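(* Let $\mathcal F$ be a family of confocal quadrics in $\mathbf P^3$. There exist configurations consisting of $12$ planes in $\mathbf P^3$ with the following properties: (1) The planes may be organized in $8$ triplets, such that each plane in a triplet is tangent to a different quadric from $\mathcal F$ and the three touching points are collinear. Every plane in the configuration is a member of two triplets. (2) The planes may be organized in $6$ quadruplets, such that the planes in each quadruplet belong to a pencil and they are tangent to two different quadrics from $\mathcal F$. Every plane in the configuration is a member of two quadruplets. Moreover, such a configuration is determined by three planes tangent to three different quadrics from $\mathcal F$, with collinear touching points.
   Context: A family of quadrics in projective space is confocal if for any hyperplane the set of its poles with respect to these quadrics is a line; equivalently, the family is dual to a pencil of quadrics. A set of planes in $\mathbf P^3$ belongs to a pencil if they all contain a common line.
   Formalization: Over C, smooth quadrics; "determined" is proved for triplets in general position (else the twelve planes collapse), as uniqueness among configurations where any two planes of a triplet share a quadruplet (else triplets on a common line can be regrouped). *)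

theory Defs
  imports "HOL-Analysis.Analysis"
begin

text \<open>
  The space is the complex projective 3-space. Its points, lines and planes are the linear
  subspaces of \<^typ>\<open>complex^4\<close> of dimension 1, 2 and 3, with incidence given by inclusion.
  The form \<^const>\<open>scalar_product\<close> is bilinear (no conjugation), unlike \<open>inner\<close>; likewise
  \<open>vec.subspace\<close> and \<open>vec.dim\<close> refer to the complex vector space structure.
\<close>

type_synonym subsp = "(complex^4) set"

definition proj_point :: "subsp \<Rightarrow> bool" where
  "proj_point X \<longleftrightarrow> vec.subspace X \<and> vec.dim X = 1"

definition proj_line :: "subsp \<Rightarrow> bool" where
  "proj_line L \<longleftrightarrow> vec.subspace L \<and> vec.dim L = 2"

definition proj_plane :: "subsp \<Rightarrow> bool" where
  "proj_plane P \<longleftrightarrow> vec.subspace P \<and> vec.dim P = 3"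

definition plane_of :: "complex^4 \<Rightarrow> subsp" where
  "plane_of n = {x. scalar_product n x = 0}"

definition symmetric_mat :: "complex^4^4 \<Rightarrow> bool" where
  "symmetric_mat S \<longleftrightarrow> transpose S = S"

text \<open>Quadrics are cones in \<^typ>\<open>complex^4\<close>: unions of their projective points.\<close>

definition quadric_of :: "complex^4^4 \<Rightarrow> subsp" where
  "quadric_of S = {x. scalar_product x (S *v x) = 0}"

definition smooth_quadric :: "subsp \<Rightarrow> bool" where
  "smooth_quadric Q \<longleftrightarrow> (\<exists>S. symmetric_mat S \<and> invertible S \<and> Q = quadric_of S)"

text \<open>
  The tangent plane at a point of a smooth quadric is the polar plane of that point. Over the
  complex numbers the matrix of a smooth quadric is determined up to a nonzero factor by its set
  of points, so the choice of the matrix does not matter.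
\<close>

definition touches :: "subsp \<Rightarrow> subsp \<Rightarrow> subsp \<Rightarrow> bool" where
  "touches Q P X \<longleftrightarrow>
     (\<exists>S. symmetric_mat S \<and> invertible S \<and> Q = quadric_of S \<and>
          proj_point X \<and> X \<subseteq> Q \<and> P = {y. \<forall>x\<in>X. scalar_product x (S *v y) = 0})"

definition tangent_to :: "subsp \<Rightarrow> subsp \<Rightarrow> bool" where
  "tangent_to Q P \<longleftrightarrow> (\<exists>X. touches Q P X)"

text \<open>
  The dual quadric lives in the dual space, coordinatised by coefficient vectors of planes;
  the zero vector belongs to it because quadrics are cones.
\<close>

definition dual_quadric :: "subsp \<Rightarrow> subsp" where
  "dual_quadric Q = {n. n = 0 \<or> tangent_to Q (plane_of n)}"

definition lin_comb :: "complex \<Rightarrow> complex^4^4 \<Rightarrow> complex \<Rightarrow> complex^4^4 \<Rightarrow> complex^4^4" where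
  "lin_comb a A b B = (\<chi> i j. a * A$i$j + b * B$i$j)"

definition quadric_pencil :: "complex^4^4 \<Rightarrow> complex^4^4 \<Rightarrow> subsp set" where
  "quadric_pencil A B = {quadric_of (lin_comb a A b B) | a b. (a, b) \<noteq> (0, 0)}"

text \<open>
  A confocal family consists of all smooth quadrics whose duals belong to a fixed pencil.
  Singular members of the dual pencil are not duals of quadrics. The family being nonempty
  amounts to the pencil having a nonsingular member.
\<close>

definition confocal_family :: "subsp set \<Rightarrow> bool" where
  "confocal_family F \<longleftrightarrow> F \<noteq> {} \<and>
     (\<exists>A B. symmetric_mat A \<and> symmetric_mat B \<and>
            (\<forall>a b. lin_comb a A b B = 0 \<longrightarrow> a = 0 \<and> b = 0) \<and>
            F = {Q. smooth_quadric Q \<and> dual_quadric Q \<in> quadric_pencil A B})"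

definition in_pencil :: "subsp set \<Rightarrow> bool" where
  "in_pencil s \<longleftrightarrow> (\<exists>L. proj_line L \<and> (\<forall>P\<in>s. proj_plane P \<and> L \<subseteq> P))"

text \<open>
  \<open>t\<close> is a set of three planes; \<open>Q P\<close> is the quadric touched by \<open>P \<in> t\<close> and \<open>X P\<close> is the
  touching point.
\<close>

definition tangent_triplet ::
  "subsp set \<Rightarrow> subsp set \<Rightarrow> (subsp \<Rightarrow> subsp) \<Rightarrow> (subsp \<Rightarrow> subsp) \<Rightarrow> bool" where
  "tangent_triplet F t Q X \<longleftrightarrow>
     card t = 3 \<and> inj_on Q t \<and> (\<forall>P\<in>t. Q P \<in> F \<and> touches (Q P) P (X P)) \<and>
     (\<exists>L. proj_line L \<and> (\<forall>P\<in>t. X P \<subseteq> L))"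

text \<open>
  A pencil of planes contains at most two planes tangent to a given smooth quadric, unless its
  axis lies on the quadric; so two planes of a quadruplet belong to each of the two quadrics.
\<close>

definition tangent_quadruplet :: "subsp set \<Rightarrow> subsp set \<Rightarrow> bool" where
  "tangent_quadruplet F u \<longleftrightarrow>
     card u = 4 \<and> in_pencil u \<and>
     (\<exists>Q\<in>F. \<exists>Q'\<in>F. Q \<noteq> Q' \<and>
        (\<exists>v\<subseteq>u. card v = 2 \<and> (\<forall>P\<in>v. tangent_to Q P) \<and> (\<forall>P\<in>u - v. tangent_to Q' P)))"

definition twelve_plane_configuration ::
  "subsp set \<Rightarrow> subsp set \<Rightarrow> subsp set set \<Rightarrow> subsp set set \<Rightarrow> bool" where
  "twelve_plane_configuration F S T U \<longleftrightarrow>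
     (\<forall>P\<in>S. proj_plane P) \<and> card S = 12 \<and>
     card T = 8 \<and> (\<forall>t\<in>T. t \<subseteq> S \<and> (\<exists>Q X. tangent_triplet F t Q X)) \<and>
     (\<forall>P\<in>S. card {t\<in>T. P \<in> t} = 2) \<and>
     card U = 6 \<and> (\<forall>u\<in>U. u \<subseteq> S \<and> tangent_quadruplet F u) \<and>
     (\<forall>P\<in>S. card {u\<in>U. P \<in> u} = 2)"

text \<open>
  Compatibility of the two organisations of a configuration: the triplets and quadruplets are
  the vertices and faces of a cube whose edges are the planes.
\<close>

definition linked :: "subsp set set \<Rightarrow> subsp set set \<Rightarrow> bool" where
  "linked T U \<longleftrightarrow> (\<forall>t\<in>T. \<forall>P\<in>t. \<forall>P'\<in>t. \<exists>u\<in>U. P \<in> u \<and> P' \<in> u)"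

definition tangent_planes_through :: "subsp \<Rightarrow> subsp \<Rightarrow> subsp \<Rightarrow> subsp set" where
  "tangent_planes_through L Q Q' = {R. proj_plane R \<and> L \<subseteq> R \<and> (tangent_to Q R \<or> tangent_to Q' R)}"

text \<open>
  General position of three tangent planes with respect to the quadrics they touch: they have
  no common line; the pencil spanned by two of them contains four different tangent planes of
  their two quadrics; and the same holds for the pencil spanned by \<open>R\<close> and \<open>R'\<close>, the other
  tangent planes to \<open>Q P\<close> and \<open>Q P'\<close> in the pencils spanned by the third plane \<open>K\<close> with \<open>P\<close>
  and \<open>P'\<close>. Outside this situation some of the twelve planes coincide or touch all quadrics
  of the family.
\<close>

definition general_position :: "subsp set \<Rightarrow> (subsp \<Rightarrow> subsp) \<Rightarrow> bool" where
  "general_position t Q \<longleftrightarrow>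
     \<not> in_pencil t \<and>
     (\<forall>P\<in>t. \<forall>P'\<in>t. P \<noteq> P' \<longrightarrow>
        card (tangent_planes_through (P \<inter> P') (Q P) (Q P')) = 4) \<and>
     (\<forall>P\<in>t. \<forall>P'\<in>t. \<forall>K\<in>t. \<forall>R R'.
        P \<noteq> P' \<and> P \<noteq> K \<and> P' \<noteq> K \<and> R \<noteq> P \<and> R' \<noteq> P' \<and>
        P \<inter> K \<subseteq> R \<and> tangent_to (Q P) R \<and> P' \<inter> K \<subseteq> R' \<and> tangent_to (Q P') R' \<longrightarrow>
        card (tangent_planes_through (R \<inter> R') (Q P) (Q P')) = 4)"

end

theory Submission
  imports Defs "HOL-Computational_Algebra.Polynomial"
begin

text \<open>
  In the dual space a plane is a vector \<open>n\<close> up to scaling, and the family is a pencil of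
  quadratic forms: the plane \<open>n\<close> touches the quadric of the form \<open>M\<close> if and only if
  \<open>n \<cdot> M n = 0\<close>, and then the touching point is \<open>M n\<close>. Three members can be scaled so that
  \<open>M\<^sub>1 + M\<^sub>2 + M\<^sub>3 = 0\<close>, and three tangent planes with collinear touching points so that
  \<open>M\<^sub>1 n\<^sub>1 + M\<^sub>2 n\<^sub>2 + M\<^sub>3 n\<^sub>3 = 0\<close>. Linear algebra then yields scalars \<open>y\<^sub>i\<close> such that every form of the
  pencil has the Gram matrix \<open>w\<^sub>i y\<^sub>i + w\<^sub>k y\<^sub>k + 2 w\<^sub>i \<delta>\<^sub>i\<^sub>k\<close> on the \<open>n\<^sub>i\<close>, where only the weights
  \<open>w\<close> depend on the form and \<open>w\<^sub>i = 0\<close> for \<open>M\<^sub>i\<close>. At a vector whose coordinates \<open>x\<^sub>k\<close> add up to 1, the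
  form is \<open>2 \<Sum>\<^sub>k w\<^sub>k x\<^sub>k (x\<^sub>k + y\<^sub>k)\<close>, so \<open>M\<^sub>i\<close> vanishes wherever \<open>x\<^sub>k \<in> {0, - y\<^sub>k}\<close> for the two indices
  \<open>k \<noteq> i\<close>; these are the twelve planes. Indexing the vertices of a cube by sets \<open>J\<close> and putting
  \<open>Y = 1 + \<Sum>\<^sub>J y\<^sub>j\<close> and \<open>G = \<Sum>\<^sub>J y\<^sub>j n\<^sub>j\<close>, the planes at the vertex \<open>J\<close> are \<open>Y n\<^sub>i - G\<close>, which makes the
  collinearity of their touching points obvious.

  For uniqueness, each of the twelve planes touches only one member of the family, and a pencil of
  planes contains just two planes tangent to that member; so the first three quadruplets
  are forced, then the three neighbouring triplets, then the other quadruplets and triplets.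

  For existence, three arbitrary members of the family admit a suitable triplet. Prescribing
  \<open>p = M\<^sub>1 (n\<^sub>1 - n\<^sub>3) = M\<^sub>2 (n\<^sub>3 - n\<^sub>2)\<close>, the conditions on \<open>p\<close> and then on the direction of \<open>n\<^sub>3\<close> are to lie
  on a nondegenerate quadratic cone and off finitely many others. Such a cone is irreducible, so it
  suffices that none of the other forms is a multiple of it.
\<close>

section \<open>Planes and lines in dual coordinates\<close>

abbreviation cdot :: "complex^'n \<Rightarrow> complex^'n \<Rightarrow> complex" (infixl "\<odot>" 70)
  where "x \<odot> y \<equiv> scalar_product x y"

section \<open>Linear forms through the bilinear dot product\<close>

lemma dot_simps [simp]:
  "(x + y) \<odot> z = x \<odot> z + y \<odot> z" "z \<odot> (x + y) = z \<odot> x + z \<odot> y"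
  "(x - y) \<odot> z = x \<odot> z - y \<odot> z" "z \<odot> (x - y) = z \<odot> x - z \<odot> y"
  "(- x) \<odot> z = - (x \<odot> z)" "z \<odot> (- x) = - (z \<odot> x)"
  "(c *s x) \<odot> z = c * (x \<odot> z)" "z \<odot> (c *s x) = c * (z \<odot> x)"
  "0 \<odot> z = 0" "z \<odot> 0 = 0"
  by (simp_all add: scalar_product_def algebra_simps sum.distrib sum_subtractf sum_negf sum_distrib_left)

lemma dot_commute: "x \<odot> y = y \<odot> x"
  by (simp add: scalar_product_def mult.commute)

lemma dot_axis: "x \<odot> axis i 1 = x $ i"
proof -
  have "x \<odot> axis i 1 = (\<Sum>j\<in>UNIV. if j = i then x $ j else 0)"
    unfolding scalar_product_def axis_def by (rule sum.cong) auto
  then show ?thesis by simp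
qed

lemma dot_eq_0_iff: "(\<forall>x. n \<odot> x = 0) \<longleftrightarrow> n = 0"
  by (metis dot_axis dot_simps(9) vec_eq_iff zero_index)

lemma dot_eqI: "(\<And>z. m \<odot> z = n \<odot> z) \<Longrightarrow> m = n"
  by (metis dot_axis vec_eq_iff)

lemma dot_transpose: "x \<odot> (M *v y) = (transpose M *v x) \<odot> y"
proof -
  have "x \<odot> (M *v y) = (\<Sum>i\<in>UNIV. \<Sum>j\<in>UNIV. x $ i * (M $ i $ j * y $ j))"
    by (simp add: scalar_product_def matrix_vector_mult_def sum_distrib_left)
  also have "\<dots> = (\<Sum>j\<in>UNIV. \<Sum>i\<in>UNIV. x $ i * (M $ i $ j * y $ j))"
    by (rule sum.swap)
  also have "\<dots> = (transpose M *v x) \<odot> y"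
    unfolding scalar_product_def matrix_vector_mult_def transpose_def
    by (simp add: sum_distrib_right sum_distrib_left mult_ac)
  finally show ?thesis .
qed

text \<open>Choose \<open>x\<close> with \<open>a \<odot> x \<noteq> 0\<close>. Subtracting a
  multiple of \<open>x\<close> moves any \<open>z\<close> into the kernel of \<open>a\<close>, so
  \<open>m\<close> is determined by \<open>m \<odot> x\<close>.\<close>

lemma dot_kernel1:
  assumes "\<And>x. a \<odot> x = 0 \<Longrightarrow> m \<odot> x = 0"
  shows "\<exists>c. m = c *s a"
proof (cases "a = 0")
  case True
  then show ?thesis using assms dot_eq_0_iff[of m] by auto
next
  case False
  then obtain x where x: "a \<odot> x \<noteq> 0" using dot_eq_0_iff by blast
  have "m \<odot> z = ((m \<odot> x / (a \<odot> x)) *s a) \<odot> z" for z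
  proof -
    have "m \<odot> (z - (a \<odot> z / (a \<odot> x)) *s x) = 0"
      by (rule assms) (simp add: x)
    then show ?thesis by simp
  qed
  then have "m = (m \<odot> x / (a \<odot> x)) *s a" by (rule dot_eqI)
  then show ?thesis ..
qed

text \<open>Independence of a pair rather than of a set: \<open>vec.independent {a, b}\<close> would
  accept \<open>a = b \<noteq> 0\<close>.\<close>

definition indep2 :: "complex^'n \<Rightarrow> complex^'n \<Rightarrow> bool" where
  "indep2 a b \<longleftrightarrow> (\<forall>s t. s *s a + t *s b = 0 \<longrightarrow> s = 0 \<and> t = 0)"

lemma indep2_sym: "indep2 a b \<Longrightarrow> indep2 b a"
  unfolding indep2_def by (metis add.commute)

lemma indep2_nonzero:
  assumes "indep2 a b"
  shows "a \<noteq> 0" "b \<noteq> 0"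
proof -
  have "1 *s a + 0 *s b \<noteq> 0" "0 *s a + 1 *s b \<noteq> 0"
    using assms zero_neq_one unfolding indep2_def by metis+
  then show "a \<noteq> 0" "b \<noteq> 0" by auto
qed

lemma indep2_iff: "indep2 a b \<longleftrightarrow> a \<noteq> 0 \<and> (\<forall>c. b \<noteq> c *s a)"
proof
  assume i: "indep2 a b"
  have "b \<noteq> c *s a" for c
  proof
    assume "b = c *s a"
    then have "c *s a + (-1) *s b = 0" by simp
    with i show False unfolding indep2_def by (metis neg_equal_0_iff_equal zero_neq_one)
  qed
  with indep2_nonzero[OF i] show "a \<noteq> 0 \<and> (\<forall>c. b \<noteq> c *s a)" by blast
next
  assume r: "a \<noteq> 0 \<and> (\<forall>c. b \<noteq> c *s a)"
  show "indep2 a b" unfolding indep2_def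
  proof (intro allI impI)
    fix s t assume e: "s *s a + t *s b = 0"
    have "t = 0"
    proof (rule ccontr)
      assume t: "t \<noteq> 0"
      have "b = (- s / t) *s a"
      proof -
        have "(1 / t) *s (s *s a + t *s b) = 0" using e by simp
        then have "(s / t) *s a + b = 0" using t by (simp add: vec.scale_right_distrib)
        then show ?thesis by (simp add: add.commute eq_neg_iff_add_eq_0)
      qed
      with r show False by blast
    qed
    with e r show "s = 0 \<and> t = 0" by simp
  qed
qed

text \<open>By \<open>dot_kernel1\<close>, the form \<open>b\<close> does not vanish on the whole
  kernel of \<open>a\<close>; a vector where it is nonzero is rescaled.\<close>

lemma dual_basis2:
  assumes "indep2 a b"
  obtains x y where "a \<odot> x = 1" "b \<odot> x = 0" "a \<odot> y = 0" "b \<odot> y = 1"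
proof -
  have *: "\<exists>y. a \<odot> y = 0 \<and> b \<odot> y = 1" if "indep2 a b" for a b :: "complex^'a"
  proof -
    have "\<not> (\<forall>x. a \<odot> x = 0 \<longrightarrow> b \<odot> x = 0)"
      using dot_kernel1[of a b] that unfolding indep2_iff by blast
    then obtain x where "a \<odot> x = 0" "b \<odot> x \<noteq> 0" by blast
    then show ?thesis by (intro exI[of _ "(1 / (b \<odot> x)) *s x"]) simp
  qed
  from *[OF assms] *[OF indep2_sym[OF assms]] that show thesis by blast
qed

text \<open>The difference of \<open>z\<close> and its projection along a dual basis is killed by
  \<open>a\<close> and \<open>b\<close>, hence by \<open>m\<close>.\<close>

lemma dot_kernel2:
  assumes i: "indep2 a b" and "\<And>x. a \<odot> x = 0 \<Longrightarrow> b \<odot> x = 0 \<Longrightarrow> m \<odot> x = 0"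
  shows "\<exists>s t. m = s *s a + t *s b"
proof -
  obtain x y where xy: "a \<odot> x = 1" "b \<odot> x = 0" "a \<odot> y = 0" "b \<odot> y = 1"
    using dual_basis2[OF i] .
  have "m \<odot> z = ((m \<odot> x) *s a + (m \<odot> y) *s b) \<odot> z" for z
  proof -
    have "m \<odot> (z - ((a \<odot> z) *s x + (b \<odot> z) *s y)) = 0"
      by (rule assms) (simp_all add: xy)
    then show ?thesis by (simp add: algebra_simps)
  qed
  then have "m = (m \<odot> x) *s a + (m \<odot> y) *s b"
    by (rule dot_eqI)
  then show ?thesis by blast
qed

section \<open>Planes, lines and pencils in terms of coefficient vectors\<close>

lemma subspace_plane_of: "vec.subspace (plane_of n)"
  by (simp add: vec.subspace_def plane_of_def)

lemma dim_UNIV4: "vec.dim (UNIV :: (complex^4) set) = 4"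
  by (rule trans[OF vec_dim_card]) simp

lemma dim_less_if_psubset:
  assumes "vec.subspace S" "vec.subspace T" "S \<subset> T"
  shows "vec.dim S < vec.dim (T :: (complex^4) set)"
  using vec.subspace_dim_equal[OF assms(1,2)] assms(3) by (metis linorder_not_le psubsetE)

lemma span_plane_point:
  assumes "n \<odot> x \<noteq> 0"
  shows "vec.span (insert x (plane_of n)) = UNIV"
proof -
  have "z - ((n \<odot> z) / (n \<odot> x)) *s x \<in> plane_of n" for z
    using assms by (simp add: plane_of_def)
  then have "z \<in> vec.span (insert x (plane_of n))" for z
    unfolding vec.span_breakdown_eq by (blast intro: vec.span_base)
  then show ?thesis by blast
qed

text \<open>Adjoining one vector off the plane spans the space and raises the dimension by at most
  one; being a proper subspace gives the other bound.\<close>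

lemma proj_plane_plane_of: "proj_plane (plane_of n) \<longleftrightarrow> n \<noteq> 0"
proof
  assume "proj_plane (plane_of n)"
  moreover have "plane_of (0 :: complex^4) = UNIV" by (simp add: plane_of_def)
  ultimately show "n \<noteq> 0" by (auto simp del: vec.dim_UNIV simp: proj_plane_def dim_UNIV4)
next
  assume "n \<noteq> 0"
  then obtain x where x: "n \<odot> x \<noteq> 0" using dot_eq_0_iff by blast
  have "vec.dim (insert x (plane_of n)) = 4"
    using span_plane_point[OF x] dim_UNIV4 by (metis vec.dim_span)
  then have "4 \<le> vec.dim (plane_of n) + 1"
    by (simp add: vec.dim_insert split: if_splits)
  moreover have "plane_of n \<subset> UNIV" using x by (auto simp: plane_of_def)
  then have "vec.dim (plane_of n) < 4"
    using dim_less_if_psubset[OF subspace_plane_of vec.subspace_UNIV] dim_UNIV4 by metis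
  ultimately show "proj_plane (plane_of n)"
    by (simp add: proj_plane_def subspace_plane_of)
qed

lemma plane_of_scale: "c \<noteq> 0 \<Longrightarrow> plane_of (c *s n) = plane_of n"
  by (simp add: plane_of_def)

lemma plane_of_eqD:
  assumes "plane_of a = plane_of b" "a \<noteq> 0"
  shows "\<exists>c. c \<noteq> 0 \<and> b = c *s a"
proof -
  have "b \<noteq> 0" using assms by (metis proj_plane_plane_of)
  moreover obtain c where "b = c *s a"
    using dot_kernel1[of a b] assms by (auto simp: plane_of_def set_eq_iff)
  ultimately show ?thesis by auto
qed

lemma plane_of_eq_iff:
  assumes "a \<noteq> 0"
  shows "plane_of a = plane_of b \<longleftrightarrow> (\<exists>c. c \<noteq> 0 \<and> b = c *s a)"
  using plane_of_eqD[OF _ assms] plane_of_scale by metis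

lemma indep2_plane_of_iff:
  assumes "a \<noteq> 0" "b \<noteq> 0"
  shows "indep2 a b \<longleftrightarrow> plane_of a \<noteq> plane_of b"
  using assms by (auto simp: indep2_iff plane_of_eq_iff)

text \<open>Adjoining a dual basis of \<open>a\<close>, \<open>b\<close> spans the space, so the
  dimension is at least two; it is smaller than that of a plane.\<close>

lemma proj_line_inter:
  assumes i: "indep2 a b"
  shows "proj_line (plane_of a \<inter> plane_of b)"
proof -
  obtain x y where xy: "a \<odot> x = 1" "b \<odot> x = 0" "a \<odot> y = 0" "b \<odot> y = 1"
    using dual_basis2[OF i] .
  let ?L = "plane_of a \<inter> plane_of b"
  have s: "vec.subspace ?L" by (simp add: subspace_plane_of vec.subspace_inter)
  have "z - (b \<odot> z) *s y - (a \<odot> z) *s x \<in> ?L" for z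
    by (simp add: plane_of_def xy)
  then have "z \<in> vec.span (insert y (insert x ?L))" for z
    unfolding vec.span_breakdown_eq[of z y]
    unfolding vec.span_breakdown_eq by (blast intro: vec.span_base)
  then have "vec.span (insert y (insert x ?L)) = UNIV" by blast
  then have "vec.dim (insert y (insert x ?L)) = 4"
    using dim_UNIV4 by (metis vec.dim_span)
  then have "4 \<le> vec.dim ?L + 2"
    unfolding vec.dim_insert by (simp split: if_splits)
  moreover have "vec.dim ?L < vec.dim (plane_of a)"
  proof (rule dim_less_if_psubset[OF s subspace_plane_of])
    have "y \<in> plane_of a" "y \<notin> ?L" using xy by (simp_all add: plane_of_def)
    then show "?L \<subset> plane_of a" by blast
  qed
  moreover have "vec.dim (plane_of a) = 3"
    using proj_plane_plane_of[of a] indep2_nonzero[OF i] by (simp add: proj_plane_def)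
  ultimately show ?thesis using s by (simp add: proj_line_def)
qed

text \<open>Two different planes meet in a line, so any common line is their whole intersection.
  Thus two planes determine the axis of a pencil.\<close>

lemma pencil_axis:
  assumes i: "indep2 a b" and L: "proj_line L" "L \<subseteq> plane_of a" "L \<subseteq> plane_of b"
  shows "L = plane_of a \<inter> plane_of b"
  using vec.subspace_dim_equal[of L "plane_of a \<inter> plane_of b"] L proj_line_inter[OF i]
  by (simp add: proj_line_def)

lemma plane_through_axis_iff:
  assumes i: "indep2 a b"
  shows "plane_of a \<inter> plane_of b \<subseteq> plane_of m \<longleftrightarrow> (\<exists>s t. m = s *s a + t *s b)"
proof
  assume "plane_of a \<inter> plane_of b \<subseteq> plane_of m"
  then show "\<exists>s t. m = s *s a + t *s b"
    using dot_kernel2[OF i, of m] by (auto simp: plane_of_def)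
qed (auto simp: plane_of_def)

lemma in_pencil_iff:
  assumes i: "indep2 a b" and "plane_of a \<in> s" "plane_of b \<in> s"
  shows "in_pencil s \<longleftrightarrow> (\<forall>P\<in>s. proj_plane P \<and> plane_of a \<inter> plane_of b \<subseteq> P)"
  using proj_line_inter[OF i] pencil_axis[OF i] assms(2,3) unfolding in_pencil_def by metis

section \<open>Points and collinear triples\<close>

lemma span_singleton_subset_iff:
  assumes "vec.subspace L"
  shows "vec.span {x} \<subseteq> L \<longleftrightarrow> x \<in> L"
  using assms by (metis vec.span_base insertI1 subsetD vec.span_minimal empty_subsetI insert_subset)

lemma proj_pointE:
  assumes "proj_point X"
  obtains x where "x \<noteq> 0" "X = vec.span {x}"
proof -
  obtain B where B: "B \<subseteq> X" "vec.independent B" "X \<subseteq> vec.span B" "card B = 1"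
    using vec.basis_exists[of X] assms unfolding proj_point_def by metis
  then obtain x where x: "B = {x}" by (metis card_1_singletonE)
  have "X = vec.span {x}"
    using B x assms vec.span_minimal[of "{x}" X] by (auto simp: proj_point_def)
  moreover have "x \<noteq> 0" using B x by simp
  ultimately show thesis using that by blast
qed

lemma proj_point_span: "x \<noteq> 0 \<Longrightarrow> proj_point (vec.span {x})"
  by (simp add: proj_point_def)

text \<open>Indexing by \<open>3\<close> admits coincident points. Three independent vectors would
  force \<open>L\<close> to have dimension at least three.\<close>

lemma dependent3_in_line:
  fixes x :: "3 \<Rightarrow> complex^4"
  assumes "proj_line L" "\<And>i. x i \<in> L"
  shows "\<exists>c :: 3 \<Rightarrow> complex. (\<exists>i. c i \<noteq> 0) \<and> c 1 *s x 1 + c 2 *s x 2 + c 3 *s x 3 = 0"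
proof (rule ccontr)
  assume n: "\<not> ?thesis"
  have n': "a = 0 \<and> b = 0 \<and> c = 0" if "a *s x 1 + b *s x 2 + c *s x 3 = 0" for a b c
  proof (rule ccontr)
    assume "\<not> (a = 0 \<and> b = 0 \<and> c = 0)"
    then have "\<exists>i::3. (if i = 1 then a else if i = 2 then b else c) \<noteq> 0"
      by (auto intro: exI[of _ 1] exI[of _ 2] exI[of _ 3])
    with n that show False
      by (auto dest!: spec[of _ "\<lambda>i::3. if i = 1 then a else if i = 2 then b else c"])
  qed
  have "x 3 \<noteq> 0" using n'[of 0 0 1] by auto
  moreover have "x 2 \<notin> vec.span {x 3}"
  proof
    assume "x 2 \<in> vec.span {x 3}"
    then obtain k where "x 2 = k *s x 3" by (auto simp: vec.span_singleton)
    then show False using n'[of 0 "-1" k] by simp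
  qed
  moreover have "x 1 \<notin> vec.span {x 2, x 3}"
  proof
    assume "x 1 \<in> vec.span {x 2, x 3}"
    then obtain k l where "x 1 - k *s x 2 = l *s x 3"
      by (auto simp: vec.span_breakdown_eq[of _ "x 2"] vec.span_singleton)
    then have "(-1) *s x 1 + k *s x 2 + l *s x 3 = 0" by (simp add: algebra_simps)
    then show False using n'[of "-1" k l] by simp
  qed
  ultimately have "vec.dim {x 1, x 2, x 3} = 3"
    by (simp add: vec.dim_insert)
  moreover have "vec.dim {x 1, x 2, x 3} \<le> vec.dim L"
    using assms by (intro vec.dim_subset) auto
  ultimately show False using assms by (simp add: proj_line_def)
qed

section \<open>Quadratic forms and generic points of cones\<close>

definition bform :: "complex^'n^'n \<Rightarrow> complex^'n \<Rightarrow> complex^'n \<Rightarrow> complex" where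
  "bform M x y = x \<odot> (M *v y)"

text \<open>Forms are functions here, so that products of linear forms and forms pulled back along a
  matrix can be treated without naming a matrix.\<close>

definition symbil :: "(complex^'n \<Rightarrow> complex^'n \<Rightarrow> complex) \<Rightarrow> bool" where
  "symbil B \<longleftrightarrow> (\<forall>x y. B x y = B y x) \<and> (\<forall>x y z. B (x + y) z = B x z + B y z) \<and>
     (\<forall>c x z. B (c *s x) z = c * B x z)"

lemma symbil_simps:
  assumes "symbil B"
  shows "B (x + y) z = B x z + B y z" "B z (x + y) = B z x + B z y"
    "B (x - y) z = B x z - B y z" "B z (x - y) = B z x - B z y"
    "B (- x) z = - B x z" "B z (- x) = - B z x"
    "B (c *s x) z = c * B x z" "B z (c *s x) = c * B z x"
    "B 0 z = 0" "B z 0 = 0"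
proof -
  note S = assms[unfolded symbil_def]
  have a: "B (x + y) z = B x z + B y z" for x y z using S by blast
  have s: "B (c *s x) z = c * B x z" for x z c using S by blast
  have c: "B x y = B y x" for x y using S by blast
  have m: "B (- x) z = - B x z" for x z using s[of "-1" x z] by simp
  show "B (x + y) z = B x z + B y z" "B (c *s x) z = c * B x z" by (fact a s)+
  show "B z (x + y) = B z x + B z y" "B z (c *s x) = c * B z x" using a s c by metis+
  show "B (- x) z = - B x z" by (fact m)
  show "B z (- x) = - B z x" using m c by metis
  show "B (x - y) z = B x z - B y z" using a[of x "- y" z] m by simp
  show "B z (x - y) = B z x - B z y" using a[of x "- y" z] m c by (metis diff_conv_add_uminus)
  show "B 0 z = 0" using s[of 0 0 z] by simp
  show "B z 0 = 0" using s[of 0 0 z] c by simp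
qed

lemma symbil_commute: "symbil B \<Longrightarrow> B x y = B y x"
  by (simp add: symbil_def)

lemma symbil_polarization:
  assumes "symbil B"
  shows "B x y = (B (x + y) (x + y) - B x x - B y y) / 2"
  using symbil_commute[OF assms, of y x] by (simp add: symbil_simps[OF assms])

lemma symbil_dot_sq: "symbil (\<lambda>x y. (a \<odot> x) * (a \<odot> y))"
  by (simp add: symbil_def algebra_simps)

lemma bform_simps [simp]:
  "bform M (x + y) z = bform M x z + bform M y z" "bform M z (x + y) = bform M z x + bform M z y"
  "bform M (x - y) z = bform M x z - bform M y z" "bform M z (x - y) = bform M z x - bform M z y"
  "bform M (- x) z = - bform M x z" "bform M z (- x) = - bform M z x"
  "bform M (c *s x) z = c * bform M x z" "bform M z (c *s x) = c * bform M z x"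
  "bform M 0 z = 0" "bform M z 0 = 0"
  by (simp_all add: bform_def vec.add vec.diff vec.scale vec.neg)

lemma symmetric_mat_transpose: "symmetric_mat M \<Longrightarrow> transpose M = M"
  by (simp add: symmetric_mat_def)

lemma bform_commute:
  fixes M :: "complex^4^4"
  assumes "symmetric_mat M"
  shows "bform M x y = bform M y x"
  unfolding bform_def dot_transpose[of x] symmetric_mat_transpose[OF assms] by (rule dot_commute)

lemma symbil_bform: "symmetric_mat M \<Longrightarrow> symbil (bform M)"
  using bform_commute by (auto simp: symbil_def)

lemma bform_eq_dot: "symmetric_mat M \<Longrightarrow> bform M x y = (M *v x) \<odot> y"
  by (metis bform_commute bform_def dot_commute)

lemma invertible_ker:
  fixes M :: "complex^'n^'n"
  shows "invertible M \<Longrightarrow> M *v x = 0 \<longleftrightarrow> x = 0"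
  using inj_matrix_vector_mult[of M] by (metis injD matrix_vector_mult_0_right)

lemma bform_nondegenerate:
  assumes "symmetric_mat M" "invertible M" "\<And>y. bform M x y = 0"
  shows "x = 0"
  using dot_eq_0_iff[of "M *v x"] invertible_ker[OF assms(2), of x] assms(1,3)
  by (metis bform_eq_dot)

text \<open>A substitute for polynomial functions in several variables: genericity arguments only
  need their restrictions to lines.\<close>

definition line_poly :: "(complex^'n \<Rightarrow> complex) \<Rightarrow> bool" where
  "line_poly f \<longleftrightarrow> (\<forall>x z. \<exists>p. \<forall>s. f (x + s *s z) = poly p s)"

lemma line_poly_const: "line_poly (\<lambda>_. c)"
  unfolding line_poly_def by (intro allI exI[of _ "[:c:]"]) simp

lemma line_poly_mult: "line_poly f \<Longrightarrow> line_poly g \<Longrightarrow> line_poly (\<lambda>x. f x * g x)"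
  unfolding line_poly_def by (metis poly_mult)

lemma line_poly_diff: "line_poly f \<Longrightarrow> line_poly g \<Longrightarrow> line_poly (\<lambda>x. f x - g x)"
  unfolding line_poly_def by (metis poly_diff)

lemma line_poly_prod:
  "(\<And>i. i \<in> I \<Longrightarrow> line_poly (f i)) \<Longrightarrow> line_poly (\<lambda>x. \<Prod>i\<in>I. f i x)"
  by (induction I rule: infinite_finite_induct) (auto intro: line_poly_const line_poly_mult)

lemma line_poly_symbil1:
  assumes "symbil B"
  shows "line_poly (B w)"
  unfolding line_poly_def
proof (intro allI)
  fix x z
  show "\<exists>p. \<forall>s. B w (x + s *s z) = poly p s"
    by (rule exI[of _ "[:B w x, B w z:]"]) (simp add: symbil_simps[OF assms])
qed

lemma line_poly_symbil2:
  assumes "symbil B"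
  shows "line_poly (\<lambda>x. B x x)"
  unfolding line_poly_def
proof (intro allI)
  fix x z
  show "\<exists>p. \<forall>s. B (x + s *s z) (x + s *s z) = poly p s"
    by (rule exI[of _ "[:B x x, 2 * B x z, B z z:]"])
      (simp add: symbil_simps[OF assms] symbil_commute[OF assms, of z x] algebra_simps)
qed

text \<open>On the line joining \<open>x\<close> and \<open>y\<close> both functions are nonzero
  polynomials, and their product has finitely many roots.\<close>

lemma line_poly_generic2:
  assumes f: "line_poly f" "f x \<noteq> 0" and g: "line_poly g" "g y \<noteq> 0"
  shows "\<exists>z. f z \<noteq> 0 \<and> g z \<noteq> 0"
proof -
  obtain p where p: "\<And>s. f (x + s *s (y - x)) = poly p s"
    using f(1) unfolding line_poly_def by metis
  obtain r where r: "\<And>s. g (x + s *s (y - x)) = poly r s"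
    using g(1) unfolding line_poly_def by metis
  have "p \<noteq> 0" using p[of 0] f(2) by auto
  moreover have "r \<noteq> 0" using r[of 1] g(2) by auto
  ultimately have "p * r \<noteq> 0" by simp
  then have "finite {s. poly (p * r) s = 0}" by (rule poly_roots_finite)
  then obtain s where "poly (p * r) s \<noteq> 0"
    using infinite_UNIV_char_0[where 'a = complex] by (metis (mono_tags, lifting) UNIV_eq_I mem_Collect_eq)
  then show ?thesis using p[of s] r[of s] by (intro exI[of _ "x + s *s (y - x)"]) auto
qed

text \<open>Induction, with the product of the functions treated so far as the first function of
  \<open>line_poly_generic2\<close>.\<close>

lemma line_poly_generic:
  assumes "finite I" "\<And>i. i \<in> I \<Longrightarrow> line_poly (f i)" "\<And>i. i \<in> I \<Longrightarrow> \<exists>x. f i x \<noteq> 0"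
  shows "\<exists>x. \<forall>i\<in>I. f i x \<noteq> 0"
  using assms
proof (induction I rule: finite_induct)
  case (insert i I)
  then obtain x where "\<forall>i\<in>I. f i x \<noteq> 0" by auto
  then have "(\<Prod>i\<in>I. f i x) \<noteq> 0" using insert.hyps by simp
  moreover obtain y where "f i y \<noteq> 0" using insert.prems by blast
  moreover have "line_poly (\<lambda>x. \<Prod>i\<in>I. f i x)" "line_poly (f i)"
    using insert.prems by (auto intro: line_poly_prod)
  ultimately obtain z where "(\<Prod>i\<in>I. f i z) \<noteq> 0" "f i z \<noteq> 0"
    using line_poly_generic2[of "\<lambda>x. \<Prod>i\<in>I. f i x" x "f i" y] by blast
  then show ?case using insert.hyps by (intro exI[of _ z]) auto
qed auto

text \<open>Such functions have no zero divisors: two that are not identically zero are both nonzero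
  at some common point.\<close>

lemma line_poly_cancel:
  assumes "line_poly f" "line_poly g" "f x \<noteq> 0" "\<And>z. f z * g z = 0"
  shows "g y = 0"
  using line_poly_generic2[OF assms(1,3,2), of y] assms(4) by (metis mult_eq_0_iff)

section \<open>Isotropic vectors and generic points of a nondegenerate cone\<close>

lemma quadratic_root:
  fixes a b c :: complex
  assumes "a \<noteq> 0"
  shows "\<exists>t. a * t\<^sup>2 + 2 * b * t + c = 0"
proof -
  define r where "r = csqrt (b\<^sup>2 - a * c)"
  define t where "t = (r - b) / a"
  have r: "r\<^sup>2 = b\<^sup>2 - a * c" by (simp add: r_def)
  have t: "a * t = r - b" using assms by (simp add: t_def)
  have "a * (a * t\<^sup>2 + 2 * b * t + c) = (a * t)\<^sup>2 + 2 * b * (a * t) + a * c"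
    by (simp add: power2_eq_square algebra_simps)
  also have "\<dots> = 0" unfolding t using r by (simp add: power2_eq_square algebra_simps)
  finally show ?thesis using assms by auto
qed

text \<open>On the span of two coordinate vectors the condition becomes a quadratic equation,
  solvable over the complex numbers.\<close>

lemma isotropic_vector_exists:
  assumes "symmetric_mat (S :: complex^4^4)"
  shows "\<exists>w. w \<noteq> 0 \<and> bform S w w = 0"
proof (cases "bform S (axis 1 1) (axis 1 1) = 0")
  case True
  moreover have "axis 1 (1::complex) \<noteq> (0 :: complex^4)" by (simp add: axis_eq_0_iff)
  ultimately show ?thesis by blast
next
  case False
  let ?x = "axis 1 1 :: complex^4" and ?y = "axis 2 1 :: complex^4"
  obtain t where t: "bform S ?x ?x * t\<^sup>2 + 2 * bform S ?x ?y * t + bform S ?y ?y = 0"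
    using quadratic_root[OF False] by blast
  have "bform S (t *s ?x + ?y) (t *s ?x + ?y) = 0"
    using t bform_commute[OF assms, of ?y ?x] by (simp add: power2_eq_square algebra_simps)
  moreover have "(t *s ?x + ?y) $ 2 \<noteq> 0" by (simp add: axis_def)
  then have "t *s ?x + ?y \<noteq> 0" by (metis zero_index)
  ultimately show ?thesis by blast
qed

text \<open>If the form vanished on the hyperplane, polarization would make each of its vectors
  orthogonal to all of it, hence a multiple of \<open>w\<close>; but its dimension is three.\<close>

lemma hyperplane_not_isotropic:
  assumes S: "symmetric_mat (S :: complex^4^4)" "invertible S" and w: "w \<noteq> 0"
  shows "\<exists>z. bform S w z = 0 \<and> bform S z z \<noteq> 0"
proof (rule ccontr)
  assume "\<not> ?thesis"
  then have iso: "bform S z z = 0" if "bform S w z = 0" for z using that by blast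
  have orth: "bform S z z' = 0" if "bform S w z = 0" "bform S w z' = 0" for z z'
    using iso[of "z + z'"] iso[of z] iso[of z'] that bform_commute[OF S(1), of z' z] by simp
  have "z \<in> vec.span {w}" if z: "bform S w z = 0" for z
  proof -
    have "\<exists>c. S *v z = c *s (S *v w)"
    proof (rule dot_kernel1)
      fix z' assume "(S *v w) \<odot> z' = 0"
      then show "(S *v z) \<odot> z' = 0" using orth[OF z] by (simp add: bform_eq_dot[OF S(1)])
    qed
    then obtain c where "S *v z = c *s (S *v w)" ..
    then have "S *v (z - c *s w) = 0" by (simp add: vec.diff vec.scale)
    then have "z = c *s w" using invertible_ker[OF S(2)] by simp
    then show ?thesis unfolding vec.span_singleton by blast
  qed
  then have "plane_of (S *v w) \<subseteq> vec.span {w}"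
    by (auto simp: plane_of_def bform_eq_dot[OF S(1)])
  then have "vec.dim (plane_of (S *v w)) \<le> vec.dim {w}" by (rule vec.dim_mono)
  moreover have "vec.dim (plane_of (S *v w)) = 3"
    using proj_plane_plane_of[of "S *v w"] invertible_ker[OF S(2)] w by (simp add: proj_plane_def)
  ultimately show False by (simp split: if_splits)
qed

text \<open>
  The map \<open>y \<mapsto> S(y,y) w - 2 S(w,y) y\<close> parametrizes the cone \<open>S = 0\<close>, by projection from its
  point \<open>w\<close>.
\<close>

lemma cone_parametrization_generic:
  assumes S: "symmetric_mat (S :: complex^4^4)" "invertible S"
    and w: "w \<noteq> 0" "bform S w w = 0"
    and R: "symbil R" and np: "\<And>c. \<exists>x y. R x y \<noteq> c * bform S x y"
  defines "n \<equiv> \<lambda>y. bform S y y *s w - (2 * bform S w y) *s y"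
  shows "\<exists>y. R (n y) (n y) \<noteq> 0"
proof (rule ccontr)
  assume "\<not> ?thesis"
  then have "R (n y) (n y) = 0" for y by blast
  moreover have "R (n y) (n y) = (bform S y y)\<^sup>2 * R w w - 4 * bform S y y * bform S w y * R w y
      + 4 * (bform S w y)\<^sup>2 * R y y" for y
    unfolding n_def using symbil_commute[OF R, of y w]
    by (simp add: symbil_simps[OF R] power2_eq_square algebra_simps)
  ultimately have van: "(bform S y y)\<^sup>2 * R w w - 4 * bform S y y * bform S w y * R w y
      + 4 * (bform S w y)\<^sup>2 * R y y = 0" for y by simp
  note Ssb = symbil_bform[OF S(1)]
  obtain y0 where y0: "bform S w y0 \<noteq> 0"
    using bform_nondegenerate[OF S] w(1) by blast
  obtain z0 where z0: "bform S w z0 = 0" "bform S z0 z0 \<noteq> 0"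
    using hyperplane_not_isotropic[OF S w(1)] by blast
  \<comment> \<open>At \<open>z0\<close> all terms with the factor \<open>bform S w y\<close> drop
    out.\<close>
  have Rww: "R w w = 0" using van[of z0] z0 by simp
  \<comment> \<open>What is left has the factor \<open>bform S w y\<close>, which can be cancelled
    even at its zeros by \<open>line_poly_cancel\<close>.\<close>
  have 2: "bform S w y * R y y - bform S y y * R w y = 0" for y
  proof (rule line_poly_cancel[of "bform S w" "\<lambda>y. bform S w y * R y y - bform S y y * R w y", OF _ _ y0])
    show "line_poly (bform S w)" by (rule line_poly_symbil1[OF Ssb])
    show "line_poly (\<lambda>y. bform S w y * R y y - bform S y y * R w y)"
      by (intro line_poly_diff line_poly_mult line_poly_symbil1[OF Ssb] line_poly_symbil2[OF Ssb]
          line_poly_symbil1[OF R] line_poly_symbil2[OF R])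
    fix z
    show "bform S w z * (bform S w z * R z z - bform S z z * R w z) = 0"
      using van[of z] Rww by (simp add: power2_eq_square algebra_simps)
  qed
  have 3: "R w y = 0" if y: "bform S w y = 0" "bform S y y \<noteq> 0" for y
    using 2[of y] y by simp
  have 4: "R w y = 0" if y: "bform S w y = 0" for y
  proof -
    have Rz: "R w z0 = 0" using 3 z0 by blast
    \<comment> \<open>The parallelogram identity: if \<open>y\<close>, \<open>y + z0\<close> and
      \<open>y - z0\<close> were all isotropic, \<open>z0\<close> would be too.\<close>
    have "bform S (y + z0) (y + z0) \<noteq> 0 \<or> bform S (y - z0) (y - z0) \<noteq> 0 \<or> bform S y y \<noteq> 0"
    proof (rule ccontr)
      assume z: "\<not> ?thesis"
      have "bform S (y + z0) (y + z0) + bform S (y - z0) (y - z0) - 2 * bform S y y = 2 * bform S z0 z0"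
        by simp
      then show False using z z0 by (simp del: bform_simps)
    qed
    then have "R w (y + z0) = 0 \<or> R w (y - z0) = 0 \<or> R w y = 0"
      using 3[of "y + z0"] 3[of "y - z0"] 3[of y] y z0 by auto
    then show ?thesis using Rz by (auto simp: symbil_simps[OF R])
  qed
  \<comment> \<open>The kernel of \<open>bform S w\<close> lies in that of \<open>R w\<close>, so
    these linear forms are proportional.\<close>
  define c where "c = R w y0 / bform S w y0"
  have 5: "R w y = c * bform S w y" for y
  proof -
    have "R w (y - (bform S w y / bform S w y0) *s y0) = 0"
      by (rule 4) (use y0 in simp)
    then show ?thesis unfolding c_def by (simp add: symbil_simps[OF R])
  qed
  \<comment> \<open>By this proportionality, the identity \<open>2\<close> again has the factor
    \<open>bform S w y\<close>.\<close>
  have 6: "R y y - c * bform S y y = 0" for y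
  proof (rule line_poly_cancel[of "bform S w" "\<lambda>y. R y y - c * bform S y y", OF _ _ y0])
    show "line_poly (bform S w)" by (rule line_poly_symbil1[OF Ssb])
    show "line_poly (\<lambda>y. R y y - c * bform S y y)"
      by (intro line_poly_diff line_poly_mult line_poly_const line_poly_symbil2[OF Ssb]
          line_poly_symbil2[OF R])
    fix z
    show "bform S w z * (R z z - c * bform S z z) = 0"
      using 2[of z] 5[of z] by (simp add: algebra_simps)
  qed
  have "R x y = c * bform S x y" for x y
    unfolding symbil_polarization[OF R, of x y] symbil_polarization[OF Ssb, of x y]
    using 6[of x] 6[of y] 6[of "x + y"] by (simp only: right_minus_eq) (simp add: field_simps)
  then show False using np[of c] by blast
qed

text \<open>The parametrization turns each condition on the cone into the nonvanishing of a
  polynomial in a free vector \<open>y\<close>; none of these polynomials is identically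
  zero.\<close>

lemma cone_generic:
  assumes S: "symmetric_mat (S :: complex^4^4)" "invertible S"
    and I: "finite I" "\<And>i. i \<in> I \<Longrightarrow> symbil (R i)"
    and np: "\<And>i c. i \<in> I \<Longrightarrow> \<exists>x y. R i x y \<noteq> c * bform S x y"
  shows "\<exists>v. bform S v v = 0 \<and> (\<forall>i\<in>I. R i v v \<noteq> 0)"
proof -
  obtain w where w: "w \<noteq> 0" "bform S w w = 0"
    using isotropic_vector_exists[OF S(1)] by blast
  define n where "n = (\<lambda>y. bform S y y *s w - (2 * bform S w y) *s y)"
  note Ssb = symbil_bform[OF S(1)]
  have "\<exists>y. \<forall>i\<in>I. R i (n y) (n y) \<noteq> 0"
  proof (rule line_poly_generic[OF I(1)])
    fix i assume i: "i \<in> I"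
    show "\<exists>y. R i (n y) (n y) \<noteq> 0"
      unfolding n_def by (rule cone_parametrization_generic[OF S w I(2)[OF i] np[OF i]])
    have "R i (n y) (n y) = bform S y y * bform S y y * R i w w
        - (4 * bform S y y * bform S w y * R i w y - 4 * bform S w y * bform S w y * R i y y)" for y
      unfolding n_def using symbil_commute[OF I(2)[OF i], of y w]
      by (simp add: symbil_simps[OF I(2)[OF i]] algebra_simps)
    then show "line_poly (\<lambda>y. R i (n y) (n y))"
      by (simp only:) (intro line_poly_diff line_poly_mult line_poly_const line_poly_symbil1[OF Ssb]
          line_poly_symbil2[OF Ssb] line_poly_symbil1[OF I(2)[OF i]] line_poly_symbil2[OF I(2)[OF i]])
  qed
  then obtain y where "\<forall>i\<in>I. R i (n y) (n y) \<noteq> 0" ..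
  moreover have "bform S (n y) (n y) = 0"
    unfolding n_def using bform_commute[OF S(1), of y w] by (simp add: w algebra_simps)
  ultimately show ?thesis by blast
qed

text \<open>The Nullstellensatz for a nondegenerate quadric, as the case of a single form in
  \<open>cone_generic\<close>.\<close>

lemma vanishing_on_cone:
  assumes S: "symmetric_mat (S :: complex^4^4)" "invertible S" and R: "symbil R"
    and "\<And>x. bform S x x = 0 \<Longrightarrow> R x x = 0"
  shows "\<exists>c. \<forall>x y. R x y = c * bform S x y"
proof (rule ccontr)
  assume "\<not> ?thesis"
  then have "\<exists>x y. R x y \<noteq> c * bform S x y" for c by blast
  with cone_generic[OF S, of "{()}" "\<lambda>_. R"] R have "\<exists>v. bform S v v = 0 \<and> R v v \<noteq> 0" by auto
  with assms(4) show False by blast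
qed

text \<open>A square of a linear form has rank one: a nonzero vector of the plane \<open>z\<close>
  would lie in the radical of \<open>S\<close>.\<close>

lemma dot_sq_not_multiple:
  assumes S: "symmetric_mat (S :: complex^4^4)" "invertible S" and "z \<noteq> 0"
  shows "\<exists>x y. (z \<odot> x) * (z \<odot> y) \<noteq> c * bform S x y"
proof (rule ccontr)
  assume "\<not> ?thesis"
  then have e: "(z \<odot> x) * (z \<odot> y) = c * bform S x y" for x y by blast
  obtain x where x: "z \<odot> x \<noteq> 0" using \<open>z \<noteq> 0\<close> dot_eq_0_iff by blast
  have "c \<noteq> 0" using e[of x x] x by auto
  have "vec.dim (plane_of z) = 3" using \<open>z \<noteq> 0\<close> proj_plane_plane_of[of z] by (simp add: proj_plane_def)
  then have "\<exists>y\<in>plane_of z. y \<noteq> 0"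
    by (metis vec.dim_eq_0 singletonI subsetI insert_iff zero_neq_numeral)
  then obtain y where "y \<noteq> 0" "z \<odot> y = 0" by (auto simp: plane_of_def)
  then have "bform S y u = 0" for u using e[of y u] \<open>c \<noteq> 0\<close> by simp
  then show False using bform_nondegenerate[OF S] \<open>y \<noteq> 0\<close> by blast
qed

section \<open>Confocal families as pencils of dual forms\<close>

lemma quadric_of_bform: "quadric_of S = {x. bform S x x = 0}"
  by (simp add: quadric_of_def bform_def)

lemma bform_multiple_iff:
  "(\<forall>x y. bform R x y = c * bform S x y) \<longleftrightarrow> (\<forall>y. R *v y = c *s (S *v y))"
proof
  assume l: "\<forall>x y. bform R x y = c * bform S x y"
  show "\<forall>y. R *v y = c *s (S *v y)"
  proof
    fix y show "R *v y = c *s (S *v y)"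
      by (rule dot_eqI) (use l in \<open>simp add: bform_def dot_commute[of _ z for z]\<close>)
  qed
qed (simp add: bform_def)

section \<open>Inverse matrices of symmetric forms\<close>

lemma invertible_action_nonzero:
  fixes M :: "complex^'n^'n"
  assumes "invertible M" "\<And>x. M *v x = 0"
  shows False
proof -
  have "(1 :: complex^'n) = 0" using assms invertible_ker[of M] by blast
  then show False by (simp add: vec_eq_iff)
qed

lemma matrix_inv_mult:
  fixes M :: "complex^'n^'n"
  assumes "invertible M"
  shows "M ** matrix_inv M = mat 1" "matrix_inv M ** M = mat 1"
  using someI_ex[OF assms[unfolded invertible_def]] unfolding matrix_inv_def by blast+

lemma matrix_inv_vector:
  fixes M :: "complex^'n^'n"
  assumes "invertible M"
  shows "M *v (matrix_inv M *v x) = x" "matrix_inv M *v (M *v x) = x"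
  by (simp_all add: matrix_vector_mul_assoc matrix_inv_mult[OF assms])

lemma invertible_matrix_inv:
  fixes M :: "complex^'n^'n"
  shows "invertible M \<Longrightarrow> invertible (matrix_inv M)"
  using matrix_inv_mult[of M] unfolding invertible_def by blast

lemma symmetric_matI:
  assumes "\<And>x y. bform M x y = bform M y x"
  shows "symmetric_mat M"
proof -
  have "transpose M *v x = M *v x" for x
    by (rule dot_eqI) (metis assms bform_def dot_commute dot_transpose)
  then show ?thesis
    unfolding symmetric_mat_def by (simp add: matrix_eq)
qed

lemma symmetric_matrix_inv:
  fixes M :: "complex^4^4"
  assumes "symmetric_mat M" "invertible M"
  shows "symmetric_mat (matrix_inv M)"
proof (rule symmetric_matI)
  fix x y
  have "bform (matrix_inv M) x y = bform M (matrix_inv M *v x) (matrix_inv M *v y)" for x y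
    by (metis assms bform_def bform_eq_dot matrix_inv_vector(1))
  then show "bform (matrix_inv M) x y = bform (matrix_inv M) y x"
    using bform_commute[OF assms(1)] by metis
qed

lemma bform_matrix_inv_eq:
  fixes M :: "complex^4^4"
  assumes "symmetric_mat M" "invertible M"
  shows "bform (matrix_inv M) x y = bform M (matrix_inv M *v x) (matrix_inv M *v y)"
  by (metis assms bform_def bform_eq_dot matrix_inv_vector(1))

text \<open>The matrix of a smooth quadric is unique up to a factor; this makes the choice of the
  matrix in \<open>touches\<close> immaterial.\<close>

lemma quadric_of_subsetD:
  assumes "symmetric_mat S" "invertible S" "symmetric_mat R" "quadric_of S \<subseteq> quadric_of R"
  shows "\<exists>c. \<forall>y. R *v y = c *s (S *v y)"
  using vanishing_on_cone[OF assms(1,2) symbil_bform[OF assms(3)]] assms(4)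
  unfolding bform_multiple_iff by (auto simp: quadric_of_bform)

section \<open>Tangency in plane coordinates\<close>

lemma span_singleton_dot: "(\<forall>x'\<in>vec.span {x}. x' \<odot> z = 0) \<longleftrightarrow> x \<odot> z = 0"
proof
  assume "\<forall>x'\<in>vec.span {x}. x' \<odot> z = 0"
  moreover have "x \<in> vec.span {x}" by (simp add: vec.span_base)
  ultimately show "x \<odot> z = 0" by blast
next
  assume "x \<odot> z = 0"
  then show "\<forall>x'\<in>vec.span {x}. x' \<odot> z = 0" unfolding vec.span_singleton by auto
qed

text \<open>The polarity of the quadric with matrix \<open>matrix_inv M\<close> sends the point
  \<open>M *v n\<close> to the plane \<open>n\<close>, and incidence of the two means
  \<open>bform M n n = 0\<close>.\<close>

lemma touches_dual_iff:
  assumes M: "symmetric_mat M" "invertible M"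
  shows "touches (quadric_of (matrix_inv M)) P X \<longleftrightarrow>
    (\<exists>n. n \<noteq> 0 \<and> P = plane_of n \<and> bform M n n = 0 \<and> X = vec.span {M *v n})" (is "?l = ?r")
proof
  assume ?l
  then obtain S where S: "symmetric_mat S" "invertible S" "quadric_of (matrix_inv M) = quadric_of S"
    and X: "proj_point X" "X \<subseteq> quadric_of (matrix_inv M)"
    and P: "P = {y. \<forall>x\<in>X. x \<odot> (S *v y) = 0}"
    unfolding touches_def by blast
  note I = symmetric_matrix_inv[OF M] invertible_matrix_inv[OF M(2)]
  obtain x where x: "x \<noteq> 0" "X = vec.span {x}" using proj_pointE[OF X(1)] .
  obtain c where c: "\<And>y. S *v y = c *s (matrix_inv M *v y)"
    using quadric_of_subsetD[OF I S(1)] S(3) by blast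
  have c0: "c \<noteq> 0" using c[of x] x(1) invertible_ker[OF S(2), of x] by (metis vec.scale_zero_left)
  \<comment> \<open>The coefficient vector of the polar plane of \<open>x\<close>.\<close>
  let ?n = "matrix_inv M *v x"
  have "bform (matrix_inv M) x x = 0"
    using X(2) x(2) by (auto simp: quadric_of_bform intro: vec.span_base)
  then have "bform M ?n ?n = 0" using bform_matrix_inv_eq[OF M] by simp
  moreover have "?n \<noteq> 0" using invertible_ker[OF I(2)] x(1) by simp
  moreover have "X = vec.span {M *v ?n}" using x(2) matrix_inv_vector[OF M(2)] by simp
  moreover have "P = plane_of ?n"
  proof -
    have "(\<forall>x'\<in>X. x' \<odot> (S *v y) = 0) \<longleftrightarrow> x \<odot> (S *v y) = 0" for y
      unfolding x(2) by (rule span_singleton_dot)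
    moreover have "x \<odot> (S *v y) = 0 \<longleftrightarrow> ?n \<odot> y = 0" for y
      using c0 bform_eq_dot[OF I(1), of x y] unfolding c[of y] bform_def dot_simps by simp
    ultimately show ?thesis unfolding P plane_of_def by simp
  qed
  ultimately show ?r by blast
next
  assume ?r
  then obtain n where n: "n \<noteq> 0" "P = plane_of n" "bform M n n = 0" "X = vec.span {M *v n}" by blast
  note I = symmetric_matrix_inv[OF M] invertible_matrix_inv[OF M(2)]
  have "bform (matrix_inv M) (M *v n) y = n \<odot> y" for y
    using bform_eq_dot[OF I(1)] matrix_inv_vector[OF M(2)] by simp
  then have "X \<subseteq> quadric_of (matrix_inv M)"
    using n(3) unfolding n(4) vec.span_singleton by (auto simp: quadric_of_bform bform_def)
  moreover have "P = {y. \<forall>x\<in>X. x \<odot> (matrix_inv M *v y) = 0}"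
    using \<open>\<And>y. bform (matrix_inv M) (M *v n) y = n \<odot> y\<close>
    unfolding n(2,4) plane_of_def span_singleton_dot bform_def by simp
  moreover have "proj_point X" unfolding n(4)
    by (rule proj_point_span) (use n(1) invertible_ker[OF M(2)] in simp)
  ultimately show ?l unfolding touches_def using I by blast
qed

lemma span_singleton_scale: "c \<noteq> 0 \<Longrightarrow> vec.span {c *s x} = vec.span {x :: complex^'n}"
  using vec.span_image_scale[of "{x}" "\<lambda>_. c"] by simp

text \<open>A plane fixes its coefficient vector up to a nonzero factor, and the conditions are
  invariant under such factors.\<close>

lemma touches_plane_of_iff:
  assumes M: "symmetric_mat M" "invertible M"
  shows "touches (quadric_of (matrix_inv M)) (plane_of n) X \<longleftrightarrow>
    n \<noteq> 0 \<and> bform M n n = 0 \<and> X = vec.span {M *v n}" (is "?l = ?r")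
proof
  assume ?l
  then obtain m where m: "m \<noteq> 0" "plane_of n = plane_of m" "bform M m m = 0" "X = vec.span {M *v m}"
    unfolding touches_dual_iff[OF M] by blast
  then obtain c where "c \<noteq> 0" "n = c *s m" using plane_of_eqD[of m n] by metis
  then show ?r using m by (simp add: vec.scale span_singleton_scale)
qed (auto simp: touches_dual_iff[OF M])

lemma tangent_plane_of_iff:
  assumes M: "symmetric_mat M" "invertible M"
  shows "tangent_to (quadric_of (matrix_inv M)) (plane_of n) \<longleftrightarrow> n \<noteq> 0 \<and> bform M n n = 0"
  unfolding tangent_to_def touches_plane_of_iff[OF M] by blast

lemma tangent_to_planeE:
  assumes M: "symmetric_mat M" "invertible M" and "tangent_to (quadric_of (matrix_inv M)) P"
  obtains n where "n \<noteq> 0" "P = plane_of n" "bform M n n = 0"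
  using assms(3) unfolding tangent_to_def touches_dual_iff[OF M] by blast

lemma dual_quadric_quadric_of:
  assumes M: "symmetric_mat M" "invertible M"
  shows "dual_quadric (quadric_of (matrix_inv M)) = quadric_of M"
  unfolding dual_quadric_def tangent_plane_of_iff[OF M] quadric_of_bform[of M] by auto

lemma matrix_inv_multiple:
  fixes M :: "complex^'n^'n"
  assumes "invertible M" "invertible M'" "\<And>x. M' *v x = c *s (M *v x)"
  shows "matrix_inv M *v x = c *s (matrix_inv M' *v x)"
  using assms(3)[of "matrix_inv M' *v x"] matrix_inv_vector[OF assms(1)] matrix_inv_vector[OF assms(2)]
  by (metis vec.scale)

text \<open>Equal quadrics have equal duals, whose matrices agree up to a factor; conversely, a
  factor of the matrix becomes the reciprocal factor of its inverse.\<close>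

lemma dual_eq_iff:
  assumes M: "symmetric_mat M" "invertible M" and M': "symmetric_mat M'" "invertible M'"
  shows "quadric_of (matrix_inv M) = quadric_of (matrix_inv M') \<longleftrightarrow>
    (\<exists>c. c \<noteq> 0 \<and> (\<forall>x. M' *v x = c *s (M *v x)))" (is "?l = ?r")
proof
  assume ?l
  then have "quadric_of M = quadric_of M'"
    using dual_quadric_quadric_of[OF M] dual_quadric_quadric_of[OF M'] by metis
  then obtain c where c: "\<And>x. M' *v x = c *s (M *v x)"
    using quadric_of_subsetD[OF M M'(1)] by blast
  have "c \<noteq> 0"
  proof
    assume "c = 0"
    then have "M' *v x = 0" for x using c by simp
    then show False using invertible_action_nonzero[OF M'(2)] by blast
  qed
  with c show ?r by blast
next
  assume ?r
  then obtain c where c: "c \<noteq> 0" "\<And>x. M' *v x = c *s (M *v x)" by blast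
  have "bform (matrix_inv M) x x = c * bform (matrix_inv M') x x" for x
    unfolding bform_def matrix_inv_multiple[OF M(2) M'(2) c(2)] by simp
  then show ?l using c(1) by (simp add: quadric_of_bform)
qed

section \<open>Pencils of symmetric matrices\<close>

lemma lin_comb_vector: "lin_comb a A b B *v x = a *s (A *v x) + b *s (B *v x)"
  by (simp add: vec_eq_iff lin_comb_def matrix_vector_mult_def sum.distrib sum_distrib_left algebra_simps)

lemma bform_lin_comb: "bform (lin_comb a A b B) x y = a * bform A x y + b * bform B x y"
  by (simp add: bform_def lin_comb_vector)

lemma symmetric_lin_comb:
  "symmetric_mat A \<Longrightarrow> symmetric_mat B \<Longrightarrow> symmetric_mat (lin_comb a A b B)"
  by (rule symmetric_matI) (simp add: bform_lin_comb bform_commute[of A x y for x y] bform_commute[of B x y for x y])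

lemma lin_comb_eq_0:
  "(\<And>x. lin_comb a A b B *v x = 0) \<Longrightarrow> lin_comb a A b B = 0"
  by (simp add: matrix_eq)

lemma invertibleI_ker:
  fixes M :: "complex^'n^'n"
  assumes "\<And>x. M *v x = 0 \<Longrightarrow> x = 0"
  shows "invertible M"
  using assms matrix_left_invertible_ker[of M] invertible_left_inverse by blast

text \<open>The Leibniz formula, with each entry read as a polynomial of degree at most one in
  \<open>s\<close>.\<close>

lemma det_lin_comb_poly: "\<exists>p. \<forall>s. det (lin_comb 1 M s N) = poly p s"
proof -
  have "det (lin_comb 1 M s N) =
    poly (\<Sum>p\<in>{p. p permutes UNIV}. smult (of_int (sign p)) (\<Prod>i\<in>UNIV. [:M $ i $ p i, N $ i $ p i:])) s" for s
    unfolding det_def by (simp add: poly_sum poly_prod lin_comb_def)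
  then show ?thesis by blast
qed

lemma finite_singular_lin_comb:
  assumes "invertible M"
  shows "finite {s. \<not> invertible (lin_comb 1 M s N)}"
proof -
  obtain p where p: "\<And>s. det (lin_comb 1 M s N) = poly p s" using det_lin_comb_poly by metis
  have "lin_comb 1 M 0 N = M" by (simp add: lin_comb_def vec_eq_iff)
  then have "poly p 0 \<noteq> 0" using p[of 0] assms by (simp add: invertible_det_nz)
  then have "p \<noteq> 0" by auto
  then have "finite {s. poly p s = 0}" by (rule poly_roots_finite)
  then show ?thesis by (simp add: invertible_det_nz p)
qed

text \<open>The working form of \<open>confocal_family\<close>: the pencil is named, and members are
  given by its invertible matrices instead of by point sets of dual quadrics.\<close>

definition pencil_family :: "subsp set \<Rightarrow> complex^4^4 \<Rightarrow> complex^4^4 \<Rightarrow> bool" where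
  "pencil_family F A B \<longleftrightarrow> F \<noteq> {} \<and> symmetric_mat A \<and> symmetric_mat B \<and>
     (\<forall>a b. lin_comb a A b B = 0 \<longrightarrow> a = 0 \<and> b = 0) \<and>
     (\<forall>Q. Q \<in> F \<longleftrightarrow> (\<exists>a b. invertible (lin_comb a A b B) \<and>
        Q = quadric_of (matrix_inv (lin_comb a A b B))))"

text \<open>The inverse matrix of a member agrees with a matrix of the pencil up to a factor. This
  is nonzero as \<open>A\<close> and \<open>B\<close> are linearly independent, so the pencil matrix
  is invertible.\<close>

lemma confocal_familyE:
  assumes "confocal_family F"
  obtains A B where "pencil_family F A B"
proof -
  obtain A B where AB: "symmetric_mat A" "symmetric_mat B"
      "\<forall>a b. lin_comb a A b B = 0 \<longrightarrow> a = 0 \<and> b = 0"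
    and F: "F = {Q. smooth_quadric Q \<and> dual_quadric Q \<in> quadric_pencil A B}" and ne: "F \<noteq> {}"
    using assms unfolding confocal_family_def by blast
  have "Q \<in> F \<longleftrightarrow> (\<exists>a b. invertible (lin_comb a A b B) \<and>
        Q = quadric_of (matrix_inv (lin_comb a A b B)))" (is "_ \<longleftrightarrow> ?r") for Q
  proof
    assume "Q \<in> F"
    then obtain S a b where S: "symmetric_mat S" "invertible S" "Q = quadric_of S"
      and ab: "dual_quadric Q = quadric_of (lin_comb a A b B)" "(a, b) \<noteq> (0, 0)"
      unfolding F smooth_quadric_def quadric_pencil_def by blast
    define M where "M = matrix_inv S"
    have M: "symmetric_mat M" "invertible M"
      using symmetric_matrix_inv invertible_matrix_inv S unfolding M_def by auto
    have "matrix_inv M = S"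
      by (simp add: matrix_eq) (metis M(2) M_def S(2) matrix_inv_vector)
    then have Q: "Q = quadric_of (matrix_inv M)" using S by simp
    then have e: "quadric_of M = quadric_of (lin_comb a A b B)"
      using ab(1) dual_quadric_quadric_of[OF M] by simp
    have s: "symmetric_mat (lin_comb a A b B)" by (rule symmetric_lin_comb[OF AB(1,2)])
    obtain c where c: "\<And>x. lin_comb a A b B *v x = c *s (M *v x)"
      using quadric_of_subsetD[OF M s] e by blast
    have "c \<noteq> 0"
    proof
      assume "c = 0"
      then have "lin_comb a A b B = 0" using c by (intro lin_comb_eq_0) simp
      then show False using AB(3) ab(2) by blast
    qed
    then have i: "invertible (lin_comb a A b B)"
      using c invertible_ker[OF M(2)] by (intro invertibleI_ker) simp
    then have "Q = quadric_of (matrix_inv (lin_comb a A b B))"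
      unfolding Q dual_eq_iff[OF M s i] using c \<open>c \<noteq> 0\<close> by blast
    with i show ?r by blast
  next
    assume ?r
    then obtain a b where i: "invertible (lin_comb a A b B)"
      and Q: "Q = quadric_of (matrix_inv (lin_comb a A b B))" by blast
    have s: "symmetric_mat (lin_comb a A b B)" by (rule symmetric_lin_comb[OF AB(1,2)])
    have "(a, b) \<noteq> (0, 0)"
    proof
      assume "(a, b) = (0, 0)"
      then have "lin_comb a A b B *v x = 0" for x by (simp add: lin_comb_vector)
    then show False using invertible_action_nonzero[OF i] by blast
    qed
    then have "dual_quadric Q \<in> quadric_pencil A B"
      unfolding Q dual_quadric_quadric_of[OF s i] quadric_pencil_def by blast
    moreover have "smooth_quadric Q"
      unfolding Q smooth_quadric_def using symmetric_matrix_inv[OF s i] invertible_matrix_inv[OF i] by blast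
    ultimately show "Q \<in> F" unfolding F by blast
  qed
  then show thesis using that AB ne unfolding pencil_family_def by blast
qed

text \<open>Three members of the family, with dual matrices scaled to add up to zero; the last
  clause says that any two of them span the pencil.\<close>

definition dual_triad :: "subsp set \<Rightarrow> (3 \<Rightarrow> complex^4^4) \<Rightarrow> bool" where
  "dual_triad F M \<longleftrightarrow> (\<forall>j. symmetric_mat (M j) \<and> invertible (M j) \<and> quadric_of (matrix_inv (M j)) \<in> F) \<and>
     inj (\<lambda>j. quadric_of (matrix_inv (M j))) \<and>
     (\<forall>x. M 1 *v x + M 2 *v x + M 3 *v x = 0) \<and>
     (\<forall>Q\<in>F. \<forall>i j. i \<noteq> j \<longrightarrow> (\<exists>N \<alpha> \<beta>. symmetric_mat N \<and> invertible N \<and>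
        Q = quadric_of (matrix_inv N) \<and> (\<forall>x. N *v x = \<alpha> *s (M i *v x) + \<beta> *s (M j *v x))))"

lemma dual_triad_exists:
  fixes q :: "3 \<Rightarrow> subsp"
  assumes F: "pencil_family F A B" and q: "inj q" "\<And>j. q j \<in> F"
  obtains M where "dual_triad F M" "\<And>j. q j = quadric_of (matrix_inv (M j))"
proof -
  have AB: "symmetric_mat A" "symmetric_mat B" and
    ind: "\<And>a b. lin_comb a A b B = 0 \<Longrightarrow> a = 0 \<and> b = 0" and
    mem: "\<And>Q. Q \<in> F \<longleftrightarrow> (\<exists>a b. invertible (lin_comb a A b B) \<and>
        Q = quadric_of (matrix_inv (lin_comb a A b B)))"
    using F unfolding pencil_family_def by auto
  note sym = symmetric_lin_comb[OF AB]
  have "\<forall>j. \<exists>a b. invertible (lin_comb a A b B) \<and> q j = quadric_of (matrix_inv (lin_comb a A b B))"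
    using q(2) mem by blast
  then obtain a b where ab: "\<And>j. invertible (lin_comb (a j) A (b j) B)"
      "\<And>j. q j = quadric_of (matrix_inv (lin_comb (a j) A (b j) B))" by metis
  have mult: "lin_comb (c * x) A (c * y) B *v v = c *s (lin_comb x A y B *v v)" for c x y v
    by (simp add: lin_comb_vector vec.scale_right_distrib)
  have nz: "a j \<noteq> 0 \<or> b j \<noteq> 0" for j
  proof (rule ccontr)
    assume "\<not> ?thesis"
    then have "lin_comb (a j) A (b j) B *v x = 0" for x by (simp add: lin_comb_vector)
    then show False using invertible_action_nonzero[OF ab(1)] by blast
  qed
  \<comment> \<open>The determinant of the coordinates of two members in the pencil; it vanishes
    only if their matrices are proportional.\<close>
  define d where "d = (\<lambda>i j. a i * b j - a j * b i)"
  have d: "d i j \<noteq> 0" if "i \<noteq> j" for i j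
  proof
    assume z: "d i j = 0"
    have "\<exists>c. c \<noteq> 0 \<and> a j = c * a i \<and> b j = c * b i"
    proof (cases "a i = 0")
      case True
      then have "b i \<noteq> 0" using nz[of i] by blast
      moreover have "a j = 0" using z True \<open>b i \<noteq> 0\<close> by (simp add: d_def)
      ultimately show ?thesis using nz[of j] True by (intro exI[of _ "b j / b i"]) auto
    next
      case False
      then have "b j = a j / a i * b i" using z by (simp add: d_def field_simps)
      moreover have "a j \<noteq> 0" using nz[of j] calculation by auto
      ultimately show ?thesis using False by (intro exI[of _ "a j / a i"]) auto
    qed
    then obtain c where "c \<noteq> 0" "a j = c * a i" "b j = c * b i" by blast
    then have "q i = q j"
      unfolding ab(2) dual_eq_iff[OF sym ab(1) sym ab(1)] using mult by metis
    then show False using q(1) that by (simp add: inj_eq)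
  qed
  \<comment> \<open>Any three vectors of the plane satisfy the linear relation whose coefficients
    are these determinants.\<close>
  define e where "e = (\<lambda>j::3. if j = 1 then d 2 3 else if j = 2 then d 3 1 else d 1 2)"
  have e: "e j \<noteq> 0" for j using d by (simp add: e_def)
  define M where "M = (\<lambda>j. lin_comb (e j * a j) A (e j * b j) B)"
  have Mm: "M j *v x = e j *s (lin_comb (a j) A (b j) B *v x)" for j x
    unfolding M_def by (rule mult)
  have Mi: "invertible (M j)" for j
    using invertible_ker[OF ab(1)[of j]] e[of j] by (intro invertibleI_ker) (simp add: Mm)
  have Ms: "symmetric_mat (M j)" for j unfolding M_def by (rule sym)
  have Mq: "q j = quadric_of (matrix_inv (M j))" for j
    unfolding ab(2) dual_eq_iff[OF sym ab(1) Ms Mi] using Mm e by metis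
  have sum0: "M 1 *v x + M 2 *v x + M 3 *v x = 0" for x
  proof -
    have "M 1 *v x + M 2 *v x + M 3 *v x = (e 1 * a 1 + e 2 * a 2 + e 3 * a 3) *s (A *v x)
       + (e 1 * b 1 + e 2 * b 2 + e 3 * b 3) *s (B *v x)"
      by (simp add: M_def lin_comb_vector vec.scale_left_distrib algebra_simps)
    also have "\<dots> = 0" by (simp add: e_def d_def algebra_simps)
    finally show ?thesis .
  qed
  have span: "\<exists>N \<alpha> \<beta>. symmetric_mat N \<and> invertible N \<and> Q = quadric_of (matrix_inv N) \<and>
      (\<forall>x. N *v x = \<alpha> *s (M i *v x) + \<beta> *s (M j *v x))" if "Q \<in> F" "i \<noteq> j" for Q i j
  proof -
    obtain r s where rs: "invertible (lin_comb r A s B)" "Q = quadric_of (matrix_inv (lin_comb r A s B))"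
      using mem \<open>Q \<in> F\<close> by blast
    \<comment> \<open>Cramer's rule.\<close>
    define \<alpha> \<beta> where "\<alpha> = (r * b j - a j * s) / (e i * d i j)"
      and "\<beta> = (a i * s - r * b i) / (e j * d i j)"
    have "\<alpha> * (e i * a i) + \<beta> * (e j * a j) = r * (a i * b j - a j * b i) / d i j"
      using e d[OF \<open>i \<noteq> j\<close>] unfolding \<alpha>_def \<beta>_def by (simp add: field_simps)
    then have r: "\<alpha> * (e i * a i) + \<beta> * (e j * a j) = r" using d[OF \<open>i \<noteq> j\<close>] by (simp add: d_def)
    have "\<alpha> * (e i * b i) + \<beta> * (e j * b j) = s * (a i * b j - a j * b i) / d i j"
      using e d[OF \<open>i \<noteq> j\<close>] unfolding \<alpha>_def \<beta>_def by (simp add: field_simps)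
    then have s: "\<alpha> * (e i * b i) + \<beta> * (e j * b j) = s" using d[OF \<open>i \<noteq> j\<close>] by (simp add: d_def)
    have "\<alpha> *s (M i *v x) + \<beta> *s (M j *v x) = (\<alpha> * (e i * a i) + \<beta> * (e j * a j)) *s (A *v x)
       + (\<alpha> * (e i * b i) + \<beta> * (e j * b j)) *s (B *v x)" for x
      unfolding M_def lin_comb_vector
      by (simp add: vec.scale_left_distrib vec.scale_right_distrib algebra_simps)
    then have "lin_comb r A s B *v x = \<alpha> *s (M i *v x) + \<beta> *s (M j *v x)" for x
      unfolding r s by (simp add: lin_comb_vector)
    then show ?thesis using rs sym by blast
  qed
  have "dual_triad F M"
    unfolding dual_triad_def
  proof (intro conjI allI ballI impI)
    show "inj (\<lambda>j. quadric_of (matrix_inv (M j)))" using q(1) unfolding Mq[symmetric] by simp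
    show "quadric_of (matrix_inv (M j)) \<in> F" for j using q(2)[of j] Mq by simp
  qed (use Ms Mi sum0 span in auto)
  then show thesis using that Mq by blast
qed

text \<open>On an affine line of the pencil through a nonsingular member only finitely many members
  are singular, and different parameters give different quadrics.\<close>

lemma pencil_family_three_members:
  assumes F: "pencil_family F A B"
  obtains q :: "3 \<Rightarrow> subsp" where "inj q" "\<And>j. q j \<in> F"
proof -
  have AB: "symmetric_mat A" "symmetric_mat B" and
    ind: "\<And>a b. lin_comb a A b B = 0 \<Longrightarrow> a = 0 \<and> b = 0" and
    mem: "\<And>Q. Q \<in> F \<longleftrightarrow> (\<exists>a b. invertible (lin_comb a A b B) \<and>
        Q = quadric_of (matrix_inv (lin_comb a A b B)))" and ne: "F \<noteq> {}"
    using F unfolding pencil_family_def by auto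
  note sym = symmetric_lin_comb[OF AB]
  obtain a b where ab: "invertible (lin_comb a A b B)" using ne mem by blast
  have nz: "a \<noteq> 0 \<or> b \<noteq> 0"
  proof (rule ccontr)
    assume "\<not> ?thesis"
    then have "lin_comb a A b B *v x = 0" for x by (simp add: lin_comb_vector)
    then show False using invertible_action_nonzero[OF ab] by blast
  qed
  obtain a' b' where d: "a * b' - a' * b \<noteq> 0"
  proof (cases "a = 0")
    case True
    then show thesis using that[of 0 1] nz by simp
  next
    case False
    then show thesis using that[of 1 0] by simp
  qed
  define N where "N = (\<lambda>s. lin_comb (a + s * a') A (b + s * b') B)"
  have Nl: "N s = lin_comb 1 (lin_comb a A b B) s (lin_comb a' A b' B)" for s
    by (simp add: N_def lin_comb_def vec_eq_iff algebra_simps)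
  have "infinite (- {s. \<not> invertible (N s)})"
    using finite_singular_lin_comb[OF ab] unfolding Nl by (metis Compl_eq_Diff_UNIV Diff_infinite_finite infinite_UNIV_char_0)
  then obtain T where T: "T \<subseteq> - {s. \<not> invertible (N s)}" "card T = 3" "finite T"
    using infinite_arbitrarily_large by blast
  then obtain h where h: "bij_betw h (UNIV :: 3 set) T"
    using finite_same_card_bij[of "UNIV :: 3 set" T] by auto
  define q where "q = (\<lambda>j. quadric_of (matrix_inv (N (h j))))"
  have hi: "invertible (N (h j))" for j using h T(1) unfolding bij_betw_def by blast
  have "q j \<in> F" for j unfolding q_def mem using hi N_def by blast
  moreover have "inj q"
  proof (rule injI)
    fix i j assume "q i = q j"
    then obtain c where c: "c \<noteq> 0" "\<And>x. N (h j) *v x = c *s (N (h i) *v x)"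
      using hi unfolding q_def N_def by (subst (asm) dual_eq_iff[OF sym _ sym]) auto
    define s t where "s = h i" and "t = h j"
    \<comment> \<open>Comparing coordinates in the pencil forces the factor \<open>c\<close> to be 1
      and the parameters to be equal.\<close>
    have "lin_comb (a + t * a' - c * (a + s * a')) A (b + t * b' - c * (b + s * b')) B *v x = 0" for x
      using c(2)[of x] unfolding N_def s_def[symmetric] t_def[symmetric] lin_comb_vector
      by (simp add: vec.scale_left_diff_distrib vec.scale_left_distrib vec.scale_right_distrib algebra_simps)
    then have "a + t * a' - c * (a + s * a') = 0 \<and> b + t * b' - c * (b + s * b') = 0"
      using ind lin_comb_eq_0 by blast
    then have 1: "a * (1 - c) + a' * (t - c * s) = 0" "b * (1 - c) + b' * (t - c * s) = 0"
      by (simp_all add: algebra_simps)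
    have "(a * b' - a' * b) * (1 - c) =
        b' * (a * (1 - c) + a' * (t - c * s)) - a' * (b * (1 - c) + b' * (t - c * s))"
      by (simp add: algebra_simps)
    then have "c = 1" using 1 d by simp
    have "(a * b' - a' * b) * (t - c * s) =
        a * (b * (1 - c) + b' * (t - c * s)) - b * (a * (1 - c) + a' * (t - c * s))"
      by (simp add: algebra_simps)
    then have "t - c * s = 0" using 1 d by simp
    then have "h i = h j" using \<open>c = 1\<close> by (simp add: s_def t_def)
    then show "i = j" using h unfolding bij_betw_def by (simp add: inj_eq)
  qed
  ultimately show thesis using that by blast
qed

section \<open>Combinatorics of the cube\<close>

lemma third_index:
  fixes i j :: 3
  assumes "i \<noteq> j"
  obtains k where "k \<noteq> i" "k \<noteq> j" "UNIV = {i, j, k}"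
proof -
  have "\<exists>k. k \<noteq> i \<and> k \<noteq> j \<and> UNIV = {i, j, k}"
    using assms exhaust_3[of i] exhaust_3[of j] UNIV_3
    by (elim disjE) (auto intro: exI[of _ 1] exI[of _ 2] exI[of _ 3])
  then show thesis using that by blast
qed

lemma other_index:
  fixes k :: 3
  obtains i where "i \<noteq> k"
proof -
  have "\<exists>i::3. i \<noteq> k" using exhaust_3[of k] by (elim disjE) (auto intro: exI[of _ 1] exI[of _ 2])
  then show thesis using that by blast
qed

lemma other_indices:
  fixes k :: 3
  obtains i j where "i \<noteq> j" "i \<noteq> k" "j \<noteq> k" "UNIV = {i, j, k}"
proof -
  obtain i where i: "i \<noteq> k" by (rule other_index)
  obtain j where "j \<noteq> i" "j \<noteq> k" "UNIV = {i, k, j}" using i by (rule third_index)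
  then show thesis using that[of i j] i by auto
qed

definition cube_vertex :: "(3 \<Rightarrow> 3 set \<Rightarrow> 'a) \<Rightarrow> 3 set \<Rightarrow> 'a set" where
  "cube_vertex pl J = range (\<lambda>i. pl i J)"

text \<open>The index \<open>k\<close> is the direction normal to the face, and \<open>s\<close>
  tells the side on which it lies.\<close>

definition cube_face :: "(3 \<Rightarrow> 3 set \<Rightarrow> 'a) \<Rightarrow> 3 \<Rightarrow> bool \<Rightarrow> 'a set" where
  "cube_face pl k s = {pl i J | i J. i \<noteq> k \<and> (k \<in> J) = s}"

text \<open>
  The vertices of a cube are the subsets \<open>J\<close> of a 3-element set; the edge in direction \<open>i\<close>
  joins \<open>J - {i}\<close> and \<open>J \<union> {i}\<close>, and \<open>pl i J\<close> is the object attached to it.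
\<close>

locale cube =
  fixes pl :: "3 \<Rightarrow> 3 set \<Rightarrow> 'a"
  assumes pl_eq_iff: "pl i J = pl i' J' \<longleftrightarrow> i = i' \<and> J - {i} = J' - {i}"
begin

abbreviation "vert \<equiv> cube_vertex pl"
abbreviation "face \<equiv> cube_face pl"
abbreviation "verts \<equiv> range vert"
abbreviation "faces \<equiv> range (\<lambda>(k, s). face k s)"
abbreviation "edges \<equiv> range (\<lambda>(i, J). pl i J)"

lemma mem_vert: "pl i J \<in> vert J' \<longleftrightarrow> J - {i} = J' - {i}"
  by (auto simp: cube_vertex_def pl_eq_iff)

lemma mem_face: "pl i J \<in> face k s \<longleftrightarrow> i \<noteq> k \<and> (k \<in> J) = s"
  unfolding cube_face_def mem_Collect_eq pl_eq_iff by blast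

text \<open>Whether \<open>x\<close> belongs to \<open>J\<close> can be read off from the edge in
  any direction other than \<open>x\<close>.\<close>

lemma vert_eq_iff: "vert J = vert J' \<longleftrightarrow> J = J'"
proof
  assume e: "vert J = vert J'"
  have "pl i J \<in> vert J" for i by (simp add: mem_vert)
  then have "pl i J \<in> vert J'" for i unfolding e .
  then have eq: "J - {i} = J' - {i}" for i by (simp add: mem_vert)
  have "x \<in> J \<longleftrightarrow> x \<in> J'" for x
  proof -
    obtain i where "i \<noteq> x" by (rule other_index)
    then show ?thesis using eq[of i] by blast
  qed
  then show "J = J'" by blast
qed simp

lemma face_eq_iff: "face k s = face k' s' \<longleftrightarrow> k = k' \<and> s = s'"
proof
  assume e: "face k s = face k' s'"
  have "i \<noteq> k' \<and> (k' \<in> (if s then {k} else {})) = s'" if "i \<noteq> k" for i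
    using mem_face[of i "if s then {k} else {}" k s] mem_face[of i _ k' s'] that e by auto
  moreover obtain i j where "i \<noteq> j" "i \<noteq> k" "j \<noteq> k" "UNIV = {i, j, k}" by (rule other_indices)
  ultimately have "i \<noteq> k'" "j \<noteq> k'" "(k' \<in> (if s then {k} else {})) = s'" "k' = i \<or> k' = j \<or> k' = k"
    by blast+
  then show "k = k' \<and> s = s'" by (auto split: if_splits)
qed simp

lemma card_vert: "card (vert J) = 3"
proof -
  have "inj (\<lambda>i. pl i J)" by (auto simp: inj_def pl_eq_iff)
  then show ?thesis unfolding cube_vertex_def by (simp add: card_image)
qed

text \<open>The edges are listed from the vertex \<open>S\<close> of the face, which allows a
  quadruplet to be checked plane by plane.\<close>

lemma face_explicit:
  fixes s :: bool
  assumes "a \<noteq> b" "UNIV = {a, b, k}" "a \<noteq> k" "b \<noteq> k"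
  defines "S \<equiv> (if s then {k} else {})"
  shows "face k s = {pl a S, pl a (insert b S), pl b S, pl b (insert a S)}"
proof (intro equalityI subsetI)
  fix P assume "P \<in> face k s"
  then obtain i J where P: "P = pl i J" "i \<noteq> k" "(k \<in> J) = s" unfolding cube_face_def by blast
  have J: "J - {c} = (if d \<in> J then insert d S else S) - {c}" if "UNIV = {c, d, k}" "c \<noteq> d" "c \<noteq> k" "d \<noteq> k" for c d
  proof (rule set_eqI)
    fix x
    have "x = c \<or> x = d \<or> x = k" using that(1) by blast
    then show "x \<in> J - {c} \<longleftrightarrow> x \<in> (if d \<in> J then insert d S else S) - {c}"
      using P(3) that by (auto simp: S_def)
  qed
  have "i = a \<or> i = b" using P(2) assms(2) by blast
  then show "P \<in> {pl a S, pl a (insert b S), pl b S, pl b (insert a S)}"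
  proof
    assume "i = a"
    then have "P = pl a (if b \<in> J then insert b S else S)"
      using J[of a b] assms P(1) by (simp add: pl_eq_iff)
    then show ?thesis by simp
  next
    assume "i = b"
    then have "P = pl b (if a \<in> J then insert a S else S)"
      using J[of b a] assms P(1) by (simp add: pl_eq_iff insert_commute)
    then show ?thesis by simp
  qed
qed (use assms in \<open>auto simp: mem_face\<close>)

lemma card_face: "card (face k s) = 4"
proof -
  obtain a b where ab: "a \<noteq> b" "a \<noteq> k" "b \<noteq> k" "UNIV = {a, b, k}" by (rule other_indices)
  show ?thesis
    unfolding face_explicit[OF ab(1,4,2,3)] using ab by (auto simp: pl_eq_iff)
qed

section \<open>Counting vertices, faces and edges\<close>

lemma card_verts: "card verts = 8"
proof -
  have "card verts = card (UNIV :: 3 set set)" by (rule card_image) (simp add: inj_def vert_eq_iff)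
  also have "\<dots> = 2 ^ 3" unfolding Pow_UNIV[symmetric] by (simp add: card_Pow)
  finally show ?thesis by simp
qed

lemma card_faces: "card faces = 6"
proof -
  have "card faces = card (UNIV :: (3 \<times> bool) set)"
    by (rule card_image) (auto simp: inj_def face_eq_iff)
  then show ?thesis by (simp add: UNIV_Times_UNIV[symmetric] card_cartesian_product del: UNIV_Times_UNIV)
qed

lemma card_edges: "card edges = 12"
proof -
  \<comment> \<open>Each edge is represented once, by its end that does not contain the
    direction.\<close>
  have "edges = (\<lambda>(i, J). pl i J) ` (SIGMA i:UNIV. Pow (UNIV - {i}))"
  proof (intro equalityI subsetI)
    fix P assume "P \<in> edges"
    then obtain i J where "P = pl i J" by auto
    then have "P = pl i (J - {i})" by (simp add: pl_eq_iff)
    then show "P \<in> (\<lambda>(i, J). pl i J) ` (SIGMA i:UNIV. Pow (UNIV - {i}))"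
      by (intro image_eqI[of _ _ "(i, J - {i})"]) auto
  qed auto
  moreover have "inj_on (\<lambda>(i, J). pl i J) (SIGMA i:UNIV. Pow (UNIV - {i}))"
    by (auto simp: inj_on_def pl_eq_iff)
  ultimately have "card edges = card (SIGMA i:(UNIV :: 3 set). Pow (UNIV - {i}))"
    by (simp add: card_image)
  also have "\<dots> = (\<Sum>i\<in>(UNIV :: 3 set). card (Pow (UNIV - {i})))" by (rule card_SigmaI) auto
  also have "\<dots> = (\<Sum>i\<in>(UNIV :: 3 set). 4)"
    by (intro sum.cong refl) (simp add: card_Pow card_Diff_singleton)
  finally show ?thesis by simp
qed

lemma card_verts_at: "card {t \<in> verts. pl i J \<in> t} = 2"
proof -
  have "{t \<in> verts. pl i J \<in> t} = {vert (J - {i}), vert (insert i J)}"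
  proof (intro equalityI subsetI)
    fix t assume "t \<in> {t \<in> verts. pl i J \<in> t}"
    then obtain J' where t: "t = vert J'" "J - {i} = J' - {i}" by (auto simp: mem_vert)
    then have "J' = J - {i} \<or> J' = insert i J" by blast
    then show "t \<in> {vert (J - {i}), vert (insert i J)}" using t by blast
  qed (auto simp: mem_vert)
  moreover have "vert (J - {i}) \<noteq> vert (insert i J)" unfolding vert_eq_iff by blast
  ultimately show ?thesis by simp
qed

lemma card_faces_at_direct: "card ((\<lambda>k. face k (k \<in> J)) ` (UNIV - {i})) = 2"
  by (subst card_image) (auto simp: inj_on_def face_eq_iff card_Diff_singleton)

lemma card_faces_at: "card {u \<in> faces. pl i J \<in> u} = 2"
proof -
  have "{u \<in> faces. pl i J \<in> u} = (\<lambda>k. face k (k \<in> J)) ` (UNIV - {i})"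
    by (auto simp: mem_face)
  then show ?thesis by (simp only: card_faces_at_direct)
qed

text \<open>Three edges without a repeated direction use each direction exactly once.\<close>

lemma transversal:
  assumes "card t = 3" "t \<subseteq> edges" "\<And>i J J'. pl i J \<in> t \<Longrightarrow> pl i J' \<in> t \<Longrightarrow> pl i J = pl i J'"
  obtains f where "t = range (\<lambda>i. pl i (f i))"
proof -
  have "\<forall>x\<in>t. \<exists>i. \<exists>J. x = pl i J" using assms(2) by fastforce
  then obtain ty where ty: "\<And>x. x \<in> t \<Longrightarrow> \<exists>J. x = pl (ty x) J" by metis
  have "inj_on ty t"
    by (rule inj_onI) (metis ty assms(3))
  then have "card (ty ` t) = 3" using assms(1) by (simp add: card_image)
  then have "ty ` t = UNIV" by (intro card_subset_eq) auto
  then have "\<forall>i. \<exists>J. pl i J \<in> t" using ty by (metis UNIV_I imageE)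
  then obtain f where f: "\<And>i. pl i (f i) \<in> t" by metis
  have "inj (\<lambda>i. pl i (f i))" by (auto simp: inj_def pl_eq_iff)
  then have "card (range (\<lambda>i. pl i (f i))) = 3" by (simp add: card_image)
  moreover have "finite t" using assms(1) by (metis card.infinite zero_neq_numeral)
  ultimately have "range (\<lambda>i. pl i (f i)) = t"
    using f assms(1) by (intro card_subset_eq) auto
  then show thesis using that by blast
qed

end

section \<open>Uniqueness of the cube structure\<close>

lemma linkedD:
  assumes "linked T U" "t \<in> T" "P \<in> t" "P' \<in> t"
  obtains u where "u \<in> U" "P \<in> u" "P' \<in> u"
  using assms unfolding linked_def by blast

lemma card_2_other:
  assumes "card A = 2" "x \<in> A"
  obtains y where "y \<in> A" "y \<noteq> x"
  using assms by (metis card_2_iff insert_iff)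

context
  fixes pl :: "3 \<Rightarrow> 3 set \<Rightarrow> subsp"
  assumes C: "cube pl"
begin

interpretation cube pl by (rule C)

lemma cube_linked: "linked (range (cube_vertex pl)) (range (\<lambda>(k, s). cube_face pl k s))"
  unfolding linked_def
proof (intro ballI)
  fix t P P' assume "t \<in> verts" "P \<in> t" "P' \<in> t"
  then obtain J i j where P: "P = pl i J" "P' = pl j J" unfolding cube_vertex_def by blast
  obtain k where "k \<noteq> i" "k \<noteq> j"
  proof (cases "i = j")
    case True
    then show thesis using other_index[of i] that by metis
  next
    case False
    then show thesis using that by (rule third_index)
  qed
  then have "P \<in> face k (k \<in> J)" "P' \<in> face k (k \<in> J)" using P by (auto simp: mem_face)
  then show "\<exists>u\<in>faces. P \<in> u \<and> P' \<in> u" by (intro bexI[of _ "face k (k \<in> J)"]) auto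
qed

text \<open>The combinatorial core of uniqueness, spreading from the vertex \<open>{}\<close>. In
  \<open>H1\<close>, a triplet has no two planes of the same direction; in \<open>H2\<close>, two
  adjacent planes determine their quadruplet.\<close>

lemma cube_unique:
  assumes T: "card T = 8" "\<And>t. t \<in> T \<Longrightarrow> t \<subseteq> S \<and> card t = 3" "\<And>P. P \<in> S \<Longrightarrow> card {t \<in> T. P \<in> t} = 2"
    and U: "card U = 6" "\<And>u. u \<in> U \<Longrightarrow> u \<subseteq> S" "\<And>P. P \<in> S \<Longrightarrow> card {u \<in> U. P \<in> u} = 2"
    and l: "linked T U" and v0: "cube_vertex pl {} \<in> T"
    and H1: "\<And>t i J J'. t \<in> T \<Longrightarrow> pl i J \<in> t \<Longrightarrow> pl i J' \<in> t \<Longrightarrow> pl i J = pl i J'"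
    and H2: "\<And>u i j k J. u \<in> U \<Longrightarrow> i \<noteq> j \<Longrightarrow> k \<noteq> i \<Longrightarrow> k \<noteq> j \<Longrightarrow> pl i J \<in> u \<Longrightarrow> pl j J \<in> u \<Longrightarrow>
      u = cube_face pl k (k \<in> J)"
  shows "S = range (\<lambda>(i, J). pl i J)" "T = range (cube_vertex pl)"
    "U = range (\<lambda>(k, s). cube_face pl k s)"
proof -
  have fin: "finite U" "finite T" using T(1) U(1) by (metis card.infinite zero_neq_numeral)+
  \<comment> \<open>Two edges at a vertex share a quadruplet because of \<open>linked\<close>, and
    \<open>H2\<close> identifies it.\<close>
  have face_in_U: "face k (k \<in> J) \<in> U" if "vert J \<in> T" for k J
  proof -
    obtain i j where ij: "i \<noteq> j" "i \<noteq> k" "j \<noteq> k" "UNIV = {i, j, k}" by (rule other_indices)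
    have "pl i J \<in> vert J" "pl j J \<in> vert J" by (auto simp: mem_vert)
    from linkedD[OF l that this] obtain u where u: "u \<in> U" "pl i J \<in> u" "pl j J \<in> u" .
    have "u = face k (k \<in> J)" by (rule H2[OF u(1) ij(1) _ _ u(2,3)]) (use ij in auto)
    then show ?thesis using u(1) by simp
  qed
  \<comment> \<open>The two faces at a base edge already exhaust the two quadruplets allowed
    there.\<close>
  have A: "\<exists>k. k \<noteq> i \<and> u = face k False" if "u \<in> U" "pl i {} \<in> u" for u i
  proof -
    have "pl i {} \<in> S" using T(2)[OF v0] mem_vert by blast
    then have "card {u \<in> U. pl i {} \<in> u} = 2" by (rule U(3))
    moreover have "(\<lambda>k. face k (k \<in> {})) ` (UNIV - {i}) \<subseteq> {u \<in> U. pl i {} \<in> u}"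
      using face_in_U[OF v0] by (auto simp: mem_face)
    ultimately have "(\<lambda>k. face k (k \<in> {})) ` (UNIV - {i}) = {u \<in> U. pl i {} \<in> u}"
      using card_faces_at_direct[of "{}" i] fin by (intro card_subset_eq) auto
    then show ?thesis using that by auto
  qed
  have v1: "vert {i} \<in> T" for i
  proof -
    have iS: "pl i {} \<in> S" using T(2)[OF v0] mem_vert by blast
    have "vert {} \<in> {t \<in> T. pl i {} \<in> t}" using v0 by (simp add: mem_vert)
    then obtain t where t: "t \<in> T" "pl i {} \<in> t" "t \<noteq> vert {}"
      using card_2_other[OF T(3)[OF iS]] by blast
    have sub: "t \<subseteq> edges"
    proof
      fix x assume "x \<in> t"
      from linkedD[OF l t(1,2) this] obtain u where "u \<in> U" "pl i {} \<in> u" "x \<in> u" .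
      then show "x \<in> edges" using A unfolding cube_face_def by blast
    qed
    obtain f where f: "t = range (\<lambda>j. pl j (f j))"
      using transversal[OF _ sub H1[OF t(1)]] T(2)[OF t(1)] by blast
    have ft: "pl j (f j) \<in> t" for j using f by blast
    have fi: "pl i (f i) = pl i {}" using H1[OF t(1)] t(2) f by blast
    \<comment> \<open>The plane of direction \<open>j\<close> shares a quadruplet with the base edge
      \<open>pl i {}\<close>. This is the face with normal \<open>k\<close> through
      \<open>{}\<close>, so only \<open>i\<close> is left undecided in \<open>f j\<close>.\<close>
    have fj: "k \<notin> f j" if "j \<noteq> i" "k \<noteq> i" "k \<noteq> j" "UNIV = {i, j, k}" for j k
    proof -
      obtain u where u: "u \<in> U" "pl i {} \<in> u" "pl j (f j) \<in> u"
        using linkedD[OF l t(1,2) ft] .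
      then obtain m where "m \<noteq> i" "u = face m False" using A by blast
      then have "m \<noteq> j" "m \<notin> f j" using u(3) by (auto simp: mem_face)
      then show ?thesis using that \<open>m \<noteq> i\<close> by blast
    qed
    \<comment> \<open>A second base edge in \<open>t\<close> would force the third one, and
      \<open>t\<close> would be \<open>vert {}\<close> again.\<close>
    have fmem: "i \<in> f j" if ji: "j \<noteq> i" for j
    proof (rule ccontr)
      assume n: "i \<notin> f j"
      obtain k where k: "k \<noteq> i" "k \<noteq> j" "UNIV = {i, j, k}" by (rule third_index[OF not_sym[OF ji]])
      have cov: "x = i \<or> x = j \<or> x = k" for x using k(3) by blast
      have k': "UNIV = {i, k, j}" using k(3) by (simp add: insert_commute)
      have j0: "pl j (f j) = pl j {}"
      proof -
        have "x \<notin> f j - {j}" for x using fj[OF ji k] n cov[of x] by auto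
        then have "f j - {j} = {}" by blast
        then show ?thesis by (simp add: pl_eq_iff)
      qed
      obtain u where u: "u \<in> U" "pl j (f j) \<in> u" "pl k (f k) \<in> u"
        using linkedD[OF l t(1) ft ft] .
      then obtain m where m: "m \<noteq> j" "u = face m False" using A j0 by metis
      then have "m \<noteq> k" "m \<notin> f k" using u(3) by (auto simp: mem_face)
      then have "i \<notin> f k" using m cov[of m] by auto
      moreover have "j \<notin> f k" using fj[of k j] k ji k' by metis
      ultimately have "x \<notin> f k - {k}" for x using cov[of x] by auto
      then have "f k - {k} = {}" by blast
      then have "pl k (f k) = pl k {}" by (simp add: pl_eq_iff)
      then have "pl m (f m) = pl m {}" for m using j0 fi cov[of m] by auto
      then show False using t(3) f by (simp add: cube_vertex_def)
    qed
    have "pl j (f j) = pl j {i}" for j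
    proof (cases "j = i")
      case True
      then show ?thesis using fi by (simp add: pl_eq_iff)
    next
      case False
      obtain k where k: "k \<noteq> i" "k \<noteq> j" "UNIV = {i, j, k}" by (rule third_index[OF not_sym[OF False]])
      have "f j - {j} = {i} - {j}"
      proof (rule set_eqI)
        fix x
        have "x = i \<or> x = j \<or> x = k" using k(3) by blast
        then show "x \<in> f j - {j} \<longleftrightarrow> x \<in> {i} - {j}"
          using fj[OF False k] fmem[OF False] k by auto
      qed
      then show ?thesis by (simp add: pl_eq_iff)
    qed
    then have "t = vert {i}" using f by (simp add: cube_vertex_def)
    then show ?thesis using t(1) by simp
  qed
  \<comment> \<open>The vertex \<open>{}\<close> supplies the three faces with \<open>s\<close>
    false, and \<open>{k}\<close> the opposite ones.\<close>
  have "face k s \<in> U" for k s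
    using face_in_U[OF v0, of k] face_in_U[OF v1, of k k] by (cases s) auto
  then have "faces \<subseteq> U" by auto
  then show UF: "U = faces" using card_faces U(1) fin by (metis card_subset_eq)
  show SE: "S = edges"
  proof (intro equalityI subsetI)
    fix P assume "P \<in> S"
    then have "card {u \<in> U. P \<in> u} = 2" by (rule U(3))
    then have "{u \<in> U. P \<in> u} \<noteq> {}" by (metis card.empty zero_neq_numeral)
    then obtain u where "u \<in> U" "P \<in> u" by blast
    then show "P \<in> edges" unfolding UF cube_face_def by auto
  next
    fix P assume "P \<in> edges"
    then obtain i J where P: "P = pl i J" by auto
    obtain k where "k \<noteq> i" by (rule other_index)
    then have "P \<in> face k (k \<in> J)" using P by (simp add: mem_face)
    then show "P \<in> S" using U(2)[of "face k (k \<in> J)"] UF by auto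
  qed
  have "T \<subseteq> verts"
  proof
    fix t assume t: "t \<in> T"
    have c3: "card t = 3" and sub: "t \<subseteq> edges" using T(2)[OF t] SE by simp_all
    obtain f where f: "t = range (\<lambda>j. pl j (f j))" by (rule transversal[OF c3 sub H1[OF t]])
    have ft: "pl j (f j) \<in> t" for j using f by blast
    \<comment> \<open>Two planes of directions \<open>i\<close> and \<open>j\<close> can share only
      a face normal to the third direction \<open>k\<close>, so they lie on the same side.\<close>
    have agree: "k \<in> f i \<longleftrightarrow> k \<in> f j" if ijk: "i \<noteq> j" "k \<noteq> i" "k \<noteq> j" for i j k
    proof -
      obtain u where u: "u \<in> U" "pl i (f i) \<in> u" "pl j (f j) \<in> u"
        using linkedD[OF l t ft ft] .
      then obtain m s where m: "u = face m s" using UF by auto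
      then have "m \<noteq> i" "m \<noteq> j" "(m \<in> f i) = s" "(m \<in> f j) = s" using u by (auto simp: mem_face)
      moreover obtain k' where "UNIV = {i, j, k'}" by (rule third_index[OF ijk(1)])
      moreover from this have "m = i \<or> m = j \<or> m = k'" "k = i \<or> k = j \<or> k = k'" by blast+
      ultimately have "m = k" using ijk by auto
      then show ?thesis using \<open>(m \<in> f i) = s\<close> \<open>(m \<in> f j) = s\<close> by simp
    qed
    \<comment> \<open>The sides agree, so any edge of another direction tells whether
      \<open>k\<close> belongs to the vertex.\<close>
    define J where "J = {k. \<exists>i. i \<noteq> k \<and> k \<in> f i}"
    have "f i - {i} = J - {i}" for i
    proof (rule set_eqI)
      fix k
      have "k \<in> f i" if "j \<noteq> k" "k \<in> f j" "k \<noteq> i" for j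
        using that agree[of j i k] by (cases "i = j") auto
      then show "k \<in> f i - {i} \<longleftrightarrow> k \<in> J - {i}" unfolding J_def by auto
    qed
    then have "pl i (f i) = pl i J" for i by (simp add: pl_eq_iff)
    then have "t = vert J" unfolding f cube_vertex_def by simp
    then show "t \<in> verts" by blast
  qed
  then show "T = verts" using card_verts T(1) by (intro card_subset_eq) auto
qed

end

section \<open>The twelve planes\<close>

lemma sum_index_split:
  fixes f :: "3 \<Rightarrow> 'b :: comm_monoid_add"
  shows "(\<Sum>k\<in>UNIV. f k) = f i + (\<Sum>k\<in>UNIV - {i}. f k)"
  by (simp add: sum.remove)

text \<open>The normal form of a suitable triplet. The nonvanishing conditions keep the twelve
  planes distinct and let each touch only one member of the family.\<close>

locale cube_data =
  fixes F :: "subsp set" and M :: "3 \<Rightarrow> complex^4^4" and n :: "3 \<Rightarrow> complex^4"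
    and y :: "3 \<Rightarrow> complex" and w :: "3 \<Rightarrow> 3 \<Rightarrow> complex"
  assumes triad: "dual_triad F M"
    and collinear: "M 1 *v n 1 + M 2 *v n 2 + M 3 *v n 3 = 0"
    and indep: "(\<Sum>k\<in>UNIV. c k *s n k) = 0 \<Longrightarrow> c i = 0"
    and gram: "bform (M j) (n i) (n k) = w j i * y i + w j k * y k + (if i = k then 2 * w j i else 0)"
    and w_diag: "w j j = 0" and w_nz: "i \<noteq> j \<Longrightarrow> w j i \<noteq> 0"
    and y_nz: "y i \<noteq> 0" and Y_nz: "1 + sum y J \<noteq> 0"
begin

abbreviation "Qd j \<equiv> quadric_of (matrix_inv (M j))"

lemma sym: "symmetric_mat (M j)" and inv: "invertible (M j)" and Qd_F: "Qd j \<in> F"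
  using triad by (auto simp: dual_triad_def)

lemma Qd_eq_iff: "Qd i = Qd j \<longleftrightarrow> i = j"
  using triad unfolding dual_triad_def inj_def by blast

lemma M_sum: "M 1 *v x + M 2 *v x + M 3 *v x = 0"
  using triad by (simp add: dual_triad_def)

section \<open>Coordinates of the twelve planes and values of the forms\<close>

definition "comb x = (\<Sum>k\<in>UNIV. x k *s n k)" for x :: "3 \<Rightarrow> complex"

definition "E i J = (1 + sum y J) *s n i - (\<Sum>j\<in>J. y j *s n j)"

text \<open>The coordinates of \<open>E i J\<close>, with sum 1; all but the one at \<open>i\<close>
  are \<open>0\<close> or \<open>- y k\<close>.\<close>

definition "crd i J k = (if k = i then 1 + sum y (J - {i}) else if k \<in> J then - y k else 0)"

lemma comb_eq_iff: "comb x = comb z \<longleftrightarrow> x = z"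
proof
  assume "comb x = comb z"
  then have "(\<Sum>k\<in>UNIV. (x k - z k) *s n k) = 0"
    unfolding comb_def by (simp add: vec.scale_left_diff_distrib sum_subtractf)
  from indep[OF this] show "x = z" by (intro ext) simp
qed simp

text \<open>Besides its diagonal part, the Gram matrix only contributes products of a linear form
  with a coordinate sum.\<close>

lemma bform_comb:
  "bform (M j) (comb x) (comb z) =
    (\<Sum>k\<in>UNIV. w j k * (y k * x k * (\<Sum>i\<in>UNIV. z i) + y k * z k * (\<Sum>i\<in>UNIV. x i) + 2 * x k * z k))"
  unfolding comb_def sum_3 by (simp add: gram algebra_simps)

lemma sum_y_remove: "i \<in> J \<Longrightarrow> sum y J = y i + sum y (J - {i})"
  by (rule sum.remove) (auto intro: finite_subset[of _ UNIV])

lemma E_eq_comb: "E i J = comb (crd i J)"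
proof -
  have fin: "finite (J - {i})" by (rule finite_subset[of _ UNIV]) auto
  have *: "(\<Sum>j\<in>J. y j *s n j) = (if i \<in> J then y i *s n i else 0) + (\<Sum>j\<in>J - {i}. y j *s n j)"
    using fin by (auto simp: sum.remove[of J i] finite_subset[of J UNIV])
  have "(\<Sum>k\<in>UNIV - {i}. crd i J k *s n k) = (\<Sum>k\<in>J - {i}. - (y k *s n k))"
    by (rule sum.mono_neutral_cong_right) (auto simp: crd_def)
  then have "comb (crd i J) = (1 + sum y (J - {i})) *s n i - (\<Sum>j\<in>J - {i}. y j *s n j)"
    unfolding comb_def sum_index_split[of _ i] by (simp add: crd_def sum_negf)
  also have "\<dots> = E i J"
    unfolding E_def * by (auto simp: sum_y_remove vec.scale_left_distrib algebra_simps)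
  finally show ?thesis ..
qed

lemma sum_crd: "(\<Sum>k\<in>UNIV. crd i J k) = 1"
proof -
  have "(\<Sum>k\<in>UNIV - {i}. crd i J k) = (\<Sum>k\<in>J - {i}. - y k)"
    by (rule sum.mono_neutral_cong_right) (auto simp: crd_def)
  then show ?thesis unfolding sum_index_split[of _ i] by (simp add: crd_def sum_negf)
qed

lemma bform_E:
  "bform (M j) (E i J) (E i' J') =
    (\<Sum>k\<in>UNIV. w j k * (y k * crd i J k + y k * crd i' J' k + 2 * crd i J k * crd i' J' k))"
  unfolding E_eq_comb bform_comb sum_crd by simp

lemma Y_insert: "1 + sum y (J - {i}) + y i = 1 + sum y (insert i J)"
  using sum_y_remove[of i "insert i J"] by simp

text \<open>Only the term at \<open>i\<close> survives, since each other coordinate \<open>x\<close>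
  is \<open>0\<close> or \<open>- y k\<close> and hence a root of
  \<open>x * (x + y k)\<close>.\<close>

lemma bform_E_self:
  "bform (M j) (E i J) (E i J) = 2 * w j i * (1 + sum y (J - {i})) * (1 + sum y (insert i J))"
proof -
  have "(\<Sum>k\<in>UNIV - {i}. w j k * (y k * crd i J k + y k * crd i J k + 2 * crd i J k * crd i J k)) = 0"
    by (rule sum.neutral) (auto simp: crd_def)
  then show ?thesis unfolding bform_E sum_index_split[of _ i] Y_insert[symmetric]
    by (simp add: crd_def algebra_simps)
qed

lemma bform_E_zero_iff: "bform (M j) (E i J) (E i J) = 0 \<longleftrightarrow> i = j"
  using w_diag[of j] w_nz[of i j] Y_nz by (auto simp: bform_E_self)

text \<open>The term at \<open>j\<close> has weight zero, and at the third index the two vectors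
  share a coordinate \<open>0\<close> or \<open>- y k\<close>; the term at \<open>i\<close> is a
  product of nonzero factors.\<close>

lemma bform_E_adjacent:
  assumes "i \<noteq> j"
  shows "bform (M j) (E i J) (E j J) \<noteq> 0"
proof -
  obtain k where k: "k \<noteq> i" "k \<noteq> j" "UNIV = {i, j, k}" using assms by (rule third_index)
  let ?t = "\<lambda>k. w j k * (y k * crd i J k + y k * crd j J k + 2 * crd i J k * crd j J k)"
  have "(\<Sum>k\<in>UNIV. ?t k) = ?t i + ?t j + ?t k"
    unfolding k(3) using k(1,2) assms by (simp add: add.assoc)
  also have "?t j = 0" by (simp add: w_diag)
  also have "?t k = 0" using k by (simp add: crd_def)
  also have "?t i = w j i * y i * (if i \<in> J then - (1 + sum y (insert i J)) else 1 + sum y (J - {i}))"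
    using assms by (simp add: crd_def Y_insert[symmetric] algebra_simps)
  finally have eq: "(\<Sum>k\<in>UNIV. ?t k) =
      w j i * y i * (if i \<in> J then - (1 + sum y (insert i J)) else 1 + sum y (J - {i}))" by simp
  show ?thesis
    unfolding bform_E eq
    using w_nz[OF assms] y_nz[of i] Y_nz[of "insert i J"] Y_nz[of "J - {i}"]
    by (cases "i \<in> J") (simp_all only: if_True if_False mult_eq_0_iff neg_equal_0_iff_equal simp_thms)
qed

lemma E_nz: "E i J \<noteq> 0"
proof -
  obtain j where "j \<noteq> i" by (rule other_index)
  then show ?thesis using bform_E_zero_iff[of j i J] by auto
qed

definition "pl i J = plane_of (E i J)"

lemma E_cong: "J - {i} = J' - {i} \<Longrightarrow> E i J = E i J'"
  unfolding E_eq_comb comb_eq_iff by (rule ext) (auto simp: crd_def)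

text \<open>The coordinate sum 1 fixes the scale. The direction is then the only index whose form
  vanishes, and the other coordinates reveal \<open>J\<close>.\<close>

lemma pl_eq_iff': "pl i J = pl i' J' \<longleftrightarrow> i = i' \<and> J - {i} = J' - {i}"
proof
  assume "pl i J = pl i' J'"
  then obtain c where c: "E i' J' = c *s E i J"
    using plane_of_eqD E_nz unfolding pl_def by blast
  have "comb (\<lambda>k. c * crd i J k) = c *s comb (crd i J)"
    by (simp add: comb_def vec.scale_sum_right)
  then have crd: "crd i' J' = (\<lambda>k. c * crd i J k)"
    using c unfolding E_eq_comb by (metis comb_eq_iff)
  have "(\<Sum>k\<in>UNIV. crd i' J' k) = c * (\<Sum>k\<in>UNIV. crd i J k)"
    unfolding crd by (simp add: sum_distrib_left)
  then have "c = 1" by (simp add: sum_crd)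
  then have eq: "crd i' J' k = crd i J k" for k using crd by simp
  have "E i' J' = E i J" using c \<open>c = 1\<close> by simp
  then have i: "i = i'" using bform_E_zero_iff[of i i J] bform_E_zero_iff[of i i' J'] by simp
  have "k \<in> J \<longleftrightarrow> k \<in> J'" if "k \<noteq> i" for k
    using eq[of k] that i y_nz[of k] by (auto simp: crd_def split: if_splits)
  then show "i = i' \<and> J - {i} = J' - {i}" using i by blast
qed (metis pl_def E_cong)

sublocale cube pl
  by unfold_locales (rule pl_eq_iff')

text \<open>Any member is spanned by \<open>M i\<close> and some \<open>M j\<close>. At this plane
  the first form vanishes and the second does not, so tangency leaves only multiples of
  \<open>M i\<close>.\<close>

lemma tangent_pl_iff:
  assumes "Q \<in> F"
  shows "tangent_to Q (pl i J) \<longleftrightarrow> Q = Qd i"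
proof
  assume t: "tangent_to Q (pl i J)"
  obtain j where j: "j \<noteq> i" by (rule other_index)
  then obtain N \<alpha> \<beta> where N: "symmetric_mat N" "invertible N" "Q = quadric_of (matrix_inv N)"
      "\<And>x. N *v x = \<alpha> *s (M i *v x) + \<beta> *s (M j *v x)"
    using triad assms unfolding dual_triad_def by metis
  have "bform N (E i J) (E i J) = 0"
    using t tangent_plane_of_iff[OF N(1,2)] unfolding N(3) pl_def by blast
  moreover have "bform N (E i J) (E i J) =
      \<alpha> * bform (M i) (E i J) (E i J) + \<beta> * bform (M j) (E i J) (E i J)"
    unfolding bform_def N(4) by simp
  moreover have "bform (M i) (E i J) (E i J) = 0" "bform (M j) (E i J) (E i J) \<noteq> 0"
    unfolding bform_E_zero_iff using j by auto
  ultimately have "\<beta> = 0" by simp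
  then have N': "\<And>x. N *v x = \<alpha> *s (M i *v x)" using N(4) by simp
  have "\<alpha> \<noteq> 0"
  proof
    assume "\<alpha> = 0"
    then show False using N' invertible_action_nonzero[OF N(2)] by simp
  qed
  then show "Q = Qd i"
    unfolding N(3) dual_eq_iff[OF N(1,2) sym inv] using N'
    by (intro exI[of _ "1 / \<alpha>"]) simp
next
  assume "Q = Qd i"
  then show "tangent_to Q (pl i J)"
    using tangent_plane_of_iff[OF sym inv, of i] E_nz bform_E_zero_iff unfolding pl_def by auto
qed

section \<open>Triplets at the vertices\<close>

lemma tangent_Qd: "tangent_to (Qd i) (pl i J)"
  unfolding tangent_pl_iff[OF Qd_F] ..

lemma touching_point: "touches (Qd i) (pl i J) (vec.span {M i *v E i J})"
  unfolding pl_def touches_plane_of_iff[OF sym inv] using E_nz bform_E_zero_iff by auto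

text \<open>The subtracted vector in \<open>E i J\<close> is the same for all \<open>i\<close>, so
  both parts cancel by the two sum relations.\<close>

lemma E_touching_sum: "M 1 *v E 1 J + M 2 *v E 2 J + M 3 *v E 3 J = 0"
proof -
  have "M 1 *v E 1 J + M 2 *v E 2 J + M 3 *v E 3 J =
    (1 + sum y J) *s (M 1 *v n 1 + M 2 *v n 2 + M 3 *v n 3)
    - (M 1 *v (\<Sum>j\<in>J. y j *s n j) + M 2 *v (\<Sum>j\<in>J. y j *s n j) + M 3 *v (\<Sum>j\<in>J. y j *s n j))"
    unfolding E_def by (simp add: vec.diff vec.scale vec.scale_right_distrib algebra_simps)
  then show ?thesis unfolding collinear M_sum by simp
qed

text \<open>If the touching vectors were proportional, pairing them with \<open>E 1 J\<close> would
  make adjacent planes conjugate.\<close>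

lemma touching_indep: "indep2 (M 1 *v E 1 J) (M 2 *v E 2 J)"
  unfolding indep2_iff
proof (intro conjI allI notI)
  show "M 1 *v E 1 J = 0 \<Longrightarrow> False" using invertible_ker[OF inv] E_nz by blast
  fix c assume e: "M 2 *v E 2 J = c *s (M 1 *v E 1 J)"
  have "bform (M 2) (E 1 J) (E 2 J) = c * bform (M 1) (E 1 J) (E 1 J)"
    unfolding bform_def e by simp
  also have "bform (M 1) (E 1 J) (E 1 J) = 0" unfolding bform_E_zero_iff by simp
  finally show False using bform_E_adjacent[of 1 2 J] by simp
qed

lemma proj_line_span:
  assumes "indep2 a b"
  shows "proj_line (vec.span {a, b} :: subsp)"
proof -
  have "a \<noteq> 0" "b \<noteq> 0" using indep2_nonzero[OF assms] .
  moreover have "a \<notin> vec.span {b}"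
    using indep2_sym[OF assms] by (auto simp: indep2_iff vec.span_singleton)
  ultimately show ?thesis unfolding proj_line_def vec.dim_span by (simp add: vec.dim_insert)
qed

lemma vert_triplet: "\<exists>Q X. tangent_triplet F (vert J) Q X"
proof -
  have inj: "inj (\<lambda>i. pl i J)" by (auto simp: inj_def pl_eq_iff)
  \<comment> \<open>Since a triplet is a set of planes, the index of a plane has to be recovered
    from it.\<close>
  define ix where "ix = Hilbert_Choice.inv (\<lambda>i. pl i J)"
  have ix: "ix (pl i J) = i" for i unfolding ix_def by (rule inv_f_f[OF inj])
  let ?Q = "\<lambda>P. Qd (ix P)" and ?X = "\<lambda>P. vec.span {M (ix P) *v E (ix P) J}"
  let ?a = "M 1 *v E 1 J" and ?b = "M 2 *v E 2 J"
  have L: "proj_line (vec.span {?a, ?b})" by (rule proj_line_span[OF touching_indep])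
  have "M i *v E i J \<in> vec.span {?a, ?b}" for i
  proof -
    have "M 3 *v E 3 J = - (?a + ?b)"
      using E_touching_sum[of J] by (metis add_eq_0_iff)
    moreover have ab: "?a \<in> vec.span {?a, ?b}" "?b \<in> vec.span {?a, ?b}" by (auto intro: vec.span_base)
    moreover have "- (?a + ?b) \<in> vec.span {?a, ?b}"
      by (intro vec.span_neg vec.span_add ab)
    ultimately show ?thesis using exhaust_3[of i] by auto
  qed
  then have X: "?X P \<subseteq> vec.span {?a, ?b}" for P
    by (simp add: span_singleton_subset_iff)
  have "tangent_triplet F (vert J) ?Q ?X"
    unfolding tangent_triplet_def
  proof (intro conjI ballI)
    show "card (vert J) = 3" by (rule card_vert)
    show "inj_on ?Q (vert J)"
      unfolding cube_vertex_def by (auto intro!: inj_onI simp: ix Qd_eq_iff)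
    fix P assume "P \<in> vert J"
    then obtain i where P: "P = pl i J" by (auto simp: cube_vertex_def)
    show "?Q P \<in> F" by (rule Qd_F)
    show "touches (?Q P) P (?X P)" unfolding P ix by (rule touching_point)
  next
    show "\<exists>L. proj_line L \<and> (\<forall>P\<in>vert J. ?X P \<subseteq> L)" using L X by blast
  qed
  then show ?thesis by blast
qed

section \<open>Quadruplets on the faces\<close>

lemma E_flip:
  assumes "i \<noteq> j"
  obtains r where "r \<noteq> 0"
    "E i (if j \<in> J then J - {j} else insert j J) = (1 + r) *s E i J - r *s E j J"
proof -
  have fin: "finite J" by (rule finite_subset[of _ UNIV]) auto
  \<comment> \<open>Flipping \<open>j\<close> adds a multiple of \<open>n i - n j\<close>, hence of
    this difference, to \<open>E i J\<close>; so the opposite edge of the face lies in the same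
    pencil of planes.\<close>
  have d: "E i J - E j J = (1 + sum y J) *s (n i - n j)"
    by (simp add: E_def vec.scale_right_diff_distrib)
  define e where "e = (if j \<in> J then - y j else y j)"
  have "sum y (if j \<in> J then J - {j} else insert j J) = sum y J + e"
    "(\<Sum>k\<in>(if j \<in> J then J - {j} else insert j J). y k *s n k) = (\<Sum>k\<in>J. y k *s n k) + e *s n j"
    using fin by (auto simp: e_def sum_diff1 vec.scale_minus_left)
  then have "E i (if j \<in> J then J - {j} else insert j J) = E i J + e *s (n i - n j)"
    unfolding E_def by (simp add: vec.scale_left_distrib vec.scale_right_diff_distrib algebra_simps)
  also have "e *s (n i - n j) = (e / (1 + sum y J)) *s (E i J - E j J)"
    unfolding d vec.scale_scale times_divide_eq_left nonzero_mult_div_cancel_right[OF Y_nz] ..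
  also have "E i J + \<dots> = (1 + e / (1 + sum y J)) *s E i J - (e / (1 + sum y J)) *s E j J"
    by (simp add: vec.scale_left_distrib vec.scale_right_diff_distrib algebra_simps)
  finally show thesis using that[of "e / (1 + sum y J)"] y_nz[of j] Y_nz[of J] by (auto simp: e_def)
qed

lemma indep2_E: "i \<noteq> j \<Longrightarrow> indep2 (E i J) (E j J)"
  using E_nz by (simp add: indep2_plane_of_iff pl_def[symmetric] pl_eq_iff)

text \<open>
  A pencil of planes contains at most two planes tangent to a quadric that is not tangent to all
  of them; here both are known.
\<close>

lemma tangent_in_pencil:
  assumes ij: "i \<noteq> j" "k \<noteq> i" "k \<noteq> j" and m: "m \<noteq> 0" "m = s *s E i J + t *s E j J"
    and z: "bform (M i) m m = 0"
  shows "plane_of m \<in> face k (k \<in> J)"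
proof -
  define J' where "J' = (if j \<in> J then J - {j} else insert j J)"
  obtain r where r: "r \<noteq> 0" "E i J' = (1 + r) *s E i J - r *s E j J"
    unfolding J'_def using ij(1) by (rule E_flip)
  let ?b = "bform (M i) (E j J) (E i J)" and ?q = "bform (M i) (E j J) (E j J)"
  have b: "?b \<noteq> 0" by (rule bform_E_adjacent[OF not_sym[OF ij(1)]])
  have q0: "bform (M i) (E i J) (E i J) = 0" by (simp add: bform_E_zero_iff)
  have comm: "bform (M i) (E i J) (E j J) = ?b" by (rule bform_commute[OF sym])
  \<comment> \<open>The root \<open>t = 0\<close> is the plane \<open>pl i J\<close>; the other
    factor must give \<open>pl i J'\<close>.\<close>
  have "t * (2 * s * ?b + t * ?q) = 0"
    using z unfolding m(2) by (simp add: q0 comm algebra_simps)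
  then consider "t = 0" | "2 * s * ?b + t * ?q = 0" by auto
  then show ?thesis
  proof cases
    case 1
    then have "s \<noteq> 0" using m by auto
    then have "plane_of m = pl i J" unfolding m(2) 1 pl_def by (simp add: plane_of_scale)
    then show ?thesis using ij by (simp add: mem_face)
  next
    case 2
    \<comment> \<open>The known second plane expresses \<open>?q\<close> through \<open>?b\<close>
      and \<open>r\<close>, which fixes the ratio of \<open>s\<close> and \<open>t\<close>.\<close>
    have "bform (M i) (E i J') (E i J') = 0" by (simp add: bform_E_zero_iff)
    then have "r * (r * ?q - 2 * (1 + r) * ?b) = 0"
      unfolding r(2) by (simp add: q0 comm algebra_simps)
    then have rq: "r * ?q = 2 * (1 + r) * ?b" using r(1) by simp
    have "2 * ?b * (s * r + t * (1 + r)) = r * (2 * s * ?b) + t * (2 * (1 + r) * ?b)"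
      by (simp add: algebra_simps)
    also have "\<dots> = r * (2 * s * ?b + t * ?q)" unfolding rq[symmetric] by (simp add: algebra_simps)
    finally have "s * r + t * (1 + r) = 0" using 2 b by simp
    then have sr: "r * s = - (t * (1 + r))"
      unfolding eq_neg_iff_add_eq_0 by (simp only: mult.commute)
    have "r *s m = (r * s) *s E i J + (r * t) *s E j J"
      unfolding m(2) by (simp add: vec.scale_right_distrib)
    also have "\<dots> = (- t) *s E i J'"
      unfolding sr r(2) by (simp add: vec.scale_right_diff_distrib vec.scale_left_distrib algebra_simps)
    finally have rm: "r *s m = (- t) *s E i J'" .
    have "t \<noteq> 0" using rm m(1) r(1) by (metis neg_0_equal_iff_equal vec.scale_eq_0_iff)
    then have "plane_of m = pl i J'"
      unfolding pl_def using plane_of_scale[OF r(1), of m] plane_of_scale[of "- t" "E i J'"] rm by simp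
    then show ?thesis using ij by (auto simp: mem_face J'_def)
  qed
qed

text \<open>The adjacent planes touch only \<open>Qd i\<close> and \<open>Qd j\<close> within the
  family, so these are the two quadrics of \<open>u\<close>; the axis is their intersection line. By
  \<open>tangent_in_pencil\<close>, \<open>u\<close> lies in the face, and both have four
  elements.\<close>

lemma quadruplet_eq_face:
  assumes u: "tangent_quadruplet F u" and ij: "i \<noteq> j" "k \<noteq> i" "k \<noteq> j"
    and pl: "pl i J \<in> u" "pl j J \<in> u"
  shows "u = face k (k \<in> J)"
proof -
  obtain Q Q' where Q: "Q \<in> F" "Q' \<in> F" and tan: "\<And>P. P \<in> u \<Longrightarrow> tangent_to Q P \<or> tangent_to Q' P"
    using u unfolding tangent_quadruplet_def by blast
  have "Q = Qd i \<or> Q' = Qd i" "Q = Qd j \<or> Q' = Qd j"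
    using tan[OF pl(1)] tan[OF pl(2)] Q by (auto simp: tangent_pl_iff)
  then have tan': "tangent_to (Qd i) P \<or> tangent_to (Qd j) P" if "P \<in> u" for P
    using tan[OF that] Qd_eq_iff[of i j] ij(1) by auto
  have pen: "pl i J \<inter> pl j J \<subseteq> P" if "P \<in> u" for P
    using u in_pencil_iff[OF indep2_E[OF ij(1), of J], of u] pl that
    unfolding tangent_quadruplet_def pl_def by blast
  have "u \<subseteq> face k (k \<in> J)"
  proof
    fix P assume P: "P \<in> u"
    from tan'[OF P] obtain m where m: "m \<noteq> 0" "P = plane_of m"
        "bform (M i) m m = 0 \<or> bform (M j) m m = 0"
      using tangent_to_planeE[OF sym inv] by metis
    obtain s t where "m = s *s E i J + t *s E j J"
      using pen[OF P] plane_through_axis_iff[OF indep2_E[OF ij(1), of J], of m] unfolding pl_def m(2) by blast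
    moreover from this have "m = t *s E j J + s *s E i J" by simp
    ultimately show "P \<in> face k (k \<in> J)"
      using m tangent_in_pencil[of i j k m s J t] tangent_in_pencil[of j i k m t J s] ij by auto
  qed
  then show ?thesis
    using u card_face[of k "k \<in> J"] unfolding tangent_quadruplet_def
    by (intro card_subset_eq) (auto intro: card_ge_0_finite)
qed

lemma face_quadruplet: "tangent_quadruplet F (face k s)"
proof -
  obtain a b where ab: "a \<noteq> b" "a \<noteq> k" "b \<noteq> k" "UNIV = {a, b, k}" by (rule other_indices)
  define S where "S = (if s then {k} else {})"
  have S: "a \<notin> S" "b \<notin> S" using ab by (auto simp: S_def)
  have f: "face k s = {pl a S, pl a (insert b S), pl b S, pl b (insert a S)}"
    unfolding S_def by (rule face_explicit[OF ab(1,4,2,3)])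
  obtain r where r: "E a (insert b S) = (1 + r) *s E a S - r *s E b S"
    using E_flip[OF ab(1), of S] S by auto
  obtain r' where r': "E b (insert a S) = (1 + r') *s E b S - r' *s E a S"
    using E_flip[OF ab(1)[symmetric], of S] S by auto
  have pencil: "in_pencil (face k s)"
    unfolding in_pencil_def
  proof (intro exI conjI ballI)
    show "proj_line (pl a S \<inter> pl b S)"
      unfolding pl_def by (rule proj_line_inter[OF indep2_E[OF ab(1)]])
    fix P assume P: "P \<in> face k s"
    then show "proj_plane P" unfolding f pl_def using proj_plane_plane_of E_nz by auto
    show "pl a S \<inter> pl b S \<subseteq> P" using P unfolding f pl_def r r' by (auto simp: plane_of_def)
  qed
  \<comment> \<open>The two edges of direction \<open>a\<close> touch \<open>Qd a\<close>, the other
    two touch \<open>Qd b\<close>.\<close>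
  define v where "v = {pl a S, pl a (insert b S)}"
  have v: "v \<subseteq> face k s" unfolding f v_def by blast
  have "pl a S \<noteq> pl a (insert b S)" unfolding pl_eq_iff using S ab(1) by blast
  then have c: "card v = 2" unfolding v_def by simp
  have ta: "\<forall>P\<in>v. tangent_to (Qd a) P" unfolding v_def by (simp add: tangent_Qd)
  have "face k s - v \<subseteq> {pl b S, pl b (insert a S)}" unfolding f v_def by blast
  moreover have "\<forall>P\<in>{pl b S, pl b (insert a S)}. tangent_to (Qd b) P" by (simp add: tangent_Qd)
  ultimately have tb: "\<forall>P\<in>face k s - v. tangent_to (Qd b) P" by (meson subsetD)
  have ne: "Qd a \<noteq> Qd b" using Qd_eq_iff ab(1) by blast
  show ?thesis
    unfolding tangent_quadruplet_def
    by (intro conjI card_face pencil bexI[OF _ Qd_F[of a]] bexI[OF _ Qd_F[of b]] ne exI[of _ v] v c ta tb)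
qed

section \<open>The configuration and its uniqueness\<close>

lemma configuration: "twelve_plane_configuration F edges verts faces"
  unfolding twelve_plane_configuration_def
proof (intro conjI ballI)
  show "card edges = 12" "card verts = 8" "card faces = 6"
    by (fact card_edges card_verts card_faces)+
  fix P assume "P \<in> edges"
  then obtain i J where P: "P = pl i J" by auto
  show "proj_plane P" unfolding P pl_def proj_plane_plane_of by (rule E_nz)
  show "card {t \<in> verts. P \<in> t} = 2" unfolding P by (rule card_verts_at)
  show "card {u \<in> faces. P \<in> u} = 2" unfolding P by (rule card_faces_at)
next
  fix t assume "t \<in> verts"
  then obtain J where t: "t = vert J" by blast
  show "t \<subseteq> edges" unfolding t cube_vertex_def by auto
  show "\<exists>Q X. tangent_triplet F t Q X" unfolding t by (rule vert_triplet)
next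
  fix u assume "u \<in> faces"
  then obtain k s where u: "u = face k s" by auto
  show "u \<subseteq> edges" unfolding u cube_face_def by auto
  show "tangent_quadruplet F u" unfolding u by (rule face_quadruplet)
qed

text \<open>A plane touches only the member of its direction, while a triplet touches three
  different quadrics.\<close>

lemma triplet_colors:
  assumes "tangent_triplet F t Q X" "pl i J \<in> t" "pl i J' \<in> t"
  shows "pl i J = pl i J'"
proof -
  have "Q (pl i J) = Qd i" "Q (pl i J') = Qd i"
    using assms tangent_pl_iff unfolding tangent_triplet_def tangent_to_def by metis+
  then show ?thesis using assms unfolding tangent_triplet_def inj_on_def by metis
qed

lemma vert_empty: "vert {} = range (\<lambda>i. plane_of (n i))"
  by (simp add: cube_vertex_def pl_def E_def)

text \<open>The given triplet is the vertex \<open>{}\<close>; \<open>triplet_colors\<close> and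
  \<open>quadruplet_eq_face\<close> supply the geometric hypotheses of
  \<open>cube_unique\<close>.\<close>

lemma unique_configuration:
  "\<exists>!(S, T, U). twelve_plane_configuration F S T U \<and> linked T U \<and> range (\<lambda>i. plane_of (n i)) \<in> T"
proof (rule ex1I[of _ "(edges, verts, faces)"], goal_cases)
  case 1
  have "vert {} \<in> verts" by blast
  then show ?case
    using configuration cube_linked[OF cube_axioms] by (simp add: vert_empty)
next
  case (2 STU)
  obtain S T U where STU: "STU = (S, T, U)" by (rule prod_cases3)
  with 2 have c: "twelve_plane_configuration F S T U" and l: "linked T U" and t: "vert {} \<in> T"
    by (simp_all add: vert_empty)
  have C: "card T = 8" "\<forall>t\<in>T. t \<subseteq> S \<and> (\<exists>Q X. tangent_triplet F t Q X)"
      "\<forall>P\<in>S. card {t\<in>T. P \<in> t} = 2" "card U = 6"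
      "\<forall>u\<in>U. u \<subseteq> S \<and> tangent_quadruplet F u" "\<forall>P\<in>S. card {u\<in>U. P \<in> u} = 2"
    using c unfolding twelve_plane_configuration_def by - (elim conjE, assumption)+
  have tr: "t \<subseteq> S \<and> card t = 3" if "t \<in> T" for t
    using bspec[OF C(2) that] unfolding tangent_triplet_def by (elim conjE exE) simp
  have col: "pl i J = pl i J'" if t: "t \<in> T" "pl i J \<in> t" "pl i J' \<in> t" for t i J J'
  proof -
    obtain Q X where "tangent_triplet F t Q X" using bspec[OF C(2) t(1)] by blast
    then show ?thesis using t(2,3) by (rule triplet_colors)
  qed
  have us: "u \<subseteq> S" if "u \<in> U" for u
    using bspec[OF C(5) that] by (rule conjunct1)
  have uf: "u = face k (k \<in> J)"
    if "u \<in> U" "i \<noteq> j" "k \<noteq> i" "k \<noteq> j" "pl i J \<in> u" "pl j J \<in> u" for u i j k J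
    using conjunct2[OF bspec[OF C(5) that(1)]] that(2-6) by (rule quadruplet_eq_face)
  note uniq = cube_unique[OF cube_axioms C(1) tr bspec[OF C(3)] C(4) us bspec[OF C(6)] l t col uf]
  have "S = edges \<and> T = verts \<and> U = faces"
    by (intro conjI uniq)
  then show ?case using STU by simp
qed

end

section \<open>Triplets in general position\<close>

lemma sum_subset3:
  fixes y :: "3 \<Rightarrow> 'b :: comm_monoid_add"
  shows "sum y J = (if 1 \<in> J then y 1 else 0) + (if 2 \<in> J then y 2 else 0) + (if 3 \<in> J then y 3 else 0)"
proof -
  have "sum y J = (\<Sum>i\<in>UNIV. if i \<in> J then y i else 0)"
    by (simp add: sum.If_cases)
  then show ?thesis by (simp add: sum_3)
qed

lemma sum_nonzero_subset3:
  fixes y :: "3 \<Rightarrow> complex"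
  assumes "\<And>i. 1 + y i \<noteq> 0" "\<And>i j. i \<noteq> j \<Longrightarrow> 1 + y i + y j \<noteq> 0" "1 + y 1 + y 2 + y 3 \<noteq> 0"
  shows "1 + sum y J \<noteq> 0"
  using assms(1)[of 1] assms(1)[of 2] assms(1)[of 3] assms(2)[of 1 2] assms(2)[of 1 3] assms(2)[of 2 3] assms(3)
  unfolding sum_subset3[of y J] by (auto simp: add.assoc)

text \<open>Makes both sum relations available for any numbering of the indices.\<close>

lemma triad_sums:
  assumes triad: "dual_triad F M" and col: "M 1 *v n 1 + M 2 *v n 2 + M 3 *v n 3 = 0"
    and U: "UNIV = {i, j, k}" "i \<noteq> j" "i \<noteq> k" "j \<noteq> k"
  shows "M i *v x + M j *v x + M k *v x = 0" "M i *v n i + M j *v n j + M k *v n k = 0"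
proof -
  have s: "(\<Sum>l\<in>UNIV. f l) = f i + f j + f k" for f :: "3 \<Rightarrow> complex^4"
    unfolding U(1) using U(2-4) by (simp add: add.assoc)
  have "M 1 *v x + M 2 *v x + M 3 *v x = 0" using triad by (simp add: dual_triad_def)
  then show "M i *v x + M j *v x + M k *v x = 0"
    using s[of "\<lambda>l. M l *v x"] sum_3[of "\<lambda>l. M l *v x"] by simp
  show "M i *v n i + M j *v n j + M k *v n k = 0"
    using s[of "\<lambda>l. M l *v n l"] sum_3[of "\<lambda>l. M l *v n l"] col by simp
qed

text \<open>A scaled triplet before the scalars \<open>y\<close> are chosen; the weights are already
  determined by the differences of the \<open>n i\<close>.\<close>

locale triad_points =
  fixes F :: "subsp set" and M :: "3 \<Rightarrow> complex^4^4" and n :: "3 \<Rightarrow> complex^4"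
    and w :: "3 \<Rightarrow> 3 \<Rightarrow> complex"
  assumes triad: "dual_triad F M"
    and collinear: "M 1 *v n 1 + M 2 *v n 2 + M 3 *v n 3 = 0"
    and iso: "bform (M j) (n j) (n j) = 0"
    and w: "w j i = bform (M j) (n i - n j) (n i - n j) / 2"
begin

lemma sym: "symmetric_mat (M j)" and inv: "invertible (M j)"
  using triad by (auto simp: dual_triad_def)

lemma comm: "bform (M j) x z = bform (M j) z x"
  by (rule bform_commute[OF sym])

lemma self: "bform (M j) (n i) (n i) = 2 * w j i + 2 * bform (M j) (n i) (n j)"
  using comm[of j "n j" "n i"] by (simp add: w iso field_simps)

lemma sum_forms:
  assumes "UNIV = {i, j, k}" "i \<noteq> j" "i \<noteq> k" "j \<noteq> k"
  shows "bform (M i) x z + bform (M j) x z + bform (M k) x z = 0"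
    "bform (M i) x (n i) + bform (M j) x (n j) + bform (M k) x (n k) = 0"
  unfolding bform_def dot_simps[symmetric] triad_sums[OF triad collinear assms] by simp_all

text \<open>In both sum relations evaluated at \<open>n i\<close> only two terms remain, because
  \<open>n i\<close> is isotropic for \<open>M i\<close>.\<close>

lemma w_opposite:
  assumes U: "UNIV = {i, j, k}" "i \<noteq> j" "i \<noteq> k" "j \<noteq> k"
  shows "w k i = - w j i" "bform (M k) (n i) (n k) = - bform (M j) (n i) (n j)"
proof -
  show 1: "bform (M k) (n i) (n k) = - bform (M j) (n i) (n j)"
    using sum_forms(2)[OF U, of "n i"] by (simp add: iso eq_neg_iff_add_eq_0 add.commute)
  have "bform (M j) (n i) (n i) + bform (M k) (n i) (n i) = 0"
    using sum_forms(1)[OF U, of "n i" "n i"] by (simp add: iso)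
  then have "2 * (w j i + w k i) = 0" unfolding self 1 by (simp add: algebra_simps)
  then have "w j i + w k i = 0" by (simp only: mult_eq_0_iff) simp
  then show "w k i = - w j i" by (simp add: eq_neg_iff_add_eq_0 add.commute)
qed

text \<open>Passing to the other index \<open>j \<noteq> i\<close> changes the sign on both sides of
  the relation for \<open>y i\<close>, so one instance yields both. The entries involving
  \<open>n j\<close> and the diagonal ones then follow directly.\<close>

lemma gram:
  assumes y: "\<And>i. \<exists>j. j \<noteq> i \<and> w j i * y i = bform (M j) (n i) (n j)"
  shows "bform (M j) (n i) (n k) = w j i * y i + w j k * y k + (if i = k then 2 * w j i else 0)"
proof -
  have y': "w j i * y i = bform (M j) (n i) (n j)" if "i \<noteq> j" for i j
  proof -
    obtain k where k: "k \<noteq> i" "w k i * y i = bform (M k) (n i) (n k)" using y by blast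
    show ?thesis
    proof (cases "k = j")
      case False
      obtain l where "l \<noteq> i" "l \<noteq> j" and U: "UNIV = {i, j, l}" using \<open>i \<noteq> j\<close> by (rule third_index)
      then have "k = i \<or> k = j \<or> k = l" by blast
      then have "k = l" using k False by blast
      then show ?thesis using w_opposite[OF U] k(2) \<open>i \<noteq> j\<close> \<open>l \<noteq> i\<close> \<open>l \<noteq> j\<close> by simp
    qed (use k in simp)
  qed
  have w0: "w j j = 0" for j by (simp add: w)
  consider "i = j" "k = j" | "i = j" "k \<noteq> j" | "i \<noteq> j" "k = j" | "i \<noteq> j" "k = i" |
    "i \<noteq> j" "k \<noteq> j" "k \<noteq> i" by blast
  then show ?thesis
  proof cases
    case 1
    then show ?thesis by (simp add: iso w0)
  next
    case 2
    then show ?thesis using y'[of k j] comm by (simp add: w0)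
  next
    case 3
    then show ?thesis using y'[of i j] by (simp add: w0)
  next
    case 4
    then show ?thesis using y'[of i j] self[of j i] by simp
  next
    case 5
    obtain l where l: "l \<noteq> i" "l \<noteq> j" "UNIV = {i, j, l}" using 5(1) by (rule third_index)
    then have "k = i \<or> k = j \<or> k = l" by blast
    then have "l = k" using 5 by blast
    then have U: "UNIV = {i, j, k}" using l by simp
    have U': "UNIV = {k, j, i}" using U by (simp add: insert_commute)
    have "bform (M k) (n i) (n k) = - bform (M j) (n i) (n j)"
      using w_opposite(2)[OF U] 5 by blast
    moreover have "bform (M i) (n k) (n i) = - bform (M j) (n k) (n j)"
      using w_opposite(2)[OF U'] 5 by blast
    moreover have "bform (M i) (n i) (n k) + bform (M j) (n i) (n k) + bform (M k) (n i) (n k) = 0"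
      using sum_forms(1)[OF U] 5 by blast
    \<comment> \<open>The forms of \<open>M i\<close> and \<open>M k\<close> are rewritten through
      \<open>M j\<close>, using that the three forms add up to zero.\<close>
    ultimately have "bform (M j) (n i) (n k) = bform (M j) (n i) (n j) + bform (M j) (n k) (n j)"
      using comm[of i "n i" "n k"] by (simp add: algebra_simps)
    then show ?thesis using y'[of i j] y'[of k j] 5 by simp
  qed
qed

lemma cube_dataI:
  assumes "\<And>i. \<exists>j. j \<noteq> i \<and> w j i * y i = bform (M j) (n i) (n j)"
    and "\<And>c i. (\<Sum>k\<in>UNIV. c k *s n k) = 0 \<Longrightarrow> c i = 0"
    and "\<And>i j. i \<noteq> j \<Longrightarrow> w j i \<noteq> 0" "\<And>i. y i \<noteq> 0" "\<And>J. 1 + sum y J \<noteq> 0"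
  shows "cube_data F M n y w"
  by unfold_locales (rule triad collinear gram assms | assumption | simp add: w)+

end

text \<open>Each form has two roots in the pencil: \<open>a\<close> and \<open>?a\<close> for
  \<open>A\<close>, \<open>b\<close> and \<open>?b\<close> for \<open>B\<close>. Every asserted
  inequality excludes a coincidence among these four planes.\<close>

lemma pencil_four_tangent_planes:
  assumes A: "symmetric_mat A" "invertible A" and B: "symmetric_mat B" "invertible B"
    and ab: "indep2 a b" and z: "bform A a a = 0" "bform B b b = 0"
    and c: "card (tangent_planes_through (plane_of a \<inter> plane_of b)
      (quadric_of (matrix_inv A)) (quadric_of (matrix_inv B))) = 4" (is "card ?Z = 4")
  shows "bform A a b \<noteq> 0" "bform B a b \<noteq> 0" "bform A b b \<noteq> 0" "bform B a a \<noteq> 0"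
    "4 * bform A a b * bform B a b \<noteq> bform A b b * bform B a a"
proof -
  let ?f = "bform A a b" and ?g = "bform B a b" and ?p = "bform A b b" and ?q = "bform B a a"
  have Am: "bform A (s *s a + t *s b) (s *s a + t *s b) = t * (2 * s * ?f + t * ?p)" for s t
    using z bform_commute[OF A(1), of b a] by (simp add: algebra_simps)
  have Bm: "bform B (s *s a + t *s b) (s *s a + t *s b) = s * (2 * t * ?g + s * ?q)" for s t
    using z bform_commute[OF B(1), of b a] by (simp add: algebra_simps)
  have nz: "s *s a + t *s b \<noteq> 0" if "s \<noteq> 0 \<or> t \<noteq> 0" for s t
    using ab that unfolding indep2_def by blast
  have mem: "plane_of (s *s a + t *s b) \<in> ?Z"
    if "s \<noteq> 0 \<or> t \<noteq> 0" "t * (2 * s * ?f + t * ?p) = 0 \<or> s * (2 * t * ?g + s * ?q) = 0" for s t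
    using that nz[OF that(1)] Am[of s t] Bm[of s t]
    by (auto simp: tangent_planes_through_def proj_plane_plane_of plane_through_axis_iff[OF ab]
        tangent_plane_of_iff[OF A] tangent_plane_of_iff[OF B])
  have memE: "\<exists>s t. R = plane_of (s *s a + t *s b) \<and> (s \<noteq> 0 \<or> t \<noteq> 0) \<and>
      (t * (2 * s * ?f + t * ?p) = 0 \<or> s * (2 * t * ?g + s * ?q) = 0)" if R: "R \<in> ?Z" for R
  proof -
    obtain m where m: "m \<noteq> 0" "R = plane_of m" "bform A m m = 0 \<or> bform B m m = 0"
      using R tangent_to_planeE[OF A] tangent_to_planeE[OF B]
      unfolding tangent_planes_through_def mem_Collect_eq by metis
    obtain s t where st: "m = s *s a + t *s b"
      using R plane_through_axis_iff[OF ab, of m] m(2) unfolding tangent_planes_through_def by blast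
    have "s \<noteq> 0 \<or> t \<noteq> 0" using m(1) st by auto
    then show ?thesis using m(2,3) unfolding st Am Bm by blast
  qed
  have inj: "inj (\<lambda>t. plane_of (a + t *s b))"
  proof (rule injI)
    fix t t' assume e: "plane_of (a + t *s b) = plane_of (a + t' *s b)"
    have "a + t *s b \<noteq> 0" using nz[of 1 t] by simp
    then obtain k where "a + t' *s b = k *s (a + t *s b)" using plane_of_eqD[OF e] by blast
    then have "(1 - k) *s a + (t' - k * t) *s b = 0"
      by (simp add: vec.scale_left_diff_distrib vec.scale_right_distrib algebra_simps)
    then have "1 - k = 0 \<and> t' - k * t = 0" using ab unfolding indep2_def by blast
    then show "t = t'" by simp
  qed
  have infinite: "infinite (range (\<lambda>t. plane_of (a + t *s b)))"
    using inj infinite_UNIV_char_0[where 'a = complex] by (simp add: finite_image_iff)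
  have finZ: "finite ?Z" using c by (metis card.infinite zero_neq_numeral)
  \<comment> \<open>Otherwise \<open>A\<close> vanishes on the whole pencil, which has infinitely
    many planes.\<close>
  have fp: "?f \<noteq> 0 \<or> ?p \<noteq> 0"
  proof (rule ccontr)
    assume "\<not> ?thesis"
    then have "range (\<lambda>t. plane_of (a + t *s b)) \<subseteq> ?Z" using mem[of 1] by auto
    then show False using finZ infinite finite_subset by blast
  qed
  have gq: "?g \<noteq> 0 \<or> ?q \<noteq> 0"
  proof (rule ccontr)
    assume "\<not> ?thesis"
    then have "range (\<lambda>t. plane_of (a + t *s b)) \<subseteq> ?Z" using mem[of 1] by auto
    then show False using finZ infinite finite_subset by blast
  qed
  let ?a = "?p *s a - (2 * ?f) *s b" and ?b = "?q *s b - (2 * ?g) *s a"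
  \<comment> \<open>The root of the linear factor is unique up to scaling, also when
    \<open>p = 0\<close>.\<close>
  have root: "\<exists>k. k \<noteq> 0 \<and> s *s u + t *s v = k *s (p *s u - (2 * f) *s v)"
    if "2 * s * f + t * p = 0" "s \<noteq> 0 \<or> t \<noteq> 0" "f \<noteq> 0 \<or> p \<noteq> 0" for s t f p and u v :: "complex^4"
  proof (cases "p = 0")
    case True
    then show ?thesis using that by (intro exI[of _ "- t / (2 * f)"]) auto
  next
    case False
    then have "t = - (2 * s * f) / p" using that(1) by (simp add: field_simps eq_neg_iff_add_eq_0)
    then show ?thesis using that False
      by (intro exI[of _ "s / p"]) (auto simp: vec.scale_right_diff_distrib algebra_simps)
  qed
  have sub: "?Z \<subseteq> {plane_of a, plane_of ?a, plane_of b, plane_of ?b}"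
  proof
    fix R assume "R \<in> ?Z"
    then obtain s t where R: "R = plane_of (s *s a + t *s b)" "s \<noteq> 0 \<or> t \<noteq> 0"
      "t * (2 * s * ?f + t * ?p) = 0 \<or> s * (2 * t * ?g + s * ?q) = 0" using memE by blast
    then consider "t = 0" "s \<noteq> 0" | "s = 0" "t \<noteq> 0" | "2 * s * ?f + t * ?p = 0" | "2 * t * ?g + s * ?q = 0"
      by auto
    then show "R \<in> {plane_of a, plane_of ?a, plane_of b, plane_of ?b}"
    proof cases
      case 1
      then show ?thesis unfolding R(1) by (simp add: plane_of_scale)
    next
      case 2
      then show ?thesis unfolding R(1) by (simp add: plane_of_scale)
    next
      case 3
      from root[OF this R(2) fp, of a b] obtain k where k: "k \<noteq> 0" "s *s a + t *s b = k *s ?a" by blast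
      show ?thesis unfolding R(1) k(2) plane_of_scale[OF k(1)] by blast
    next
      case 4
      have "t \<noteq> 0 \<or> s \<noteq> 0" using R(2) by blast
      from root[OF 4 this gq, of b a] obtain k where k: "k \<noteq> 0" "t *s b + s *s a = k *s ?b" by blast
      show ?thesis unfolding R(1) add.commute[of "s *s a"] k(2) plane_of_scale[OF k(1)] by blast
    qed
  qed
  have "4 \<le> card {plane_of a, plane_of ?a, plane_of b, plane_of ?b}"
    using card_mono[OF _ sub] c by simp
  then have dist: "distinct [plane_of a, plane_of ?a, plane_of b, plane_of ?b]"
    by (auto simp: card_insert_if split: if_splits)
  have f: "?f \<noteq> 0"
  proof
    assume "?f = 0"
    then have "plane_of ?a = plane_of a" using fp by (simp add: plane_of_scale)
    then show False using dist by simp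
  qed
  have g: "?g \<noteq> 0"
  proof
    assume "?g = 0"
    then have "plane_of ?b = plane_of b" using gq by (simp add: plane_of_scale)
    then show False using dist by simp
  qed
  have p: "?p \<noteq> 0"
  proof
    assume "?p = 0"
    then have e: "?a = (- 2 * ?f) *s b" by simp
    have "- 2 * ?f \<noteq> 0" using f by simp
    then have "plane_of ?a = plane_of b" unfolding e by (rule plane_of_scale)
    then show False using dist by simp
  qed
  have q: "?q \<noteq> 0"
  proof
    assume "?q = 0"
    then have e: "?b = (- 2 * ?g) *s a" by simp
    have "- 2 * ?g \<noteq> 0" using g by simp
    then have "plane_of ?b = plane_of a" unfolding e by (rule plane_of_scale)
    then show False using dist by simp
  qed
  have "4 * ?f * ?g \<noteq> ?p * ?q"
  proof
    assume e: "4 * ?f * ?g = ?p * ?q"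
    have "(- 2 * ?g) *s ?a = (?p * (- 2 * ?g)) *s a + (4 * ?f * ?g) *s b"
      by (simp add: vec.scale_right_diff_distrib algebra_simps)
    also have "\<dots> = ?p *s ?b" unfolding e by (simp add: vec.scale_right_diff_distrib algebra_simps)
    finally have "plane_of ?a = plane_of ?b"
      using plane_of_scale[of "- 2 * ?g" ?a] plane_of_scale[of ?p ?b] g p by simp
    then show False using dist by simp
  qed
  then show "?f \<noteq> 0" "?g \<noteq> 0" "?p \<noteq> 0" "?q \<noteq> 0" "4 * ?f * ?g \<noteq> ?p * ?q" using f g p q by blast+
qed

text \<open>Rescaling the plane vectors makes the touching vectors add up to zero. The first pencil
  condition of general position then bounds away \<open>y i\<close>, \<open>1 + y i\<close> and
  \<open>1 + y i + y j\<close>; the one on \<open>R\<close> and \<open>R'\<close> does so for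
  \<open>w\<close> and \<open>1 + y 1 + y 2 + y 3\<close>.\<close>

lemma general_triplet_cube_data:
  assumes F: "pencil_family F A B" and t: "tangent_triplet F t Q X" "general_position t Q"
  obtains M n y w where "cube_data F M n y w" "t = range (\<lambda>i. plane_of (n i))"
proof -
  have "card t = 3" "finite t"
    using t(1) unfolding tangent_triplet_def by (auto intro: card_ge_0_finite)
  then obtain p where p: "bij_betw p (UNIV :: 3 set) t"
    using finite_same_card_bij[of "UNIV :: 3 set" t] by auto
  have pt: "p j \<in> t" for j using p by (auto simp: bij_betw_def)
  have pinj: "p i = p j \<longleftrightarrow> i = j" for i j using p by (auto simp: bij_betw_def inj_eq)
  have trange: "t = range p" using p by (simp add: bij_betw_def)
  have Qinj: "inj (\<lambda>j. Q (p j))"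
    using t(1) pt pinj unfolding tangent_triplet_def inj_def inj_on_def by metis
  have QF: "Q (p j) \<in> F" and Qt: "touches (Q (p j)) (p j) (X (p j))" for j
    using t(1) pt unfolding tangent_triplet_def by blast+
  obtain M where M: "dual_triad F M" "\<And>j. Q (p j) = quadric_of (matrix_inv (M j))"
    using dual_triad_exists[OF F Qinj QF] by metis
  have sym: "symmetric_mat (M j)" and inv: "invertible (M j)" for j
    using M(1) by (auto simp: dual_triad_def)
  have "\<forall>j. \<exists>n. n \<noteq> 0 \<and> p j = plane_of n \<and> bform (M j) n n = 0 \<and> X (p j) = vec.span {M j *v n}"
    using Qt unfolding M(2) touches_dual_iff[OF sym inv] by blast
  then obtain m where m: "\<And>j. m j \<noteq> 0" "\<And>j. p j = plane_of (m j)" "\<And>j. bform (M j) (m j) (m j) = 0"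
      "\<And>j. X (p j) = vec.span {M j *v m j}" by metis
  obtain L where L: "proj_line L" "\<And>j. X (p j) \<subseteq> L"
    using t(1) pt unfolding tangent_triplet_def by blast
  have "M j *v m j \<in> L" for j
    using L unfolding m(4) by (simp add: span_singleton_subset_iff proj_line_def)
  then obtain c :: "3 \<Rightarrow> complex" where c: "\<exists>i. c i \<noteq> 0" "c 1 *s (M 1 *v m 1) + c 2 *s (M 2 *v m 2) + c 3 *s (M 3 *v m 3) = 0"
    using dependent3_in_line[OF L(1), of "\<lambda>j. M j *v m j"] by blast
  define n where "n = (\<lambda>j. c j *s m j)"
  have np: "\<not> in_pencil t"
    and gp1: "\<forall>P\<in>t. \<forall>P'\<in>t. P \<noteq> P' \<longrightarrow> card (tangent_planes_through (P \<inter> P') (Q P) (Q P')) = 4"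
    and gp2: "\<forall>P\<in>t. \<forall>P'\<in>t. \<forall>K\<in>t. \<forall>R R'. P \<noteq> P' \<and> P \<noteq> K \<and> P' \<noteq> K \<and> R \<noteq> P \<and> R' \<noteq> P' \<and>
        P \<inter> K \<subseteq> R \<and> tangent_to (Q P) R \<and> P' \<inter> K \<subseteq> R' \<and> tangent_to (Q P') R' \<longrightarrow>
        card (tangent_planes_through (R \<inter> R') (Q P) (Q P')) = 4"
    using t(2) unfolding general_position_def by - (elim conjE, assumption)+
  have m_indep2: "indep2 (m i) (m j)" if "i \<noteq> j" for i j
    unfolding indep2_plane_of_iff[OF m(1) m(1)] m(2)[symmetric] pinj by (rule that)
  have card1: "card (tangent_planes_through (p i \<inter> p j) (Q (p i)) (Q (p j))) = 4" if "i \<noteq> j" for i j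
    using gp1 pt[of i] pt[of j] that pinj[of i j] by blast
  have m4: "bform (M i) (m i) (m j) \<noteq> 0" "bform (M j) (m i) (m j) \<noteq> 0" if "i \<noteq> j" for i j
    using pencil_four_tangent_planes(1,2)[OF sym inv sym inv m_indep2[OF that] m(3) m(3)]
      card1[OF that] unfolding m(2) M(2)[unfolded m(2)] by blast+
  have colm: "M 1 *v n 1 + M 2 *v n 2 + M 3 *v n 3 = 0" using c(2) by (simp add: n_def vec.scale)
  \<comment> \<open>A relation between only two touching vectors, paired with their planes, would
    contradict \<open>m4\<close>.\<close>
  have c0: "c k \<noteq> 0" for k
  proof
    assume k: "c k = 0"
    obtain i j where ij: "i \<noteq> j" "i \<noteq> k" "j \<noteq> k" "UNIV = {i, j, k}" by (rule other_indices)
    have "M i *v n i + M j *v n j + M k *v n k = 0"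
      using triad_sums(2)[OF M(1) colm ij(4,1-3)] .
    then have z: "c i *s (M i *v m i) + c j *s (M j *v m j) = 0" using k by (simp add: n_def vec.scale)
    have "m x \<odot> (c i *s (M i *v m i) + c j *s (M j *v m j)) =
        c i * bform (M i) (m x) (m i) + c j * bform (M j) (m x) (m j)" for x
      by (simp add: bform_def)
    then have z: "c i * bform (M i) (m x) (m i) + c j * bform (M j) (m x) (m j) = 0" for x
      unfolding z by simp
    have "c j = 0" using z[of i] m4(2)[OF ij(1)] by (simp add: m(3))
    moreover have "c i = 0" using z[of j] m4(2)[OF not_sym[OF ij(1)]] by (simp add: m(3))
    ultimately have "c x = 0" if "x = i \<or> x = j \<or> x = k" for x using k that by blast
    then have "c x = 0" for x using ij(4) by blast
    then show False using c(1) by blast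
  qed
  have n0: "n j \<noteq> 0" for j using c0 m(1) by (simp add: n_def)
  have pn: "p j = plane_of (n j)" for j unfolding m(2) n_def plane_of_scale[OF c0] ..
  have iso: "bform (M j) (n j) (n j) = 0" for j by (simp add: n_def m(3))
  have indep2: "indep2 (n i) (n j)" if "i \<noteq> j" for i j
    unfolding indep2_plane_of_iff[OF n0 n0] pn[symmetric] pinj by (rule that)
  have card1': "card (tangent_planes_through (plane_of (n i) \<inter> plane_of (n j))
      (quadric_of (matrix_inv (M i))) (quadric_of (matrix_inv (M j)))) = 4" if "i \<noteq> j" for i j
    using card1[OF that] unfolding M(2) unfolding pn .
  note four = pencil_four_tangent_planes[OF sym inv sym inv]
  have n4: "bform (M i) (n i) (n j) \<noteq> 0" "bform (M j) (n i) (n j) \<noteq> 0"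
    "bform (M i) (n j) (n j) \<noteq> 0" "bform (M j) (n i) (n i) \<noteq> 0"
    "4 * bform (M i) (n i) (n j) * bform (M j) (n i) (n j) \<noteq> bform (M i) (n j) (n j) * bform (M j) (n i) (n i)"
    if "i \<noteq> j" for i j
    using four[OF indep2[OF that] iso iso card1'[OF that]] by blast+
  have indep: "d i = 0" if d: "(\<Sum>k\<in>UNIV. d k *s n k) = 0" for d i
  proof -
    have z: "d 1 *s n 1 + d 2 *s n 2 + d 3 *s n 3 = 0" using d by (simp add: sum_3)
    have i12: "indep2 (n 1) (n 2)" by (rule indep2) simp
    have "d 3 = 0"
    proof (rule ccontr)
      assume d3: "d 3 \<noteq> 0"
      have "(1 / d 3) *s (d 1 *s n 1 + d 2 *s n 2 + d 3 *s n 3) = 0" unfolding z by simp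
      then have "(d 1 / d 3) *s n 1 + (d 2 / d 3) *s n 2 + n 3 = 0"
        using d3 by (simp add: vec.scale_right_distrib)
      then have "n 3 = (- d 1 / d 3) *s n 1 + (- d 2 / d 3) *s n 2"
        by (simp add: eq_neg_iff_add_eq_0[symmetric] add.commute add.left_commute)
      then have "plane_of (n 1) \<inter> plane_of (n 2) \<subseteq> plane_of (n 3)"
        using plane_through_axis_iff[OF i12] by blast
      then have "plane_of (n 1) \<inter> plane_of (n 2) \<subseteq> plane_of (n j)" for j
        using exhaust_3[of j] by auto
      then have "in_pencil t"
        unfolding in_pencil_def trange pn using proj_line_inter[OF i12] n0 proj_plane_plane_of by blast
      then show False using np by blast
    qed
    then have "d 1 = 0 \<and> d 2 = 0" using z i12 unfolding indep2_def by simp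
    then show ?thesis using \<open>d 3 = 0\<close> exhaust_3[of i] by auto
  qed
  define w where "w = (\<lambda>j i. bform (M j) (n i - n j) (n i - n j) / 2)"
  interpret triad_points F M n w
    by unfold_locales (auto simp: M(1) colm iso w_def)
  have card2: "card (tangent_planes_through (R \<inter> R') (Q (p j)) (Q (p k))) = 4"
    if "UNIV = {i, j, k}" "i \<noteq> j" "i \<noteq> k" "j \<noteq> k" "R \<noteq> p j" "R' \<noteq> p k" "p j \<inter> p i \<subseteq> R" "p k \<inter> p i \<subseteq> R'"
      "tangent_to (Q (p j)) R" "tangent_to (Q (p k)) R'" for i j k R R'
  proof -
    have "p j \<noteq> p k \<and> p j \<noteq> p i \<and> p k \<noteq> p i \<and> R \<noteq> p j \<and> R' \<noteq> p k \<and>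
        p j \<inter> p i \<subseteq> R \<and> tangent_to (Q (p j)) R \<and> p k \<inter> p i \<subseteq> R' \<and> tangent_to (Q (p k)) R'"
      using that pinj by blast
    then show ?thesis
      using gp2[THEN bspec, OF pt[of j], THEN bspec, OF pt[of k], THEN bspec, OF pt[of i], THEN spec,
          of R, THEN spec, of R'] by blast
  qed
  \<comment> \<open>The two vectors play \<open>R\<close> and \<open>R'\<close> in the last clause
    of \<open>general_position\<close>, with \<open>p i\<close> as the plane
    \<open>K\<close>.\<close>
  have reflect: "4 * bform (M j) (a *s n j + b *s n i) (a *s n k + b' *s n i) *
        bform (M k) (a *s n j + b *s n i) (a *s n k + b' *s n i) \<noteq>
      bform (M j) (a *s n k + b' *s n i) (a *s n k + b' *s n i) *
        bform (M k) (a *s n j + b *s n i) (a *s n j + b *s n i)"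
      "bform (M j) (a *s n j + b *s n i) (a *s n k + b' *s n i) \<noteq> 0"
    if U: "UNIV = {i, j, k}" "i \<noteq> j" "i \<noteq> k" "j \<noteq> k" and ab: "a \<noteq> 0" "b \<noteq> 0" "b' \<noteq> 0"
      and R: "bform (M j) (a *s n j + b *s n i) (a *s n j + b *s n i) = 0"
        "bform (M k) (a *s n k + b' *s n i) (a *s n k + b' *s n i) = 0" for i j k a b b'
  proof -
    let ?R = "a *s n j + b *s n i" and ?R' = "a *s n k + b' *s n i"
    have s: "(\<Sum>l\<in>UNIV. f l) = f i + f j + f k" for f :: "3 \<Rightarrow> complex^4"
      unfolding U(1) using U(2-4) by (simp add: add.assoc)
    have ind: "d i = 0 \<and> d j = 0 \<and> d k = 0" if "d i *s n i + d j *s n j + d k *s n k = 0" for d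
      using indep[of d] that s[of "\<lambda>l. d l *s n l"] by simp
    have ind': "x = 0 \<and> y = 0 \<and> z = 0" if "x *s n i + y *s n j + z *s n k = 0" for x y z
      using ind[of "\<lambda>l. if l = i then x else if l = j then y else z"] that U by auto
    have ind2: "indep2 ?R ?R'"
      unfolding indep2_def
    proof (intro allI impI)
      fix x z assume "x *s ?R + z *s ?R' = 0"
      then have "(x * b + z * b') *s n i + (x * a) *s n j + (z * a) *s n k = 0"
        by (simp add: vec.scale_right_distrib vec.scale_left_distrib algebra_simps)
      from ind'[OF this] show "x = 0 \<and> z = 0" using ab by simp
    qed
    have R0: "?R \<noteq> 0" "?R' \<noteq> 0" using indep2_nonzero[OF ind2] .
    have "plane_of ?R \<noteq> p j"
    proof
      assume "plane_of ?R = p j"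
      then have "plane_of (n j) = plane_of ?R" unfolding pn by simp
      then obtain e where "?R = e *s n j" using plane_of_eqD n0 by blast
      then have "b *s n i + (a - e) *s n j + 0 *s n k = 0"
        by (simp add: vec.scale_left_diff_distrib algebra_simps)
      from ind'[OF this] show False using ab by simp
    qed
    moreover have "plane_of ?R' \<noteq> p k"
    proof
      assume "plane_of ?R' = p k"
      then have "plane_of (n k) = plane_of ?R'" unfolding pn by simp
      then obtain e where "?R' = e *s n k" using plane_of_eqD n0 by blast
      then have "b' *s n i + 0 *s n j + (a - e) *s n k = 0"
        by (simp add: vec.scale_left_diff_distrib algebra_simps)
      from ind'[OF this] show False using ab by simp
    qed
    moreover have "p j \<inter> p i \<subseteq> plane_of ?R" "p k \<inter> p i \<subseteq> plane_of ?R'"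
      unfolding pn by (auto simp: plane_of_def)
    moreover have "tangent_to (Q (p j)) (plane_of ?R)" "tangent_to (Q (p k)) (plane_of ?R')"
      unfolding M(2) tangent_plane_of_iff[OF sym inv] using R R0 by simp_all
    ultimately have "card (tangent_planes_through (plane_of ?R \<inter> plane_of ?R') (Q (p j)) (Q (p k))) = 4"
      by (rule card2[OF U])
    note four[OF ind2 R this[unfolded M(2)]]
    then show "4 * bform (M j) ?R ?R' * bform (M k) ?R ?R' \<noteq> bform (M j) ?R' ?R' * bform (M k) ?R ?R"
      "bform (M j) ?R ?R' \<noteq> 0" by blast+
  qed
  \<comment> \<open>If \<open>w j i\<close> vanishes, so does \<open>w k i\<close>, and
    \<open>n j - n i\<close> and \<open>n k - n i\<close> are the reflected planes. By the sum
    relations \<open>M j\<close> and \<open>M k\<close> send them to opposite vectors, so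
    \<open>M j\<close> pairs them to zero, against \<open>reflect\<close>.\<close>
  have wnz: "w j i \<noteq> 0" if ij: "i \<noteq> j" for i j
  proof
    assume w0: "w j i = 0"
    obtain k where k: "k \<noteq> i" "k \<noteq> j" and U: "UNIV = {i, j, k}" using ij by (rule third_index)
    note U' = U ij not_sym[OF k(1)] not_sym[OF k(2)]
    have e: "1 *s n j + (-1) *s n i = n j - n i" "1 *s n k + (-1) *s n i = n k - n i" by simp_all
    have z: "bform (M j) (n j - n i) (n j - n i) = 0"
      using w0 comm[of j "n i" "n j"] by (simp add: w_def algebra_simps)
    have "w k i = 0" using w_opposite(1)[OF U'] w0 by simp
    then have z': "bform (M k) (n k - n i) (n k - n i) = 0"
      using comm[of k "n i" "n k"] by (simp add: w_def algebra_simps)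
    have "bform (M j) (n j - n i) (n k - n i) \<noteq> 0"
      using reflect(2)[OF U', of 1 "-1" "-1"] z z' unfolding e by simp
    moreover have "M j *v (n j - n i) + M k *v (n k - n i) =
        (M i *v n i + M j *v n j + M k *v n k) - (M i *v n i + M j *v n i + M k *v n i)"
      by (simp add: vec.diff algebra_simps)
    then have "M j *v (n j - n i) + M k *v (n k - n i) = 0"
      unfolding triad_sums[OF M(1) colm U'] by simp
    then have "M j *v (n j - n i) = - (M k *v (n k - n i))"
      unfolding eq_neg_iff_add_eq_0 .
    then have "bform (M j) (n k - n i) (n j - n i) = - bform (M k) (n k - n i) (n k - n i)"
      unfolding bform_def by simp
    ultimately show False using z' comm[of j "n k - n i" "n j - n i"] by simp
  qed
  have "\<forall>i. \<exists>y j. j \<noteq> i \<and> w j i * y = bform (M j) (n i) (n j)"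
  proof
    fix i :: 3
    obtain j where "j \<noteq> i" by (rule other_index)
    then show "\<exists>y j. j \<noteq> i \<and> w j i * y = bform (M j) (n i) (n j)"
      using wnz[of i j] by (intro exI[of _ "bform (M j) (n i) (n j) / w j i"] exI[of _ j]) auto
  qed
  then obtain y where y: "\<And>i. \<exists>j. j \<noteq> i \<and> w j i * y i = bform (M j) (n i) (n j)" by metis
  note gram = gram[of y, OF y]
  have w_diag: "w j j = 0" for j by (simp add: w_def)
  have ynz: "y i \<noteq> 0" for i
    using y[of i] n4(2)[of i] by auto
  have y1: "1 + y i \<noteq> 0" for i
  proof
    assume "1 + y i = 0"
    then have "y i = - 1" by (simp add: eq_neg_iff_add_eq_0 add.commute)
    obtain j where "j \<noteq> i" by (rule other_index)
    \<comment> \<open>By the Gram matrix this value is \<open>2 * w j i * (1 + y i)\<close>.\<close>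
    then have "bform (M j) (n i) (n i) \<noteq> 0" using n4(4)[of i j] by blast
    then show False unfolding gram by (simp add: \<open>y i = - 1\<close>)
  qed
  have y2: "1 + y i + y j \<noteq> 0" if "i \<noteq> j" for i j
  proof
    assume z: "1 + y i + y j = 0"
    have "bform (M i) (n j) (n j) * bform (M j) (n i) (n i) - 4 * bform (M i) (n i) (n j) * bform (M j) (n i) (n j)
        = 4 * w i j * w j i * (1 + y i + y j)"
      using that unfolding gram by (simp add: w_diag algebra_simps)
    then show False using n4(5)[OF that] unfolding z by simp
  qed
  have y3: "1 + y 1 + y 2 + y 3 \<noteq> 0"
  proof
    assume z: "1 + y 1 + y 2 + y 3 = 0"
    have U: "UNIV = {3, 1, 2 :: 3}" using UNIV_3 by auto
    define a where "a = 1 + y 3"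
    \<comment> \<open>These are the vectors called \<open>E 1 {3}\<close> and \<open>E 2 {3}\<close>
      in \<open>cube_data\<close>.\<close>
    let ?R = "a *s n 1 + (- y 3) *s n 3" and ?R' = "a *s n 2 + (- y 3) *s n 3"
    have "a \<noteq> 0" "- y 3 \<noteq> 0" using y1 ynz by (auto simp: a_def)
    moreover have "bform (M 1) ?R ?R = 0" "bform (M 2) ?R' ?R' = 0"
      by (simp_all add: gram w_diag a_def algebra_simps)
    moreover have "bform (M 1) ?R' ?R' = 2 * w 1 2 * a * (1 + y 2 + y 3)"
      "bform (M 2) ?R ?R = 2 * w 2 1 * a * (1 + y 1 + y 3)"
      "bform (M 1) ?R ?R' = w 1 2 * a * y 2" "bform (M 2) ?R ?R' = w 2 1 * a * y 1"
      by (simp_all add: gram w_diag a_def algebra_simps)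
    \<comment> \<open>The quantity that \<open>reflect\<close> shows to be nonzero has the factor
      \<open>1 + y 1 + y 2 + y 3\<close>.\<close>
    moreover have "(2 * w 1 2 * a * (1 + y 2 + y 3)) * (2 * w 2 1 * a * (1 + y 1 + y 3))
        - 4 * (w 1 2 * a * y 2) * (w 2 1 * a * y 1) = 4 * w 1 2 * w 2 1 * a * a * a * (1 + y 1 + y 2 + y 3)"
      by (simp add: a_def algebra_simps)
    ultimately show False
      using reflect(1)[OF U, of a "- y 3" "- y 3"] unfolding z by simp
  qed
  have "1 + sum y J \<noteq> 0" for J by (rule sum_nonzero_subset3[OF y1 y2 y3])
  then have "cube_data F M n y w"
    using y indep wnz ynz by (intro cube_dataI) auto
  moreover have "t = range (\<lambda>i. plane_of (n i))" unfolding trange pn ..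
  ultimately show thesis using that by blast
qed

section \<open>Existence\<close>

lemma orthogonal_to_two:
  fixes a b :: "complex^4"
  shows "\<exists>z. z \<noteq> 0 \<and> a \<odot> z = 0 \<and> b \<odot> z = 0"
proof -
  have pos: "\<exists>z\<in>V. z \<noteq> 0" if "vec.dim V > 0" for V :: subsp
    using that by (metis bot_nat_0.not_eq_extremum vec.dim_eq_0 singletonI subsetI insert_iff)
  have plane: "\<exists>z\<in>plane_of e. z \<noteq> 0" for e :: "complex^4"
  proof (cases "e = 0")
    case True
    have "(1 :: complex^4) \<noteq> 0" by (simp add: vec_eq_iff)
    moreover have "1 \<in> plane_of e" unfolding True plane_of_def by simp
    ultimately show ?thesis by blast
  next
    case False
    then show ?thesis using pos[of "plane_of e"] proj_plane_plane_of[of e] by (simp add: proj_plane_def)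
  qed
  consider "indep2 a b" | "a = 0" | c where "b = c *s a" unfolding indep2_iff by blast
  then have "\<exists>z\<in>plane_of a \<inter> plane_of b. z \<noteq> 0"
  proof cases
    case 1
    then show ?thesis using proj_line_inter[OF 1] by (intro pos) (simp add: proj_line_def)
  next
    case 2
    then show ?thesis using plane[of b] by (auto simp: plane_of_def)
  next
    case 3
    then show ?thesis using plane[of a] by (auto simp: plane_of_def)
  qed
  then show ?thesis by (auto simp: plane_of_def)
qed

lemma dual_triad_not_multiple:
  assumes "dual_triad F M" "i \<noteq> j" "\<And>x. M i *v x = k *s (M j *v x)"
  shows False
proof -
  have s: "symmetric_mat (M i)" "invertible (M i)" "symmetric_mat (M j)" "invertible (M j)"
    using assms(1) by (auto simp: dual_triad_def)
  have "k \<noteq> 0"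
  proof
    assume "k = 0"
    then show False using invertible_action_nonzero[OF s(2)] assms(3) by simp
  qed
  then have "quadric_of (matrix_inv (M j)) = quadric_of (matrix_inv (M i))"
    unfolding dual_eq_iff[OF s(3,4,1,2)] using assms(3) by blast
  then show False using assms(1,2) unfolding dual_triad_def inj_def by blast
qed

text \<open>
  The form below is nonzero at \<open>x\<close> if and only if no root \<open>t\<close> of \<open>t\<^sup>2 C(x,x) + 2 t p\<cdot>x + c\<close>
  satisfies \<open>t l\<cdot>x = k\<close>; it is obtained by eliminating \<open>t\<close>.
\<close>

lemma eliminated_form_not_multiple:
  fixes C D :: "complex^4^4" and p l :: "complex^4" and c k :: complex
  assumes C: "symmetric_mat C" and D: "symmetric_mat D"
    and np: "\<And>\<gamma>. \<exists>x. C *v x \<noteq> \<gamma> *s (D *v x)"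
    and p: "\<And>\<gamma>. \<not> invertible (lin_comb 1 C \<gamma> D) \<Longrightarrow> \<exists>z. lin_comb 1 C \<gamma> D *v z = 0 \<and> p \<odot> z \<noteq> 0"
    and k: "k \<noteq> 0"
  defines "R \<equiv> \<lambda>x y. k\<^sup>2 * bform C x y + k * ((p \<odot> x) * (l \<odot> y) + (l \<odot> x) * (p \<odot> y)) + c * ((l \<odot> x) * (l \<odot> y))"
  shows "symbil R" "\<exists>x y. R x y \<noteq> \<gamma> * bform D x y"
proof -
  show "symbil R"
    unfolding symbil_def R_def
    by (auto simp: bform_commute[OF C, of x y for x y] algebra_simps)
  show "\<exists>x y. R x y \<noteq> \<gamma> * bform D x y"
  proof (rule ccontr)
    assume "\<not> ?thesis"
    then have eq: "R x y = \<gamma> * bform D x y" for x y by blast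
    \<comment> \<open>If \<open>R\<close> were \<open>\<gamma>\<close> times the form of
      \<open>D\<close>, this member \<open>L\<close> of the pencil would have a form built from
      \<open>p\<close> and \<open>l\<close> alone.\<close>
    define \<delta> where "\<delta> = - \<gamma> / k\<^sup>2"
    define L where "L = lin_comb 1 C \<delta> D"
    have Lb: "k\<^sup>2 * bform L x y =
        - (k * ((p \<odot> x) * (l \<odot> y) + (l \<odot> x) * (p \<odot> y)) + c * ((l \<odot> x) * (l \<odot> y)))" for x y
    proof -
      have "k\<^sup>2 * bform L x y = k\<^sup>2 * bform C x y - \<gamma> * bform D x y"
        using k by (simp add: L_def bform_lin_comb \<delta>_def algebra_simps)
      then show ?thesis unfolding eq[symmetric] R_def by (simp add: algebra_simps)
    qed
    have L_nonzero: False if "\<And>x y. bform L x y = 0"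
    proof -
      have "L *v y = 0" for y
        by (rule dot_eqI) (metis bform_def dot_commute dot_simps(10) that)
      then have "C *v y = (- \<delta>) *s (D *v y)" for y
        by (simp add: L_def lin_comb_vector eq_neg_iff_add_eq_0)
      then show False using np by blast
    qed
    have Ls: "symmetric_mat L" unfolding L_def by (rule symmetric_lin_comb[OF C D])
    \<comment> \<open>Such a form is degenerate in dimension four, as some nonzero vector is
      orthogonal to both.\<close>
    obtain x where x: "x \<noteq> 0" "p \<odot> x = 0" "l \<odot> x = 0" using orthogonal_to_two by blast
    have "bform L x y = 0" for y using Lb[of x y] x k by simp
    then have "\<not> invertible L" using bform_nondegenerate[OF Ls] x(1) by blast
    then obtain z where z: "L *v z = 0" "p \<odot> z \<noteq> 0" using p unfolding L_def by blast
    have Lz: "k * ((p \<odot> z) * (l \<odot> y) + (l \<odot> z) * (p \<odot> y)) + c * ((l \<odot> z) * (l \<odot> y)) = 0" for y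
    proof -
      have "bform L z y = 0" unfolding bform_eq_dot[OF Ls] z(1) by simp
      then have "- (k * ((p \<odot> z) * (l \<odot> y) + (l \<odot> z) * (p \<odot> y)) + c * ((l \<odot> z) * (l \<odot> y))) = 0"
        unfolding Lb[symmetric] by simp
      then show ?thesis by (simp only: neg_equal_0_iff_equal)
    qed
    show False
    proof (cases "l \<odot> z = 0")
      case True
      then have "l \<odot> y = 0" for y using Lz[of y] k z(2) by simp
      then have "bform L x y = 0" for x y using Lb[of x y] k by simp
      then show False by (rule L_nonzero)
    next
      case False
      define m where "m = (p \<odot> z) / (l \<odot> z)"
      have "(l \<odot> z) * (2 * k * (p \<odot> z) + c * (l \<odot> z)) = 0" using Lz[of z] by (simp add: algebra_simps)
      then have ckm: "c * (l \<odot> z) = - 2 * k * (p \<odot> z)"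
        using False by (simp add: eq_neg_iff_add_eq_0 add.commute)
      \<comment> \<open>The kernel vector \<open>z\<close> forces \<open>p\<close> to be
        proportional to \<open>l\<close>, whereupon all terms of \<open>L\<close> cancel.\<close>
      have pl: "(l \<odot> z) * (p \<odot> y) = (p \<odot> z) * (l \<odot> y)" for y
      proof -
        have "k * ((l \<odot> z) * (p \<odot> y) - (p \<odot> z) * (l \<odot> y)) =
          k * ((p \<odot> z) * (l \<odot> y) + (l \<odot> z) * (p \<odot> y)) + (- 2 * k * (p \<odot> z)) * (l \<odot> y)"
          by (simp add: algebra_simps)
        also have "\<dots> = 0" using Lz[of y] unfolding ckm[symmetric] by (simp add: algebra_simps)
        finally show ?thesis using k by simp
      qed
      have "(l \<odot> z) * (k\<^sup>2 * bform L x y) = 0" for x y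
      proof -
        have "(l \<odot> z) * (k\<^sup>2 * bform L x y) = - (k * (((l \<odot> z) * (p \<odot> x)) * (l \<odot> y)
            + (l \<odot> x) * ((l \<odot> z) * (p \<odot> y))) + (c * (l \<odot> z)) * ((l \<odot> x) * (l \<odot> y)))"
          unfolding Lb by (simp add: algebra_simps)
        also have "\<dots> = 0" unfolding pl ckm by (simp add: algebra_simps)
        finally show ?thesis .
      qed
      then show False using L_nonzero False k by simp
    qed
  qed
qed

text \<open>With \<open>M 1 *v u = M 2 *v v = p\<close>, the vectors \<open>m + u\<close>,
  \<open>m - v\<close>, \<open>m\<close> have touching vectors adding up to zero for every
  \<open>m\<close>. First \<open>p\<close> and then the direction \<open>h\<close> of
  \<open>m\<close> are generic points of a cone.\<close>

lemma cube_data_exists: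
  assumes F: "pencil_family F A B"
  obtains M n y w where "cube_data F M n y w"
proof -
  obtain q :: "3 \<Rightarrow> subsp" where "inj q" "\<And>j. q j \<in> F"
    using pencil_family_three_members[OF F] by metis
  then obtain M where M: "dual_triad F M" using dual_triad_exists[OF F] by metis
  have sym: "symmetric_mat (M j)" and inv: "invertible (M j)" for j
    using M by (auto simp: dual_triad_def)
  have Msum: "M 1 *v x + M 2 *v x + M 3 *v x = 0" for x
    using M by (simp add: dual_triad_def)
  have M3: "M 3 *v x = - (M 1 *v x) - M 2 *v x" for x
    using minus_unique[OF Msum[of x]] by simp
  have inj3: "M 3 *v x = M 3 *v x' \<Longrightarrow> x = x'" for x x'
    using invertible_ker[OF inv[of 3], of "x - x'"] by (simp add: vec.diff)
  have Mform: "bform (M 1) x z + bform (M 2) x z + bform (M 3) x z = 0" for x z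
    unfolding bform_def dot_simps[symmetric] Msum by simp
  define N1 N2 where "N1 = matrix_inv (M 1)" and "N2 = matrix_inv (M 2)"
  have Ns: "symmetric_mat N1" "symmetric_mat N2" "invertible N1" "invertible N2"
    unfolding N1_def N2_def using symmetric_matrix_inv[OF sym inv] invertible_matrix_inv[OF inv] by auto
  have MN: "M 1 *v (N1 *v x) = x" "M 2 *v (N2 *v x) = x" "N1 *v (M 1 *v x) = x" "N2 *v (M 2 *v x) = x" for x
    unfolding N1_def N2_def by (simp_all add: matrix_inv_vector[OF inv])
  \<comment> \<open>Vanishing of \<open>S\<close> at \<open>p\<close> means
    \<open>p \<odot> v = - (p \<odot> u)\<close>; the isotropy conditions for \<open>m + u\<close>
    and \<open>m - v\<close> then coincide once \<open>m\<close> is isotropic for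
    \<open>M 3\<close>.\<close>
  define S where "S = lin_comb 1 N1 1 N2"
  have Sv: "S *v x = N1 *v x + N2 *v x" for x by (simp add: S_def lin_comb_vector)
  have S: "symmetric_mat S" "invertible S"
  proof -
    show "symmetric_mat S" unfolding S_def by (rule symmetric_lin_comb[OF Ns(1,2)])
    show "invertible S"
    proof (rule invertibleI_ker)
      fix x assume "S *v x = 0"
      then have e: "N2 *v x = - (N1 *v x)" unfolding Sv by (simp add: eq_neg_iff_add_eq_0 add.commute)
      have "M 2 *v (N1 *v x) = - x" using MN(2)[of x] unfolding e vec.neg by (metis minus_minus)
      then have "M 3 *v (N1 *v x) = 0" unfolding M3 MN by simp
      then have "N1 *v x = 0" using invertible_ker[OF inv] by blast
      then show "x = 0" using invertible_ker[OF Ns(3)] by blast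
    qed
  qed
  \<comment> \<open>The sum of the inverses factors because \<open>M 3\<close> is minus the sum of
    \<open>M 1\<close> and \<open>M 2\<close>.\<close>
  have S1: "S *v x = - (N1 *v (M 3 *v (N2 *v x)))" and S2: "S *v x = - (N2 *v (M 3 *v (N1 *v x)))" for x
    unfolding Sv M3 by (simp_all add: MN vec.diff vec.neg)
  have N_not_multiple: False if "\<And>x. N1 *v x = k *s (N2 *v x)" for k
  proof -
    have "M 2 *v x = k *s (M 1 *v x)" for x
      using that[of "M 2 *v x"] MN(1)[of "M 2 *v x"] by (simp add: MN vec.scale)
    from dual_triad_not_multiple[OF M _ this] show False by simp
  qed
  have N_not_multiple': False if "\<And>x. N2 *v x = k *s (N1 *v x)" for k
  proof -
    have "M 1 *v x = k *s (M 2 *v x)" for x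
      using that[of "M 1 *v x"] MN(2)[of "M 1 *v x"] by (simp add: MN vec.scale)
    from dual_triad_not_multiple[OF M _ this] show False by simp
  qed
  \<comment> \<open>Parameters of singular members; their kernel vectors must not be orthogonal to
    \<open>p\<close>, as \<open>eliminated_form_not_multiple\<close> requires.\<close>
  define \<Gamma> where "\<Gamma> = {\<gamma>. \<not> invertible (lin_comb 1 (M 1) \<gamma> (M 3))}"
  have "finite \<Gamma>" unfolding \<Gamma>_def by (rule finite_singular_lin_comb[OF inv])
  have "\<forall>\<gamma>\<in>\<Gamma>. \<exists>z. z \<noteq> 0 \<and> lin_comb 1 (M 1) \<gamma> (M 3) *v z = 0"
    using invertibleI_ker unfolding \<Gamma>_def by blast
  then obtain zz where zz: "\<And>\<gamma>. \<gamma> \<in> \<Gamma> \<Longrightarrow> zz \<gamma> \<noteq> 0 \<and> lin_comb 1 (M 1) \<gamma> (M 3) *v zz \<gamma> = 0"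
    by metis
  define R2 R3 where "R2 = (\<lambda>x y. bform (M 3) (N1 *v x) (N1 *v y))"
    and "R3 = (\<lambda>x y. bform (M 3) (N2 *v x) (N2 *v y))"
  \<comment> \<open>At \<open>p\<close> the first three forms are twice the weights
    \<open>w 1 3\<close>, \<open>w 3 1\<close> and \<open>w 3 2\<close>.\<close>
  define I where "I = {bform N1, R2, R3} \<union> (\<lambda>\<gamma> x y. (zz \<gamma> \<odot> x) * (zz \<gamma> \<odot> y)) ` \<Gamma>"
  have "\<exists>p. bform S p p = 0 \<and> (\<forall>R\<in>I. R p p \<noteq> 0)"
  proof (rule cone_generic[OF S, where R = "\<lambda>R. R"])
    show "finite I" using \<open>finite \<Gamma>\<close> by (simp add: I_def)
    fix R assume R: "R \<in> I"
    have "symbil R2" "symbil R3"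
      unfolding R2_def R3_def symbil_def
      by (auto simp: vec.add vec.scale bform_commute[OF sym, of _ "N1 *v x" "N1 *v y" for x y] bform_commute[OF sym, of _ "N2 *v x" "N2 *v y" for x y])
    then show "symbil R"
      using R symbil_bform[OF Ns(1)] symbil_dot_sq unfolding I_def by blast
    fix c
    have R1: "\<exists>x y. bform N1 x y \<noteq> c * bform S x y"
    proof (rule ccontr)
      assume "\<not> ?thesis"
      then have e: "N1 *v y = c *s (S *v y)" for y using bform_multiple_iff[of N1 c S] by blast
      show False
      proof (cases "c = 0")
        case True
        then show False using e invertible_action_nonzero[OF Ns(3)] by simp
      next
        case False
        have "N2 *v y = ((1 - c) / c) *s (N1 *v y)" for y
        proof -
          have "c *s (N2 *v y) = (1 - c) *s (N1 *v y)"
            using e[of y] unfolding Sv by (simp add: vec.scale_right_distrib vec.scale_left_diff_distrib algebra_simps)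
          then have "(1 / c) *s (c *s (N2 *v y)) = (1 / c) *s ((1 - c) *s (N1 *v y))" by simp
          then show ?thesis using False unfolding vec.scale_scale by simp
        qed
        then show False by (rule N_not_multiple')
      qed
    qed
    have R2': "\<exists>x y. R2 x y \<noteq> c * bform S x y"
    proof (rule ccontr)
      assume "\<not> ?thesis"
      then have e: "R2 x y = c * bform S x y" for x y by blast
      \<comment> \<open>In the factorization \<open>S1\<close> the common factors \<open>N1\<close>
        and \<open>M 3\<close> cancel.\<close>
      have "N1 *v y = (- c) *s (N2 *v y)" for y
      proof -
        have "N1 *v (M 3 *v (N1 *v y)) = c *s (S *v y)"
        proof (rule dot_eqI)
          fix x
          show "(N1 *v (M 3 *v (N1 *v y))) \<odot> x = (c *s (S *v y)) \<odot> x"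
            using e[of x y] unfolding R2_def bform_def[of "M 3"] bform_def[of S]
            by (metis bform_def bform_eq_dot[OF Ns(1)] dot_commute dot_simps(7))
        qed
        also have "\<dots> = N1 *v (M 3 *v ((- c) *s (N2 *v y)))" unfolding S1 by (simp add: vec.scale vec.neg)
        finally have "M 3 *v (N1 *v y) = M 3 *v ((- c) *s (N2 *v y))" by (metis MN(1))
        then show ?thesis by (rule inj3)
      qed
      then show False by (rule N_not_multiple)
    qed
    have R3': "\<exists>x y. R3 x y \<noteq> c * bform S x y"
    proof (rule ccontr)
      assume "\<not> ?thesis"
      then have e: "R3 x y = c * bform S x y" for x y by blast
      have "N2 *v y = (- c) *s (N1 *v y)" for y
      proof -
        have "N2 *v (M 3 *v (N2 *v y)) = c *s (S *v y)"
        proof (rule dot_eqI)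
          fix x
          show "(N2 *v (M 3 *v (N2 *v y))) \<odot> x = (c *s (S *v y)) \<odot> x"
            using e[of x y] unfolding R3_def bform_def[of "M 3"] bform_def[of S]
            by (metis bform_def bform_eq_dot[OF Ns(2)] dot_commute dot_simps(7))
        qed
        also have "\<dots> = N2 *v (M 3 *v ((- c) *s (N1 *v y)))" unfolding S2 by (simp add: vec.scale vec.neg)
        finally have "M 3 *v (N2 *v y) = M 3 *v ((- c) *s (N1 *v y))" by (metis MN(2))
        then show ?thesis by (rule inj3)
      qed
      then show False by (rule N_not_multiple')
    qed
    have R4: "\<exists>x y. (zz \<gamma> \<odot> x) * (zz \<gamma> \<odot> y) \<noteq> c * bform S x y" if "\<gamma> \<in> \<Gamma>" for \<gamma>
      using dot_sq_not_multiple[OF S] zz[OF that] by blast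
    show "\<exists>x y. R x y \<noteq> c * bform S x y"
      using R R1 R2' R3' R4 unfolding I_def by blast
  qed
  then obtain p where p: "bform S p p = 0" "\<And>R. R \<in> I \<Longrightarrow> R p p \<noteq> 0" by blast
  define u v where "u = N1 *v p" and "v = N2 *v p"
  define c where "c = p \<odot> u"
  have M1u: "M 1 *v u = p" and M2v: "M 2 *v v = p" by (simp_all add: u_def v_def MN)
  have c0: "c \<noteq> 0" using p(2)[of "bform N1"] by (simp add: I_def c_def u_def bform_def)
  have q3u: "bform (M 3) u u \<noteq> 0" using p(2)[of R2] by (simp add: I_def R2_def u_def)
  have q3v: "bform (M 3) v v \<noteq> 0" using p(2)[of R3] by (simp add: I_def R3_def v_def)
  have pv: "p \<odot> v = - c"
    using p(1) by (simp add: bform_def Sv c_def u_def v_def eq_neg_iff_add_eq_0 add.commute)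
  have b1u: "bform (M 1) u x = p \<odot> x" "bform (M 1) x u = p \<odot> x" for x
    using bform_eq_dot[OF sym, of 1 u x] bform_commute[OF sym, of 1 u x] M1u by simp_all
  have b2v: "bform (M 2) v x = p \<odot> x" "bform (M 2) x v = p \<odot> x" for x
    using bform_eq_dot[OF sym, of 2 v x] bform_commute[OF sym, of 2 v x] M2v by simp_all
  have uv: "indep2 u v"
    unfolding indep2_iff
  proof (intro conjI allI notI)
    show "u = 0 \<Longrightarrow> False" using c0 by (simp add: c_def)
    fix k assume k: "v = k *s u"
    then have "- c = k * c" using pv by (simp add: c_def)
    then have "k = - 1" using c0 by (metis mult_minus1 mult_right_cancel)
    then have "v = - u" using k by simp
    then have "M 2 *v u = - p" using M2v by (simp add: vec.neg) (metis minus_minus)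
    then have "M 3 *v u = 0" unfolding M3 M1u by simp
    then show False using q3u by (simp add: bform_def)
  qed
  have kernel: "\<exists>z. lin_comb 1 (M 1) \<gamma> (M 3) *v z = 0 \<and> p \<odot> z \<noteq> 0"
    if "\<not> invertible (lin_comb 1 (M 1) \<gamma> (M 3))" for \<gamma>
  proof -
    have g: "\<gamma> \<in> \<Gamma>" using that by (simp add: \<Gamma>_def)
    then have "(\<lambda>x y. (zz \<gamma> \<odot> x) * (zz \<gamma> \<odot> y)) \<in> I" unfolding I_def by blast
    from p(2)[OF this] have "p \<odot> zz \<gamma> \<noteq> 0" by (simp add: dot_commute)
    then show ?thesis using zz[OF g] by blast
  qed
  have np13: "\<exists>x. M 1 *v x \<noteq> \<gamma> *s (M 3 *v x)" for \<gamma>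
    using dual_triad_not_multiple[OF M, of 1 3 \<gamma>] by auto
  \<comment> \<open>If \<open>z \<odot> m\<close> is nonzero, pairing with \<open>z\<close> isolates
    the coefficient of \<open>m\<close> in a linear relation.\<close>
  obtain z where z: "z \<noteq> 0" "u \<odot> z = 0" "v \<odot> z = 0" using orthogonal_to_two by blast
  \<comment> \<open>The linear parts of \<open>y 1\<close>, \<open>y 2\<close>, \<open>y 3\<close>
    as affine functions of \<open>m\<close>.\<close>
  define l1 l2 l3 where "l1 = (2 / bform (M 3) u u) *s (M 3 *v u)"
    and "l2 = (- 2 / bform (M 3) v v) *s (M 3 *v v)" and "l3 = (- 2 / c) *s p"
  have l0: "l1 \<noteq> 0" "l2 \<noteq> 0"
  proof -
    have "M 3 *v u \<noteq> 0" "M 3 *v v \<noteq> 0" using q3u q3v by (auto simp: bform_def)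
    then show "l1 \<noteq> 0" "l2 \<noteq> 0" using q3u q3v by (simp_all add: l1_def l2_def)
  qed
  define Rk where "Rk = (\<lambda>(l, k) x y. k\<^sup>2 * bform (M 1) x y + k * ((p \<odot> x) * (l \<odot> y) + (l \<odot> x) * (p \<odot> y))
      + c * ((l \<odot> x) * (l \<odot> y)))"
  \<comment> \<open>A pair \<open>(l, k)\<close> stands for a forbidden value
    \<open>l \<odot> m = k\<close>. In order, these are the zeros of \<open>1 + y 1\<close>,
    \<open>1 + y 2\<close>, \<open>y 3\<close>, \<open>1 + y 3\<close>, the sums with two indices
    and the full sum.\<close>
  define K where "K = {(l1, -1), (l2, -1), (l3, 2), (l3, 1), (l1 + l2, -1), (l1 + l3, 1), (l2 + l3, 1),
      (l1 + l2 + l3, 1 :: complex)}"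
  define I' where "I' = {bform (M 1), (\<lambda>x y. (z \<odot> x) * (z \<odot> y)), (\<lambda>x y. (l1 \<odot> x) * (l1 \<odot> y)),
      (\<lambda>x y. (l2 \<odot> x) * (l2 \<odot> y))} \<union> Rk ` K"
  have "\<exists>h. bform (M 3) h h = 0 \<and> (\<forall>R\<in>I'. R h h \<noteq> 0)"
  proof (rule cone_generic[OF sym inv, where R = "\<lambda>R. R"])
    show "finite I'" by (simp add: I'_def K_def)
    have RK: "symbil (Rk lk)" "\<exists>x y. Rk lk x y \<noteq> d * bform (M 3) x y" if lk: "lk \<in> K" for lk d
    proof -
      obtain l k where e: "lk = (l, k)" by (rule prod.exhaust)
      have k: "k \<noteq> 0" using lk unfolding e K_def by auto
      note el = eliminated_form_not_multiple[OF sym sym np13 kernel k, of l c]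
      show "symbil (Rk lk)" unfolding e Rk_def prod.case by (rule el(1))
      show "\<exists>x y. Rk lk x y \<noteq> d * bform (M 3) x y" unfolding e Rk_def prod.case by (rule el(2)[of d])
    qed
    fix R assume R: "R \<in> I'"
    then show "symbil R"
      unfolding I'_def using symbil_bform[OF sym] symbil_dot_sq RK(1) by blast
    fix d
    have "\<exists>x y. bform (M 1) x y \<noteq> d * bform (M 3) x y"
      using np13[of d] bform_multiple_iff[of "M 1" d "M 3"] by blast
    then show "\<exists>x y. R x y \<noteq> d * bform (M 3) x y"
      using R dot_sq_not_multiple[OF sym inv] z(1) l0 RK(2) unfolding I'_def by blast
  qed
  then obtain h where h: "bform (M 3) h h = 0" "\<And>R. R \<in> I' \<Longrightarrow> R h h \<noteq> 0" by blast
  have a0: "bform (M 1) h h \<noteq> 0" using h(2)[of "bform (M 1)"] by (simp add: I'_def)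
  \<comment> \<open>Isotropy of \<open>m + u\<close> for \<open>M 1\<close> fixes the scale of
    \<open>m\<close> along \<open>h\<close>.\<close>
  obtain t where t: "bform (M 1) h h * t\<^sup>2 + 2 * (p \<odot> h) * t + c = 0"
    using quadratic_root[OF a0] by blast
  have t0: "t \<noteq> 0" using t c0 by auto
  have zh: "z \<odot> h \<noteq> 0" using h(2)[of "\<lambda>x y. (z \<odot> x) * (z \<odot> y)"] by (simp add: I'_def)
  have lh: "l1 \<odot> h \<noteq> 0" "l2 \<odot> h \<noteq> 0"
    using h(2)[of "\<lambda>x y. (l1 \<odot> x) * (l1 \<odot> y)"] h(2)[of "\<lambda>x y. (l2 \<odot> x) * (l2 \<odot> y)"]
    by (simp_all add: I'_def)
  define m where "m = t *s h"
  have lk: "l \<odot> m \<noteq> k" if "(l, k) \<in> K" for l k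
  proof
    assume e: "l \<odot> m = k"
    have "Rk (l, k) \<in> I'" using that by (simp add: I'_def)
    from h(2)[OF this] have "Rk (l, k) h h \<noteq> 0" .
    \<comment> \<open>Substituting \<open>k = t * (l \<odot> h)\<close> turns the eliminated form
      into a multiple of the equation for \<open>t\<close>.\<close>
    moreover have "Rk (l, k) h h = (l \<odot> h) * (l \<odot> h) * (bform (M 1) h h * t\<^sup>2 + 2 * (p \<odot> h) * t + c)"
      unfolding Rk_def e[symmetric] m_def by (simp add: power2_eq_square algebra_simps)
    ultimately show False unfolding t by simp
  qed
  have m1: "bform (M 1) m m + 2 * (p \<odot> m) + c = 0"
    using t by (simp add: m_def power2_eq_square algebra_simps)
  have m3: "bform (M 3) m m = 0" by (simp add: m_def h(1))
  have m2: "bform (M 2) m m = - bform (M 1) m m"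
    using Mform[of m m] m3 by (simp add: eq_neg_iff_add_eq_0 add.commute)
  define n where "n = (\<lambda>i::3. if i = 1 then m + u else if i = 2 then m - v else m)"
  have n: "n 1 = m + u" "n 2 = m - v" "n 3 = m" by (simp_all add: n_def)
  define w where "w = (\<lambda>j i. bform (M j) (n i - n j) (n i - n j) / 2)"
  define y where "y = (\<lambda>i::3. if i = 1 then l1 \<odot> m else if i = 2 then l2 \<odot> m else - 2 + l3 \<odot> m)"
  have y: "y 1 = l1 \<odot> m" "y 2 = l2 \<odot> m" "y 3 = - 2 + l3 \<odot> m" by (simp_all add: y_def)
  interpret triad_points F M n w
  proof
    show "dual_triad F M" by (rule M)
    show "M 1 *v n 1 + M 2 *v n 2 + M 3 *v n 3 = 0"
      using Msum[of m] by (simp add: n vec.add vec.diff M1u M2v algebra_simps)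
    show "bform (M j) (n j) (n j) = 0" for j
    proof -
      have "bform (M 1) (n 1) (n 1) = 0" using m1 by (simp add: n b1u c_def[symmetric] algebra_simps)
      moreover have "bform (M 2) (n 2) (n 2) = - (bform (M 1) m m + 2 * (p \<odot> m) + c)"
        by (simp add: n b2v m2 pv algebra_simps)
      then have "bform (M 2) (n 2) (n 2) = 0" unfolding m1 by simp
      moreover have "bform (M 3) (n 3) (n 3) = 0" by (simp add: n m3)
      ultimately show ?thesis using exhaust_3[of j] by auto
    qed
    show "w j i = bform (M j) (n i - n j) (n i - n j) / 2" for j i by (simp add: w_def)
  qed
  have w31: "w 3 1 = bform (M 3) u u / 2" and w32: "w 3 2 = bform (M 3) v v / 2" and w13: "w 1 3 = c / 2"
    by (simp_all add: w_def n b1u c_def)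
  have U: "UNIV = {1, 3, 2 :: 3}" "UNIV = {2, 3, 1 :: 3}" "UNIV = {3, 1, 2 :: 3}" using UNIV_3 by auto
  have wopp: "w 2 1 = - w 3 1" "w 1 2 = - w 3 2" "w 2 3 = - w 1 3"
    using w_opposite(1)[OF U(1)] w_opposite(1)[OF U(2)] w_opposite(1)[OF U(3)] by simp_all
  have "w 3 1 \<noteq> 0" "w 3 2 \<noteq> 0" "w 1 3 \<noteq> 0" using q3u q3v c0 by (simp_all add: w31 w32 w13)
  then have wnz: "w j i \<noteq> 0" if "i \<noteq> j" for i j
    using that exhaust_3[of i] exhaust_3[of j] by (auto simp: wopp)
  have wy: "w 3 1 * y 1 = bform (M 3) (n 1) (n 3)" "w 3 2 * y 2 = bform (M 3) (n 2) (n 3)"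
    "w 1 3 * y 3 = bform (M 1) (n 3) (n 1)"
  proof -
    show "w 3 1 * y 1 = bform (M 3) (n 1) (n 3)"
      using q3u by (simp add: w31 y l1_def n m3 bform_eq_dot[OF sym, of 3 u m])
    show "w 3 2 * y 2 = bform (M 3) (n 2) (n 3)"
      using q3v by (simp add: w32 y l2_def n m3 bform_eq_dot[OF sym, of 3 v m])
    \<comment> \<open>The equation \<open>m1\<close> replaces the quadratic expression in
      \<open>m\<close> by an affine one.\<close>
    have "w 1 3 * y 3 = - c - p \<odot> m" using c0 by (simp add: w13 y l3_def algebra_simps)
    moreover have "bform (M 1) (n 3) (n 1) - (- c - p \<odot> m) = bform (M 1) m m + 2 * (p \<odot> m) + c"
      by (simp add: n b1u)
    then have "- c - p \<odot> m = bform (M 1) (n 3) (n 1)" unfolding m1 by simp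
    ultimately show "w 1 3 * y 3 = bform (M 1) (n 3) (n 1)" by (rule trans)
  qed
  have "\<exists>j. j \<noteq> i \<and> w j i * y i = bform (M j) (n i) (n j)" for i
  proof -
    consider "i = 1" | "i = 2" | "i = 3" using exhaust_3[of i] by blast
    then show ?thesis
    proof cases
      case 1 then show ?thesis using wy(1) by (intro exI[of _ 3]) auto
    next
      case 2 then show ?thesis using wy(2) by (intro exI[of _ 3]) auto
    next
      case 3 then show ?thesis using wy(3) by (intro exI[of _ 1]) auto
    qed
  qed
  moreover have "d i = 0" if d: "(\<Sum>k\<in>UNIV. d k *s n k) = 0" for d i
  proof -
    have e: "(d 1 + d 2 + d 3) *s m + (d 1 *s u + (- d 2) *s v) = 0"
      using d by (simp add: sum_3 n vec.scale_left_distrib vec.scale_right_distrib vec.scale_right_diff_distrib algebra_simps)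
    have "z \<odot> ((d 1 + d 2 + d 3) *s m + (d 1 *s u + (- d 2) *s v)) = 0" unfolding e by simp
    then have s: "d 1 + d 2 + d 3 = 0"
      using zh t0 z by (simp add: m_def dot_commute[of z u] dot_commute[of z v])
    then have "d 1 *s u + (- d 2) *s v = 0" using e by simp
    then have "d 1 = 0 \<and> - d 2 = 0" using uv unfolding indep2_def by blast
    then show ?thesis using s exhaust_3[of i] by auto
  qed
  moreover have "y i \<noteq> 0" for i
  proof -
    have "y 1 \<noteq> 0" "y 2 \<noteq> 0" using lh t0 by (simp_all add: y m_def)
    moreover have "y 3 \<noteq> 0" using lk[of l3 2] by (simp add: y K_def)
    ultimately show ?thesis using exhaust_3[of i] by auto
  qed
  moreover have "1 + sum y J \<noteq> 0" for J
  proof (rule sum_nonzero_subset3)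
    have 1: "1 + y 1 \<noteq> 0" "1 + y 2 \<noteq> 0" "1 + y 3 \<noteq> 0"
      using lk[of l1 "-1"] lk[of l2 "-1"] lk[of l3 1] by (auto simp: y K_def add_eq_0_iff)
    then show "1 + y i \<noteq> 0" for i using exhaust_3[of i] by auto
    have "1 + y 1 + y 2 \<noteq> 0" "1 + y 1 + y 3 \<noteq> 0" "1 + y 2 + y 3 \<noteq> 0"
      using lk[of "l1 + l2" "-1"] lk[of "l1 + l3" 1] lk[of "l2 + l3" 1]
      by (auto simp: y K_def add_eq_0_iff algebra_simps)
    then show "1 + y i + y j \<noteq> 0" if "i \<noteq> j" for i j
      using that exhaust_3[of i] exhaust_3[of j] by (auto simp: add.assoc add.commute add.left_commute)
    show "1 + y 1 + y 2 + y 3 \<noteq> 0"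
      using lk[of "l1 + l2 + l3" 1] by (auto simp: y K_def add_eq_0_iff algebra_simps)
  qed
  ultimately have "cube_data F M n y w" using wnz by (intro cube_dataI) auto
  then show thesis by (rule that)
qed

theorem theorem10:
  fixes F :: "subsp set"
  assumes "confocal_family F"
  shows "(\<exists>S T U. twelve_plane_configuration F S T U \<and> linked T U) \<and>
         (\<forall>t Q X. tangent_triplet F t Q X \<and> general_position t Q \<longrightarrow>
            (\<exists>!(S, T, U). twelve_plane_configuration F S T U \<and> linked T U \<and> t \<in> T))"
proof (intro conjI allI impI)
  obtain A B where F: "pencil_family F A B" using confocal_familyE[OF assms] .
  obtain M n y w where "cube_data F M n y w" using cube_data_exists[OF F] .
  then interpret cube_data F M n y w .
  show "\<exists>S T U. twelve_plane_configuration F S T U \<and> linked T U"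
    using configuration cube_linked[OF cube_axioms] by blast
next
  fix t Q X assume t: "tangent_triplet F t Q X \<and> general_position t Q"
  obtain A B where F: "pencil_family F A B" using confocal_familyE[OF assms] .
  obtain M n y w where D: "cube_data F M n y w" and tn: "t = range (\<lambda>i. plane_of (n i))"
    using general_triplet_cube_data[OF F] t by metis
  show "\<exists>!(S, T, U). twelve_plane_configuration F S T U \<and> linked T U \<and> t \<in> T"
    unfolding tn by (rule cube_data.unique_configuration[OF D])
qed

end
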